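(* Let $G$ be a finite group, $H$ a subgroup of $G$ of index $s\ge 2$, $H_1$ a subgroup of $H$ of index $d\ge 1$, and $U$ an $H_1$-module of dimension $a$ over a field $\mathbb{F}$. Let $V:=U\uparrow^H_{H_1}$ and $W:=V\uparrow^G_H$ be the induced modules. Let $\Omega$ be the set of right cosets of $H$ in $G$ and $\Omega_1$ the set of right cosets of $H_1$ in $H$. Let $K:=\mathrm{core}_G(H)$, let $K'$ be a subgroup of $K$, and let $$m:=\min\{\chi(Q,\Omega_1) : Q\le K' \text{ and } V \text{ is semisimple as an } \mathbb{F}[Q]\text{-module}\}.$$ Suppose that $G^{\Omega}$ (the permutation group induced by $G$ on $\Omega$) contains a soluble transitive subgroup, and let $M$ be a submodule of $W$. Let $\chi:=\chi(K,V^{*})$ be the number of orbits of $K$ on the set $V^*$ of non-zero elements of $V$. Then $$d_G(M)\le \min\left\{\frac{ad-am}{R_{\mathbb{F}}(K')}+am,\ \chi\right\}\widetilde{\omega}(s)\le \min\left\{\frac{ad-am}{R_{\mathbb{F}}(K')}+am,\ \chi\right\}\left\lfloor \frac{bs}{\sqrt{\log s}}\right\rfloor,$$ where $b:=\sqrt{2/\pi}$. Furthermore, if $s=p^t$ with $p$ prime, then $$d_G(M)\le \min\left\{\frac{ad-am}{R_{\mathbb{F}}(K')}+am,\ \chi\right\}\left\lfloor \frac{bp^t}{\sqrt{t(p-1)}}\right\rfloor.$$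
   Context: $d_G(M)$ is the minimal number of elements required to generate $M$ as an $\mathbb{F}[G]$-module. For a group $X$ acting on a set $\Sigma$, $\chi(X,\Sigma)$ is the number of orbits of $X$ on $\Sigma$. For a non-trivial finite group $X$, $R_{\mathbb{F}}(X)$ is the smallest dimension of a non-trivial representation of $X$ over $\mathbb{F}$. If $K$ has infinitely many orbits on the non-zero elements of $V$, the minimum is taken to be its first entry $\frac{ad-am}{R_{\mathbb{F}}(K')}+am$. For a positive integer $s$ with prime factorisation $s=p_1^{r_1}\cdots p_l^{r_l}$, $K(s):=\sum_i r_i(p_i-1)$ and $\widetilde{\omega}(s):=\frac{s}{2^{K(s)}}\binom{K(s)}{\lfloor K(s)/2\rfloor}$. $\log$ is logarithm to base $2$.
   Formalization: The second inequality of the displayed chain is false for s = 3 and s = 6 when V is non-zero (3/2 > 1, 9/4 > 2), so it is stated only for other s; both bounds on d_G(M) are proved for all s ≥ 2. *)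

theory Defs
  imports
    Complex_Main
    "HOL-Algebra.Group_Action"
    "HOL-Algebra.Solvable_Groups"
    "HOL-Library.Function_Algebras"
    "HOL-Computational_Algebra.Primes"
    "Jordan_Normal_Form.Matrix"
begin

section \<open>Modules over group algebras\<close>

text \<open>
  Groups are those of HOL-Algebra, the ground field is a type of class field, and a (left)
  module for the group algebra of \<open>G\<close> is a subspace \<open>V\<close> of an ambient vector space together
  with a linear action of \<open>G\<close> on \<open>V\<close>. Nothing is assumed about \<open>act\<close> outside \<open>carrier G\<close> and \<open>V\<close>.
  Restriction to a subgroup \<open>Q\<close> is obtained by replacing \<open>G\<close> by \<open>G\<lparr>carrier := Q\<rparr>\<close>.
\<close>

locale rep_module = group G + vector_space scale
  for G :: "('g, 'r) monoid_scheme" (structure)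
    and scale :: "'f::field \<Rightarrow> 'v::ab_group_add \<Rightarrow> 'v" +
  fixes act :: "'g \<Rightarrow> 'v \<Rightarrow> 'v" and V :: "'v set"
  assumes subspace_V: "subspace V"
    and act_closed: "\<lbrakk>g \<in> carrier G; v \<in> V\<rbrakk> \<Longrightarrow> act g v \<in> V"
    and act_add: "\<lbrakk>g \<in> carrier G; v \<in> V; w \<in> V\<rbrakk> \<Longrightarrow> act g (v + w) = act g v + act g w"
    and act_scale: "\<lbrakk>g \<in> carrier G; v \<in> V\<rbrakk> \<Longrightarrow> act g (scale c v) = scale c (act g v)"
    and act_one: "v \<in> V \<Longrightarrow> act \<one> v = v"
    and act_mult: "\<lbrakk>g \<in> carrier G; h \<in> carrier G; v \<in> V\<rbrakk> \<Longrightarrow> act (g \<otimes> h) v = act g (act h v)"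

text \<open>
  The qualified constants below are those of the HOL library locale \<open>module\<close> of vector spaces, not
  of its HOL-Algebra namesake.
\<close>

definition has_dim :: "('f::field \<Rightarrow> 'v::ab_group_add \<Rightarrow> 'v) \<Rightarrow> 'v set \<Rightarrow> nat \<Rightarrow> bool" where
  "has_dim scale V a \<longleftrightarrow>
     (\<exists>B\<subseteq>V. finite B \<and> \<not> Modules.module.dependent scale B \<and>
             Modules.module.span scale B = V \<and> card B = a)"

definition is_submodule ::
    "('f::field \<Rightarrow> 'v::ab_group_add \<Rightarrow> 'v) \<Rightarrow> ('g, 'r) monoid_scheme \<Rightarrow> ('g \<Rightarrow> 'v \<Rightarrow> 'v) \<Rightarrow>
      'v set \<Rightarrow> 'v set \<Rightarrow> bool" where
  "is_submodule scale G act N V \<longleftrightarrow>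
     Modules.module.subspace scale N \<and> N \<subseteq> V \<and> (\<forall>g\<in>carrier G. \<forall>v\<in>N. act g v \<in> N)"

definition irreducible_submodule ::
    "('f::field \<Rightarrow> 'v::ab_group_add \<Rightarrow> 'v) \<Rightarrow> ('g, 'r) monoid_scheme \<Rightarrow> ('g \<Rightarrow> 'v \<Rightarrow> 'v) \<Rightarrow>
      'v set \<Rightarrow> 'v set \<Rightarrow> bool" where
  "irreducible_submodule scale G act N V \<longleftrightarrow>
     is_submodule scale G act N V \<and> N \<noteq> {0} \<and>
     (\<forall>N'. is_submodule scale G act N' N \<longrightarrow> N' = {0} \<or> N' = N)"

text \<open>Semisimple: an internal direct sum of irreducible submodules.\<close>

definition semisimple_module ::
    "('f::field \<Rightarrow> 'v::ab_group_add \<Rightarrow> 'v) \<Rightarrow> ('g, 'r) monoid_scheme \<Rightarrow> ('g \<Rightarrow> 'v \<Rightarrow> 'v) \<Rightarrow>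
      'v set \<Rightarrow> bool" where
  "semisimple_module scale G act V \<longleftrightarrow>
     (\<exists>\<S>. (\<forall>N\<in>\<S>. irreducible_submodule scale G act N V) \<and>
          (\<forall>N\<in>\<S>. N \<inter> Modules.module.span scale (\<Union>(\<S> - {N})) = {0}) \<and>
          Modules.module.span scale (\<Union>\<S>) = V)"

definition generated_submodule ::
    "('f::field \<Rightarrow> 'v::ab_group_add \<Rightarrow> 'v) \<Rightarrow> ('g, 'r) monoid_scheme \<Rightarrow> ('g \<Rightarrow> 'v \<Rightarrow> 'v) \<Rightarrow>
      'v set \<Rightarrow> 'v set \<Rightarrow> 'v set" where
  "generated_submodule scale G act M S = (\<lambda>N. is_submodule scale G act N M) hull S"

definition min_generators ::
    "('f::field \<Rightarrow> 'v::ab_group_add \<Rightarrow> 'v) \<Rightarrow> ('g, 'r) monoid_scheme \<Rightarrow> ('g \<Rightarrow> 'v \<Rightarrow> 'v) \<Rightarrow>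
      'v set \<Rightarrow> nat" where
  "min_generators scale G act M =
     (LEAST n. \<exists>S\<subseteq>M. finite S \<and> card S = n \<and> generated_submodule scale G act M S = M)"

section \<open>Induced modules\<close>

definition fun_scale :: "('f \<Rightarrow> 'v \<Rightarrow> 'v) \<Rightarrow> 'f \<Rightarrow> ('g \<Rightarrow> 'v) \<Rightarrow> 'g \<Rightarrow> 'v" where
  "fun_scale scale c f = (\<lambda>x. scale c (f x))"

text \<open>
  The induced module in Frobenius' form: the functions \<open>f\<close> from \<open>G\<close> to \<open>V\<close> with
  \<open>f (h x) = h (f x)\<close> for \<open>h\<close> in \<open>H\<close>, on which \<open>G\<close> acts by right translation. For a finite group,
  \<open>f\<close> corresponds to the element \<open>\<Sum>x\<in>T. x\<inverse> \<otimes> f x\<close> of the tensor product of the group algebra of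
  \<open>G\<close> with \<open>V\<close> over the group algebra of \<open>H\<close>, for any set \<open>T\<close> of representatives of the right cosets
  \<open>H x\<close>. Functions are normalised to be 0 outside \<open>carrier G\<close>, so that \<open>induced\<close> is a subspace of
  a function type.
\<close>

definition induced ::
    "('g, 'r) monoid_scheme \<Rightarrow> 'g set \<Rightarrow> ('g \<Rightarrow> 'v \<Rightarrow> 'v) \<Rightarrow> 'v::zero set \<Rightarrow> ('g \<Rightarrow> 'v) set" where
  "induced G H act V =
     {f. (\<forall>x\<in>carrier G. f x \<in> V) \<and> (\<forall>x. x \<notin> carrier G \<longrightarrow> f x = 0) \<and>
         (\<forall>h\<in>H. \<forall>x\<in>carrier G. f (h \<otimes>\<^bsub>G\<^esub> x) = act h (f x))}"

definition induced_act ::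
    "('g, 'r) monoid_scheme \<Rightarrow> 'g \<Rightarrow> ('g \<Rightarrow> 'v::zero) \<Rightarrow> 'g \<Rightarrow> 'v" where
  "induced_act G g f = (\<lambda>x. if x \<in> carrier G then f (x \<otimes>\<^bsub>G\<^esub> g) else 0)"

lemma vector_space_fun_scale:
  assumes "vector_space scale"
  shows "vector_space (fun_scale scale)"
proof -
  interpret vector_space scale by fact
  show ?thesis
    by unfold_locales (auto simp: fun_scale_def fun_eq_iff scale_right_distrib scale_left_distrib)
qed

lemma rep_module_induced:
  fixes G :: "('g, 'r) monoid_scheme" and scale :: "'f::field \<Rightarrow> 'v::ab_group_add \<Rightarrow> 'v"
  assumes "group G" and H: "subgroup H G" and "rep_module (G\<lparr>carrier := H\<rparr>) scale act V"
  shows "rep_module G (fun_scale scale) (induced_act G) (induced G H act V)"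
proof -
  interpret G: group G by fact
  interpret V: rep_module "G\<lparr>carrier := H\<rparr>" scale act V by fact
  interpret F: vector_space "fun_scale scale"
    by (rule vector_space_fun_scale) (rule V.vector_space_axioms)
  have HG: "h \<in> carrier G" if "h \<in> H" for h
    using subgroup.subset[OF H] that by auto
  have z: "act h 0 = 0" if "h \<in> H" for h
    using V.act_scale[of h 0 0] V.subspace_0[OF V.subspace_V] that by simp
  show ?thesis
  proof unfold_locales
    show "F.subspace (induced G H act V)"
      unfolding F.subspace_def induced_def
      using z V.act_add V.act_scale V.subspace_0[OF V.subspace_V]
        V.subspace_add[OF V.subspace_V] V.subspace_scale[OF V.subspace_V]
      by (auto simp: fun_scale_def HG)
  qed (auto simp: induced_def induced_act_def fun_scale_def fun_eq_iff G.m_assoc HG)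
qed

section \<open>Group-theoretic notions\<close>

definition core :: "('g, 'r) monoid_scheme \<Rightarrow> 'g set \<Rightarrow> 'g set" where
  "core G H = (\<Inter>g\<in>carrier G. g <#\<^bsub>G\<^esub> H #>\<^bsub>G\<^esub> inv\<^bsub>G\<^esub> g)"

definition num_orbits ::
    "('g, 'r) monoid_scheme \<Rightarrow> 'g set \<Rightarrow> 'a set \<Rightarrow> ('g \<Rightarrow> 'a \<Rightarrow> 'a) \<Rightarrow> nat" where
  "num_orbits G X \<Sigma> \<phi> = card (orbits (G\<lparr>carrier := X\<rparr>) \<Sigma> \<phi>)"

text \<open>
  HOL-Algebra actions are left actions, so \<open>g\<close> sends a right coset \<open>C\<close> to \<open>C g\<inverse>\<close>. Orbits and the
  induced permutation group are the same as for right multiplication by \<open>g\<close>.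
\<close>

definition coset_act :: "('g, 'r) monoid_scheme \<Rightarrow> 'g \<Rightarrow> 'g set \<Rightarrow> 'g set" where
  "coset_act G g C = C #>\<^bsub>G\<^esub> inv\<^bsub>G\<^esub> g"

definition coset_perm_group :: "('g, 'r) monoid_scheme \<Rightarrow> 'g set \<Rightarrow> ('g set \<Rightarrow> 'g set) set" where
  "coset_perm_group G H = (\<lambda>g. restrict (coset_act G g) (rcosets\<^bsub>G\<^esub> H)) ` carrier G"

definition has_soluble_transitive_subgroup :: "'a set \<Rightarrow> ('a \<Rightarrow> 'a) set \<Rightarrow> bool" where
  "has_soluble_transitive_subgroup \<Omega> P \<longleftrightarrow>
     (\<exists>T\<subseteq>P. subgroup T (BijGroup \<Omega>) \<and> solvable (BijGroup \<Omega>\<lparr>carrier := T\<rparr>) \<and>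
        (\<forall>x\<in>\<Omega>. \<forall>y\<in>\<Omega>. \<exists>t\<in>T. t x = y))"

text \<open>
  \<open>rep_min_dim TYPE('f) X\<close> is the least degree of a homomorphism from \<open>X\<close> to a general linear group
  over the field that is not identically 1. It is meaningful for non-trivial finite \<open>X\<close> only; for
  trivial \<open>X\<close> there is no such homomorphism and the value is unspecified.
\<close>

definition rep_min_dim :: "'f::field itself \<Rightarrow> ('g, 'r) monoid_scheme \<Rightarrow> nat" where
  "rep_min_dim ty X =
     (LEAST n. \<exists>\<rho> \<in> hom X (units_of (ring_mat ty n ())). \<exists>x\<in>carrier X. \<rho> x \<noteq> 1\<^sub>m n)"

text \<open>The minimum of \<open>x\<close> and the number of orbits in \<open>Os\<close>, the latter being possibly infinite.\<close>

definition min_card :: "real \<Rightarrow> 'a set \<Rightarrow> real" where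
  "min_card x Os = (if finite Os then min x (real (card Os)) else x)"

section \<open>The arithmetic functions\<close>

definition K_fun :: "nat \<Rightarrow> nat" where
  "K_fun s = (\<Sum>p\<in>prime_factors s. multiplicity p s * (p - 1))"

definition omega_tilde :: "nat \<Rightarrow> real" where
  "omega_tilde s = real s / 2 ^ K_fun s * real (K_fun s choose (K_fun s div 2))"

text \<open>
  Writing \<open>F s\<close> for the integer part of \<open>sqrt (2/pi) * s / sqrt (log 2 s)\<close>, the inequality
  \<open>omega_tilde s \<le> F s\<close> holds for all \<open>s \<ge> 2\<close> except 3 and 6, where \<open>omega_tilde\<close> is not an integer:
  \<open>omega_tilde 3 = 3/2\<close> and \<open>F 3 = 1\<close>, \<open>omega_tilde 6 = 9/4\<close> and \<open>F 6 = 2\<close>.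
\<close>

end

theory Submission
  imports Defs "HOL-Analysis.Gamma_Function" "HOL-Real_Asymp.Real_Asymp" "HOL-Algebra.Multiplicative_Group"
begin

text \<open>
  Refining a soluble series through a transitive subgroup gives a transversal of the right cosets of
  \<open>H\<close> indexed by a product of chains of prime lengths, with a linear order extending the product order,
  such that going up in the product order is realised by a translation that respects the linear order.
  The leading coefficients of a submodule \<open>M\<close> of the induced module therefore form submodules of \<open>V\<close> for
  \<open>K\<close> that increase along the product order. Along each chain of a symmetric chain decomposition,
  generators are needed only where the leading coefficients grow. Their number is bounded by the number of
  orbits on non-zero vectors, since the new coefficients lie in different orbits, and by the length of
  \<open>V\<close> as a module for \<open>K'\<close>. In the latter, the trivial factors are counted by the fixed vectors
  of \<open>Q\<close>, and all others have dimension at least \<open>R\<close>. The number of chains is the middle coefficient of a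
  product of polynomials \<open>1 + x + \<dots> + x\<^bsup>p - 1\<^esup>\<close>, which is compared with that of a power of \<open>1 + x\<close>.
\<close>

section \<open>The function \<open>omega_tilde\<close>\<close>

text \<open>Two points shape the details. Firstly, \<open>omega_tilde s\<close> is in general not an
  integer, while the number of chains is. The bound on the number of generators is therefore rounded
  down through the number of chains, for every \<open>s\<close>, whereas comparing
  \<open>omega_tilde s\<close> itself with the rounded value requires room for a loss of up to 1. If
  \<open>s\<close> is not a power of 2, the room comes from the factor 3/4 between
  \<open>2 ^ K_fun s\<close> and \<open>s\<close>: it lowers log 2 (s) below the exponent by log 2
  (4/3), about 2/5. Powers of 2 leave no such room, but there \<open>omega_tilde s\<close> is an
  integer. Secondly, leading coefficients form modules for \<open>K\<close> only: an element of
  \<open>K\<close> fixes every coset of \<open>H\<close>, an element of \<open>H\<close> may permute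
  them. Both entries of the minimum bound the length of the same kind of list, whose entries lie
  outside the submodule generated by their predecessors. This property passes from \<open>K\<close>
  to \<open>K'\<close> at once, and the trivial and non-trivial steps of the resulting chain of
  submodules can be counted separately without refining it to a composition series.\<close>

lemma central_binomial_Suc:
  "real ((2 * Suc n) choose (Suc n)) * real (n + 1) = 2 * real (2 * n + 1) * real ((2 * n) choose n)"
proof -
  have 1: "Suc n * ((2 * Suc n) choose Suc n) = (2 * Suc n) * ((2 * n + 1) choose n)"
    using Suc_times_binomial_eq[of "2 * n + 1" n] by (simp add: mult.commute)
  have 2: "Suc n * ((2 * n + 1) choose n) = (2 * n + 1) * ((2 * n) choose n)"
    using binomial_absorb_comp[of "2 * n + 1" n] by simp
  have "Suc n * (Suc n * ((2 * Suc n) choose Suc n)) = Suc n * (2 * ((2 * n + 1) * ((2 * n) choose n)))"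
    using 1 2 by (metis (no_types, lifting) mult.assoc mult.left_commute)
  then have "Suc n * ((2 * Suc n) choose Suc n) = 2 * ((2 * n + 1) * ((2 * n) choose n))"
    by (metis Suc_not_Zero mult_cancel1)
  note E = this
  define B where "B = (2 * Suc n) choose Suc n"
  define C where "C = (2 * n) choose n"
  have "Suc n * B = 2 * ((2 * n + 1) * C)" unfolding B_def C_def by (rule E)
  then have "real (Suc n * B) = real (2 * ((2 * n + 1) * C))" by (simp only:)
  then have "real (n + 1) * real B = 2 * (real (2 * n + 1) * real C)"
    by (simp only: of_nat_mult Suc_eq_plus1 of_nat_numeral)
  then show ?thesis by (simp only: B_def C_def mult_ac)
qed

text \<open>Ties the central binomial coefficient to pi through the product of Wallis; the constant
  \<open>sqrt (2 / pi)\<close> of the theorem enters here.\<close>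

lemma wallis_central_binomial:
  "(\<Prod>k=1..n. (4 * real k ^ 2) / (4 * real k ^ 2 - 1)) =
     16 ^ n / (real ((2 * n) choose n) ^ 2 * real (2 * n + 1))"
proof (induction n)
  case (Suc n)
  define c where "c = real ((2 * n) choose n)"
  define c' where "c' = real ((2 * Suc n) choose Suc n)"
  have c0: "c > 0" by (simp add: c_def)
  have c': "c' = 2 * real (2 * n + 1) * c / real (n + 1)"
    using central_binomial_Suc[of n] by (simp add: c_def c'_def field_simps)
  have e: "4 * real (Suc n) ^ 2 - 1 = real (2 * n + 1) * real (2 * n + 3)"
    by (simp add: power2_eq_square algebra_simps)
  have "(\<Prod>k=1..Suc n. (4 * real k ^ 2) / (4 * real k ^ 2 - 1)) =
          16 ^ n / (c ^ 2 * real (2 * n + 1)) * ((4 * real (Suc n) ^ 2) / (4 * real (Suc n) ^ 2 - 1))"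
    using Suc.IH by (simp add: c_def)
  also have "\<dots> = 16 ^ Suc n / (c' ^ 2 * real (2 * Suc n + 1))"
  proof -
    have "16 ^ n / (c ^ 2 * u) * ((4 * v ^ 2) / (u * w)) = 16 * 16 ^ n / ((2 * u * c / v) ^ 2 * w)"
      if "u > 0" "v > 0" "w > 0" for u v w :: real
      using that c0 by (simp add: field_simps power2_eq_square)
    from this[of "real (2 * n + 1)" "real (n + 1)" "real (2 * n + 3)"]
    show ?thesis unfolding e c' by (simp add: algebra_simps)
  qed
  finally show ?case by (simp only: c'_def)
qed simp

text \<open>By Wallis, the quotient \<open>f n\<close> below decreases to pi. With 4 n + 1 in place
  of 4 n it also matches the next asymptotic term, so that n = 4 is already enough for
  \<open>pi \<le> 63 / 20\<close>.\<close>

lemma central_binomial_pi_bound: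
  "real ((2 * n) choose n) ^ 2 * real (4 * n + 1) * pi \<le> 4 * 16 ^ n"
proof -
  define c where "c n = real ((2 * n) choose n)" for n
  have c0: "c n > 0" for n by (simp add: c_def)
  define f where "f n = 4 * 16 ^ n / (c n ^ 2 * real (4 * n + 1))" for n
  have dec: "f (Suc n) \<le> f n" for n
  proof -
    have c': "c (Suc n) = 2 * real (2 * n + 1) * c n / real (n + 1)"
      using central_binomial_Suc[of n] by (simp add: c_def field_simps)
    have "f (Suc n) = 4 * 16 ^ n / (c n ^ 2) * (16 * real (n+1)^2 / (4 * real (2*n+1)^2 * real (4 * n + 5)))"
    proof -
      have "4 * (16 * 16 ^ n) / ((2 * u * c n / v) ^ 2 * w) = 4 * 16 ^ n / (c n ^ 2) * (16 * v ^ 2 / (4 * u ^ 2 * w))"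
        if "u > 0" "v > 0" "w > 0" for u v w :: real
        using that c0[of n] by (simp add: field_simps power2_eq_square)
      from this[of "real (2 * n + 1)" "real (n + 1)" "real (4 * n + 5)"]
      show ?thesis unfolding f_def c' by (simp add: algebra_simps)
    qed
    also have "\<dots> \<le> 4 * 16 ^ n / (c n ^ 2) * (1 / real (4 * n + 1))"
    proof (rule mult_left_mono)
      \<comment> \<open>After clearing denominators the sides differ by 1 only: 4 (n + 1)^2 (4 n +
        1) + 1 = (2 n + 1)^2 (4 n + 5).\<close>
      show "16 * real (n+1)^2 / (4 * real (2*n+1)^2 * real (4 * n + 5)) \<le> 1 / real (4 * n + 1)"
        by (simp add: divide_simps) (simp add: algebra_simps power2_eq_square)
    qed simp
    finally show ?thesis by (simp add: f_def)
  qed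
  have lim: "f \<longlonglongrightarrow> pi"
  proof -
    have "(\<lambda>n. (\<Prod>k=1..n. (4 * real k ^ 2) / (4 * real k ^ 2 - 1)) * (4 * real (2 * n + 1) / real (4 * n + 1)))
             \<longlonglongrightarrow> pi / 2 * 2"
    proof (intro tendsto_mult wallis)
      show "(\<lambda>n. 4 * real (2 * n + 1) / real (4 * n + 1)) \<longlonglongrightarrow> 2"
        by real_asymp
    qed
    moreover have "(\<Prod>k=1..n. (4 * real k ^ 2) / (4 * real k ^ 2 - 1)) * (4 * real (2 * n + 1) / real (4 * n + 1)) = f n" for n
    proof -
      have "x / (y * u) * (4 * u / w) = 4 * x / (y * w)" if "u \<noteq> 0" for x y u w :: real
        using that by simp
      from this[of "real (2 * n + 1)"] show ?thesis
        unfolding wallis_central_binomial f_def c_def by simp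
    qed
    ultimately show ?thesis by simp
  qed
  have "decseq f" using dec by (simp add: decseq_Suc_iff)
  then have "pi \<le> f n" using lim by (rule decseq_ge)
  then have "pi * (c n ^ 2 * real (4 * n + 1)) \<le> 4 * 16 ^ n"
    using c0[of n] by (simp add: f_def pos_le_divide_eq)
  then show ?thesis by (simp add: c_def mult.commute mult.left_commute)
qed

text \<open>The probability of the most likely number of heads in \<open>n\<close> tosses of a fair
  coin. As \<open>omega_tilde s\<close> is \<open>s\<close> times its value at
  \<open>K_fun s\<close>, and it decreases, upper bounds for \<open>omega_tilde\<close> follow from
  lower bounds for \<open>K_fun\<close>.\<close>

definition central_prob :: "nat \<Rightarrow> real" where
  "central_prob n = real (n choose (n div 2)) / 2 ^ n"

lemma central_prob_Suc_le: "central_prob (Suc n) \<le> central_prob n"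
proof -
  have "Suc n choose (Suc n div 2) \<le> 2 * (n choose (n div 2))"
  proof (cases "Suc n div 2")
    case (Suc k)
    have "Suc n choose Suc k = (n choose k) + (n choose Suc k)" by simp
    also have "\<dots> \<le> 2 * (n choose (n div 2))"
      using binomial_maximum[of n k] binomial_maximum[of n "Suc k"] by linarith
    finally show ?thesis by (simp add: Suc)
  qed (auto simp: Suc_le_eq)
  then have "real (Suc n choose (Suc n div 2)) \<le> 2 * real (n choose (n div 2))"
    by (metis of_nat_le_iff of_nat_mult of_nat_numeral)
  then show ?thesis by (simp add: central_prob_def field_simps)
qed

lemma central_prob_antimono: "m \<le> n \<Longrightarrow> central_prob n \<le> central_prob m"
  by (induction rule: dec_induct) (use central_prob_Suc_le order.trans in blast)+

lemma central_prob_pos: "central_prob n > 0"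
  by (simp add: central_prob_def)

lemma central_prob_even: "central_prob (2 * n) ^ 2 * (2 * real n) \<le> 2 / pi"
proof -
  define c where "c = real ((2 * n) choose n)"
  have "c ^ 2 * (4 * real n) * pi \<le> c ^ 2 * real (4 * n + 1) * pi"
    by (intro mult_right_mono mult_left_mono) auto
  also have "\<dots> \<le> 4 * 16 ^ n" using central_binomial_pi_bound[of n] by (simp only: c_def)
  finally have *: "c ^ 2 * real n * pi \<le> 16 ^ n" by simp
  have p: "((2::real) ^ (2 * n)) ^ 2 = 16 ^ n"
    by (simp add: power_mult power2_eq_square flip: power_mult_distrib)
  have "central_prob (2 * n) ^ 2 * (2 * real n) = c ^ 2 / 16 ^ n * (2 * real n)"
    by (simp add: central_prob_def c_def power_divide p)
  also have "\<dots> \<le> 2 / pi"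
    using * by (simp add: field_simps)
  finally show ?thesis .
qed

lemma central_prob_le:
  assumes "n \<ge> 1"
  shows "central_prob n \<le> sqrt (2 / pi) / sqrt (real n)"
proof -
  have "central_prob n ^ 2 * real n \<le> 2 / pi"
  proof (cases "even n")
    case True
    then show ?thesis using central_prob_even[of "n div 2"] by (auto elim!: evenE)
  next
    case False
    then obtain k where n: "n = 2 * k + 1" by (auto elim: oddE)
    \<comment> \<open>An odd number of tosses has the same value as the next even number, so the
      bound for even numbers carries over without loss.\<close>
    have eq: "central_prob n = central_prob (2 * Suc k)"
    proof -
      have "(2 * Suc k) choose (Suc k) = 2 * (n choose k)"
        using binomial_symmetric[of k "2 * k + 1"] by (simp add: n)
      then show ?thesis by (simp add: central_prob_def n)
    qed
    have "central_prob n ^ 2 * real n \<le> central_prob (2 * Suc k) ^ 2 * (2 * real (Suc k))"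
      unfolding eq by (intro mult_left_mono) (auto simp: n)
    also have "\<dots> \<le> 2 / pi" by (rule central_prob_even)
    finally show ?thesis .
  qed
  then have "sqrt (central_prob n ^ 2 * real n) \<le> sqrt (2 / pi)" by simp
  then have "central_prob n * sqrt (real n) \<le> sqrt (2 / pi)"
    using central_prob_pos[of n] by (simp add: real_sqrt_mult)
  then show ?thesis using assms by (simp add: field_simps)
qed

lemma pi_le_315: "pi \<le> 63 / 20"
proof -
  have "((2 * 4) choose 4) = (70::nat)" by (simp add: binomial_fact' fact_numeral)
  then show ?thesis using central_binomial_pi_bound[of 4] by simp
qed

section \<open>Prime factorisations and \<open>K_fun\<close>\<close>

lemma K_fun_prod_list:
  assumes "\<forall>k\<in>set ks. prime k"
  shows "K_fun (prod_list ks) = (\<Sum>k\<leftarrow>ks. k - 1)"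
proof -
  have pf: "prime_factorization (prod_list ks) = mset ks"
    using assms prime_factorization_prod_mset_primes[of "mset ks"] by (simp add: prod_mset_prod_list)
  have nz: "prod_list ks \<noteq> 0" using assms by (auto simp: prod_list_zero_iff)
  have "K_fun (prod_list ks) = (\<Sum>p\<in>set ks. count_list ks p * (p - 1))"
    unfolding K_fun_def
  proof (rule sum.cong)
    show "prime_factors (prod_list ks) = set ks" by (simp add: pf)
    fix p assume "p \<in> set ks"
    then have "multiplicity p (prod_list ks) = count (prime_factorization (prod_list ks)) p"
      using assms by (simp add: count_prime_factorization_prime)
    then show "multiplicity p (prod_list ks) * (p - 1) = count_list ks p * (p - 1)"
      by (simp add: pf count_mset)
  qed
  also have "\<dots> = (\<Sum>k\<leftarrow>ks. k - 1)"
    by (simp add: sum_list_map_eq_sum_count)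
  finally show ?thesis .
qed

lemma obtain_prime_list:
  assumes "s > (0::nat)"
  obtains ks where "\<forall>k\<in>set ks. prime k" "prod_list ks = s"
proof -
  obtain ks where ks: "mset ks = prime_factorization s" using ex_mset by blast
  have "prod_list ks = s"
    using prod_mset_prime_factorization_nat[OF assms] ks by (metis prod_mset_prod_list)
  moreover have "\<forall>k\<in>set ks. prime k"
    using ks by (metis in_prime_factors_imp_prime set_mset_mset)
  ultimately show ?thesis using that by blast
qed

text \<open>Equality holds for 2 only in the first bound and for 3 only in the second, which is the
  source of the factor 3/4.\<close>

lemma prime_le_two_power:
  assumes "prime (k::nat)"
  shows "k \<le> 2 ^ (k - 1)" and "k \<noteq> 2 \<Longrightarrow> 4 * k \<le> 3 * 2 ^ (k - 1)"
proof -
  have *: "k \<ge> 1" using assms prime_ge_1_nat by blast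
  obtain n where n: "k = Suc n" using * by (metis Suc_le_D One_nat_def)
  have "Suc n \<le> 2 ^ n" by (induction n) auto
  then show "k \<le> 2 ^ (k - 1)" by (simp add: n)
  assume "k \<noteq> 2"
  then have "n \<ge> 2" using n assms prime_ge_2_nat[OF assms] by linarith
  then have "4 * Suc n \<le> 3 * 2 ^ n" by (induction n rule: dec_induct) auto
  then show "4 * k \<le> 3 * 2 ^ (k - 1)" by (simp add: n)
qed

lemma prod_primes_le_two_power:
  assumes "\<forall>k\<in>set ks. prime (k::nat)"
  shows "prod_list ks \<le> 2 ^ (\<Sum>k\<leftarrow>ks. k - 1)"
    and "\<exists>k\<in>set ks. k \<noteq> 2 \<Longrightarrow> 4 * prod_list ks \<le> 3 * 2 ^ (\<Sum>k\<leftarrow>ks. k - 1)"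
  using assms
proof (induction ks)
  case (Cons k ks)
  {
    case 1
    then show ?case
      using Cons.IH(1) prime_le_two_power(1)[of k] by (auto simp: power_add intro: mult_mono)
  next
    case 2
    show ?case
    proof (cases "k = 2")
      case True
      then have "4 * prod_list ks \<le> 3 * 2 ^ (\<Sum>k\<leftarrow>ks. k - 1)" using Cons.IH(2) 2 by auto
      then show ?thesis using True by simp
    next
      case False
      have "4 * k \<le> 3 * 2 ^ (k - 1)" "prod_list ks \<le> 2 ^ (\<Sum>k\<leftarrow>ks. k - 1)"
        using prime_le_two_power(2)[of k] False 2(2) Cons.IH(1) by auto
      from mult_le_mono[OF this] have "(4 * k) * prod_list ks \<le> (3 * 2 ^ (k - 1)) * 2 ^ (\<Sum>k\<leftarrow>ks. k - 1)" .
      then show ?thesis by (simp add: power_add mult.assoc)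
    qed
  }
qed auto

lemma omega_tilde_eq: "omega_tilde s = real s * central_prob (K_fun s)"
  by (simp add: omega_tilde_def central_prob_def)

text \<open>One odd prime factor suffices for the factor 3/4, since every other prime k contributes
  k / 2^(k - 1), which is at most 1.\<close>

lemma le_two_power_K_fun:
  assumes "s > 0"
  shows "s \<le> 2 ^ K_fun s" and "\<nexists>t. s = 2 ^ t \<Longrightarrow> 4 * s \<le> 3 * 2 ^ K_fun s"
proof -
  obtain ks where ks: "\<forall>k\<in>set ks. prime k" "prod_list ks = s"
    using obtain_prime_list[OF assms] .
  have K: "K_fun s = (\<Sum>k\<leftarrow>ks. k - 1)" using K_fun_prod_list[OF ks(1)] ks(2) by simp
  show "s \<le> 2 ^ K_fun s" using prod_primes_le_two_power(1)[OF ks(1)] by (simp add: K ks)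
  assume *: "\<nexists>t. s = 2 ^ t"
  have "\<exists>k\<in>set ks. k \<noteq> 2"
  proof (rule ccontr)
    assume "\<not> ?thesis"
    then have "ks = replicate (length ks) 2"
      by (metis replicate_eqI)
    then have "prod_list ks = 2 ^ length ks" by (metis prod_list_replicate)
    with * ks show False by blast
  qed
  then show "4 * s \<le> 3 * 2 ^ K_fun s" using prod_primes_le_two_power(2)[OF ks(1)] by (simp add: K ks)
qed

lemma K_fun_prime_power:
  assumes "prime p"
  shows "K_fun (p ^ t) = t * (p - 1)"
  using K_fun_prod_list[of "replicate t p"] assms by (simp add: sum_list_replicate)

lemma omega_tilde_le:
  assumes "s \<ge> 2"
  shows "omega_tilde s \<le> sqrt (2 / pi) * real s / sqrt (real (K_fun s))"
proof -
  have "K_fun s \<ge> 1"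
    using le_two_power_K_fun(1)[of s] assms by (cases "K_fun s") auto
  from mult_left_mono[OF central_prob_le[OF this], of "real s"] show ?thesis
    by (simp add: omega_tilde_eq mult.commute)
qed

lemma omega_tilde_le_log:
  assumes "s \<ge> 2"
  shows "omega_tilde s \<le> sqrt (2 / pi) * real s / sqrt (log 2 (real s))"
proof -
  have "real s \<le> 2 ^ K_fun s"
    using of_nat_mono[OF le_two_power_K_fun(1)[of s], where 'a = real] assms by simp
  then have "log 2 (real s) \<le> real (K_fun s)"
    using assms by (simp add: log_le_iff powr_realpow)
  moreover have "log 2 (real s) > 0" using assms by simp
  ultimately have "sqrt (2 / pi) * real s / sqrt (real (K_fun s)) \<le> sqrt (2 / pi) * real s / sqrt (log 2 (real s))"
    by (intro divide_left_mono) auto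
  with omega_tilde_le[OF assms] show ?thesis by linarith
qed


section \<open>Comparison of \<open>omega_tilde\<close> with an integer part\<close>

lemma K_fun_ge:
  assumes "\<nexists>t. s = 2 ^ t" "3 * 2 ^ j < 8 * s"
  shows "j \<le> K_fun s"
proof -
  have "2 * (4 * s) \<le> 2 * (3 * 2 ^ K_fun s)"
    using le_two_power_K_fun(2)[OF _ assms(1)] assms(2) by (intro mult_left_mono) auto
  with assms(2) have "3 * 2 ^ j < (3 * 2 ^ Suc (K_fun s) :: nat)" by simp
  then have "(2::nat) ^ j < 2 ^ Suc (K_fun s)" by linarith
  then have "j < Suc (K_fun s)" by (rule power_less_imp_less_exp[rotated]) simp
  then show ?thesis by simp
qed

text \<open>The fraction \<open>u / v\<close> is an upper bound for log 2 (s), certified by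
  \<open>s ^ v \<le> 2 ^ u\<close>. Squaring the claim and using \<open>pi \<le> 63 / 20\<close>
  leaves a rational condition on \<open>x\<close>, so that concrete cases become arithmetic.\<close>

lemma le_floor_log_bound:
  assumes "s \<ge> 2" "s ^ v \<le> 2 ^ u" "v > 0" "x\<^sup>2 * 63 * real u \<le> 40 * real s ^ 2 * real v" "x \<ge> 0"
  shows "x \<le> sqrt (2 / pi) * real s / sqrt (log 2 (real s))"
proof -
  have "real s ^ v \<le> 2 ^ u"
    using of_nat_mono[OF assms(2), where 'a = real] by simp
  then have "log 2 (real s ^ v) \<le> log 2 (2 ^ u)"
    using assms(1) by (subst log_le_cancel_iff) auto
  then have l: "log 2 (real s) \<le> real u / real v"
    using assms(1,3) by (simp add: log_nat_power field_simps)
  have l0: "log 2 (real s) > 0" using assms(1) by simp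
  have "x\<^sup>2 * log 2 (real s) * pi \<le> x\<^sup>2 * (real u / real v) * (63 / 20)"
    using l l0 pi_le_315 assms(1) by (intro mult_mono mult_left_mono) auto
  also have "\<dots> \<le> 2 * real s ^ 2"
    using assms(3,4) by (simp add: field_simps)
  finally have "x\<^sup>2 * log 2 (real s) \<le> 2 / pi * real s ^ 2"
    by (simp add: field_simps)
  then have "sqrt (x\<^sup>2 * log 2 (real s)) \<le> sqrt (2 / pi * real s ^ 2)"
    by (rule real_sqrt_le_mono)
  moreover have "sqrt (x\<^sup>2 * log 2 (real s)) = x * sqrt (log 2 (real s))"
    using assms(5) by (subst real_sqrt_mult) simp
  moreover have "sqrt (2 / pi * real s ^ 2) = sqrt (2 / pi) * real s"
    by (subst real_sqrt_mult) simp
  ultimately have "x * sqrt (log 2 (real s)) \<le> sqrt (2 / pi) * real s"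
    by (simp only:)
  then show ?thesis using l0 by (simp add: field_simps)
qed

text \<open>For concrete \<open>s\<close>: the integer \<open>n\<close> separates
  \<open>s * central_prob j\<close>, and hence \<open>omega_tilde s\<close>, from the bound before
  rounding.\<close>

lemma omega_tilde_le_floor_nat:
  assumes "s \<ge> 2" "s ^ v \<le> 2 ^ u" "v > 0" "n\<^sup>2 * 63 * u \<le> 40 * s ^ 2 * v"
    and "j \<le> K_fun s" "real s * central_prob j \<le> real n"
  shows "omega_tilde s \<le> real_of_int \<lfloor>sqrt (2 / pi) * real s / sqrt (log 2 (real s))\<rfloor>"
proof -
  have "real (n\<^sup>2 * 63 * u) \<le> real (40 * s ^ 2 * v)" using assms(4) of_nat_le_iff by blast
  then have "real n \<le> sqrt (2 / pi) * real s / sqrt (log 2 (real s))"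
    by (intro le_floor_log_bound[OF assms(1-3)]) simp_all
  then have "int n \<le> \<lfloor>sqrt (2 / pi) * real s / sqrt (log 2 (real s))\<rfloor>"
    by (simp add: le_floor_iff)
  then have "real n \<le> real_of_int \<lfloor>sqrt (2 / pi) * real s / sqrt (log 2 (real s))\<rfloor>"
    by linarith
  moreover have "omega_tilde s \<le> real s * central_prob j"
    unfolding omega_tilde_eq using assms(5) by (intro mult_left_mono central_prob_antimono) auto
  ultimately show ?thesis using assms(6) by linarith
qed

text \<open>
  Here \<open>u / v\<close> is an upper bound for \<open>log 2 S\<close>, and \<open>\<theta>\<close> a lower bound for
  \<open>sqrt (2 / pi) / sqrt (u / v)\<close>, by \<open>pi \<le> 63 / 20\<close>.
\<close>

lemma omega_tilde_le_floor_gap: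
  assumes "s \<ge> 2" "s \<le> S" "S ^ v \<le> 2 ^ u" "v > 0" "\<theta>\<^sup>2 * 63 * real u \<le> 40 * real v" "\<theta> \<ge> 0"
    and "j \<le> K_fun s" "1 \<le> real s * (\<theta> - central_prob j)"
  shows "omega_tilde s \<le> real_of_int \<lfloor>sqrt (2 / pi) * real s / sqrt (log 2 (real s))\<rfloor>"
proof -
  have "s ^ v \<le> 2 ^ u" using power_mono[OF assms(2), of v] assms(3) by linarith
  moreover have "(real s * \<theta>)\<^sup>2 * 63 * real u \<le> 40 * real s ^ 2 * real v"
    using mult_left_mono[OF assms(5), of "real s ^ 2"] by (simp add: power_mult_distrib mult_ac)
  ultimately have "real s * \<theta> \<le> sqrt (2 / pi) * real s / sqrt (log 2 (real s))"
    using assms(6) by (intro le_floor_log_bound[OF assms(1) _ assms(4)]) simp_all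
  moreover have "omega_tilde s \<le> real s * central_prob j"
    unfolding omega_tilde_eq using assms(7) by (intro mult_left_mono central_prob_antimono) auto
  ultimately show ?thesis using assms(8) by (simp add: right_diff_distrib) linarith
qed

lemma omega_tilde_le_floor_large:
  assumes "s > 192" "\<nexists>t. s = 2 ^ t"
  shows "omega_tilde s \<le> real_of_int \<lfloor>sqrt (2 / pi) * real s / sqrt (log 2 (real s))\<rfloor>"
proof -
  \<comment> \<open>Thus 3/8 * 2^j < s \<le> 3/4 * 2^j. The lower bound makes \<open>s\<close> large
    compared with powers of \<open>j\<close>, the upper one keeps log 2 (s) away from
    \<open>j\<close>.\<close>
  define j where "j = (LEAST j. 4 * s \<le> 3 * 2 ^ j)"
  have "4 * s \<le> 3 * 2 ^ K_fun s" using le_two_power_K_fun(2)[OF _ assms(2)] assms(1) by simp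
  then have j: "4 * s \<le> 3 * 2 ^ j" unfolding j_def by (rule LeastI)
  have j9: "j \<ge> 9"
  proof (rule ccontr)
    assume "\<not> ?thesis"
    then have "(2::nat) ^ j \<le> 2 ^ 8" by (intro power_increasing) auto
    with j assms(1) show False by simp
  qed
  then obtain i where i: "j = Suc i" by (metis Suc_le_D eval_nat_numeral(3))
  have "\<not> 4 * s \<le> 3 * 2 ^ i" using not_less_Least[of i "\<lambda>j. 4 * s \<le> 3 * 2 ^ j"] by (simp add: i flip: j_def)
  then have s_lb: "3 * 2 ^ j < 8 * s" by (simp add: i)
  have Kj: "j \<le> K_fun s" using K_fun_ge[OF assms(2) s_lb] .
  \<comment> \<open>The constant 280 is what turns 9 * 4^j \<le> 64 * s^2 into 25 * j^3 \<le> 40/63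
    * s^2 below. The inequality fails at 8 and starts to hold at 9, hence the threshold 192 = 3/4 *
    2^8 for \<open>s\<close>.\<close>
  have pow: "280 * j ^ 3 \<le> 4 ^ j"
    using j9
  proof (induction j rule: dec_induct)
    case (step n)
    have "(n + 1) ^ 3 \<le> 4 * n ^ 3"
    proof -
      have "8 * (n + 1) \<le> 10 * n" using step by simp
      then have "(8 * (n + 1)) ^ 3 \<le> (10 * n) ^ 3" by (intro power_mono) auto
      moreover have "(8 * (n + 1)) ^ 3 = 512 * (n + 1) ^ 3" "(10 * n) ^ 3 = 1000 * n ^ 3"
        by (subst power_mult_distrib, simp)+
      ultimately show ?thesis by linarith
    qed
    then show ?case using step.IH by simp
  qed simp
  have j0: "real j > 0" using j9 by simp
  \<comment> \<open>The number 2/5 is a lower bound for log 2 (4/3), because (3/4)^5 is less than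
    1/4.\<close>
  have lj: "log 2 (real s) \<le> real j - 2 / 5"
  proof -
    have "(4 * s) ^ 5 \<le> (3 * 2 ^ j) ^ 5" using j by (intro power_mono) auto
    then have "1024 * s ^ 5 \<le> 243 * 2 ^ (j * 5)" by (simp add: power_mult_distrib power_mult)
    then have "4 * s ^ 5 \<le> 2 ^ (5 * j)" by (simp add: mult.commute)
    then have "real (4 * s ^ 5) \<le> real (2 ^ (5 * j))" using of_nat_le_iff by blast
    then have "log 2 (4 * real s ^ 5) \<le> log 2 (2 ^ (5 * j))"
      using assms by (subst log_le_cancel_iff) auto
    moreover have "log 2 (4 * real s ^ 5) = 2 + 5 * log 2 (real s)"
    proof -
      have "log 2 (2 ^ 2 :: real) = 2" by (subst log_nat_power) auto
      then have "log 2 (4 :: real) = 2" by simp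
      then show ?thesis using assms(1) by (simp add: log_mult log_nat_power)
    qed
    ultimately show ?thesis by (simp add: log_nat_power)
  qed
  define b where "b = sqrt (2 / pi)"
  define y where "y = sqrt (real j)"
  have b0: "b > 0" and y0: "y > 0" using j0 by (auto simp: b_def y_def)
  have b2: "b\<^sup>2 \<ge> 40 / 63" using pi_le_315 by (simp add: b_def field_simps)
  have y2: "y\<^sup>2 = real j" by (simp add: y_def)
  \<comment> \<open>First-order expansion of the inverse square root: lowering \<open>j\<close> by
    2/5 gains the relative amount 1 / (5 j).\<close>
  have 1: "(1 + 1 / (5 * real j)) / y \<le> 1 / sqrt (real j - 2 / 5)"
  proof -
    have "((1 + 1 / (5 * real j)) * sqrt (real j - 2 / 5))\<^sup>2 = (1 + 1 / (5 * real j))\<^sup>2 * (real j - 2 / 5)"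
      using j9 by (simp add: power_mult_distrib)
    also have "\<dots> \<le> real j"
      using j0 by (simp add: field_simps power2_eq_square)
    finally have "((1 + 1 / (5 * real j)) * sqrt (real j - 2 / 5))\<^sup>2 \<le> y\<^sup>2" by (simp add: y2)
    then have "(1 + 1 / (5 * real j)) * sqrt (real j - 2 / 5) \<le> y"
      using y0 by (metis less_le power2_le_imp_le)
    then show ?thesis using y0 j9 by (simp add: field_simps)
  qed
  \<comment> \<open>In absolute terms the gain is at least 1, which pays for rounding down.\<close>
  have 2: "1 \<le> b * real s * (1 / (5 * real j)) / y"
  proof -
    have "(3 * 2 ^ j) ^ 2 \<le> (8 * s) ^ 2" using s_lb by (intro power_mono) auto
    then have "9 * 4 ^ j \<le> 64 * s ^ 2" 
    proof -
      have "((2::nat) ^ j)\<^sup>2 = 4 ^ j"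
        by (simp add: power2_eq_square flip: power_mult_distrib)
      with \<open>(3 * 2 ^ j) ^ 2 \<le> (8 * s) ^ 2\<close> show ?thesis by (simp add: power_mult_distrib)
    qed
    then have "9 * 280 * j ^ 3 \<le> 64 * s ^ 2" using pow by linarith
    then have "real (9 * 280 * j ^ 3) \<le> real (64 * s ^ 2)" using of_nat_le_iff by blast
    then have "25 * real j ^ 3 \<le> 40 / 63 * real s ^ 2" by simp
    also have "\<dots> \<le> b\<^sup>2 * real s ^ 2" using b2 by (intro mult_right_mono) auto
    also have "\<dots> = (b * real s) ^ 2" by (simp add: power_mult_distrib)
    also have "25 * real j ^ 3 = (5 * real j * y) ^ 2"
      by (simp add: power_mult_distrib y2) (simp add: power3_eq_cube power2_eq_square)
    finally have "5 * real j * y \<le> b * real s"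
      by (rule power2_le_imp_le) (use b0 in simp)
    then show ?thesis using y0 j0 by (simp add: field_simps)
  qed
  have "omega_tilde s \<le> real s * central_prob j"
    unfolding omega_tilde_eq using Kj by (intro mult_left_mono central_prob_antimono) auto
  also have "\<dots> \<le> real s * (b / y)"
    using central_prob_le[of j] j9 unfolding b_def y_def by (intro mult_left_mono) auto
  finally have "omega_tilde s + 1 \<le> real s * (b / y) + b * real s * (1 / (5 * real j)) / y"
    using 2 by linarith
  also have "\<dots> = b * real s * ((1 + 1 / (5 * real j)) / y)"
    by (simp add: add_divide_distrib distrib_left mult.commute)
  finally have "omega_tilde s + 1 \<le> b * real s * ((1 + 1 / (5 * real j)) / y)" .
  also have "\<dots> \<le> b * real s * (1 / sqrt (real j - 2 / 5))"
    using 1 b0 by (intro mult_left_mono) auto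
  also have "\<dots> \<le> b * real s / sqrt (log 2 (real s))"
    using lj b0 j9 assms(1) by (auto intro!: divide_left_mono mult_pos_pos)
  finally show ?thesis unfolding b_def by linarith
qed

lemma omega_tilde_le_floor:
  assumes "s \<ge> 2" "s \<noteq> 3" "s \<noteq> 6"
  shows "omega_tilde s \<le> real_of_int \<lfloor>sqrt (2 / pi) * real s / sqrt (log 2 (real s))\<rfloor>"
proof (cases "\<exists>t. s = 2 ^ t")
  case True
  then obtain t where t: "s = 2 ^ t" by blast
  have "omega_tilde s = real_of_int (int (t choose (t div 2)))"
    using K_fun_prime_power[OF two_is_prime_nat, of t] by (simp add: omega_tilde_def t)
  then show ?thesis using omega_tilde_le_log[OF assms(1)] by (metis le_floor_iff of_int_le_iff)
next
  case False
  note K = K_fun_ge[OF False]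
  have c: "central_prob 3 = 3 / 8" "central_prob 4 = 3 / 8" "central_prob 5 = 5 / 16"
    "central_prob 6 = 5 / 16" "central_prob 7 = 35 / 128" "central_prob 8 = 35 / 128"
    "central_prob 10 = 63 / 256"
    by (simp_all add: central_prob_def binomial_fact' fact_numeral)
  have n2: "s \<noteq> 2 ^ t" for t using False by blast
  \<comment> \<open>The end points 12, 24, 48, 96 and 192 are of the form 3/8 * 2^j, where
    \<open>K_fun_ge\<close> raises its lower bound for \<open>K_fun s\<close>. The others, 16, 32
    and 40, keep the estimate of log 2 (s) sharp enough within a range.\<close>
  consider "s \<le> 12" | "12 < s" "s \<le> 16" | "16 < s" "s \<le> 24" | "24 < s" "s \<le> 32"
    | "32 < s" "s \<le> 40" | "40 < s" "s \<le> 48" | "48 < s" "s \<le> 96" | "96 < s" "s \<le> 192" | "s > 192"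
    by linarith
  then show ?thesis
  proof cases
    case 1
    then consider "s = 5" | "s = 7" | "s = 9" | "s = 10" | "s = 11" | "s = 12"
    proof -
      have "s = 2 \<or> s = 3 \<or> s = 4 \<or> s = 5 \<or> s = 6 \<or> s = 7 \<or> s = 8 \<or> s = 9 \<or> s = 10 \<or> s = 11 \<or> s = 12"
        using 1 assms(1) by presburger
      then show ?thesis using that assms(2,3) n2[of 1] n2[of 2] n2[of 3] by (elim disjE) simp_all
    qed
    then show ?thesis
    proof cases
      case 1
      then show ?thesis using K[of 3]
        by (intro omega_tilde_le_floor_nat[of s 2 5 2 3]) (simp_all add: c)
    next
      case 2
      then show ?thesis using K[of 4]
        by (intro omega_tilde_le_floor_nat[of s 1 3 3 4]) (simp_all add: c)
    next
      case 3
      then show ?thesis using K[of 4]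
        by (intro omega_tilde_le_floor_nat[of s 5 16 4 4]) (simp_all add: c)
    next
      case 4
      then show ?thesis using K[of 4]
        by (intro omega_tilde_le_floor_nat[of s 2 7 4 4]) (simp_all add: c)
    next
      case 5
      \<comment> \<open>Here \<open>K_fun_ge\<close> yields only 4, and 11 * 3/8 exceeds 4, the
        integer part of the bound; so the exact value is used.\<close>
      have "K_fun 11 = 10" using K_fun_prime_power[of 11 1] by simp
      then show ?thesis using 5
        by (intro omega_tilde_le_floor_nat[of s 1 4 3 10]) (simp_all add: c)
    next
      case 6
      then show ?thesis using K[of 4]
        by (intro omega_tilde_le_floor_nat[of s 5 18 5 4]) (simp_all add: c)
    qed
  next
    case 2
    then show ?thesis using K[of 5]
      by (intro omega_tilde_le_floor_gap[of s 16 1 4 "398/1000" 5]) (simp_all add: c power2_eq_square)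
  next
    case 3
    then show ?thesis using K[of 5]
      by (intro omega_tilde_le_floor_gap[of s 24 5 23 "3715/10000" 5]) (simp_all add: c power2_eq_square)
  next
    case 4
    then show ?thesis using K[of 6]
      by (intro omega_tilde_le_floor_gap[of s 32 1 5 "356/1000" 6]) (simp_all add: c power2_eq_square)
  next
    case 5
    then show ?thesis using K[of 6]
      by (intro omega_tilde_le_floor_gap[of s 40 3 16 "345/1000" 6]) (simp_all add: c power2_eq_square)
  next
    case 6
    then show ?thesis using K[of 6]
      by (intro omega_tilde_le_floor_gap[of s 48 17 95 "337/1000" 6]) (simp_all add: c power2_eq_square)
  next
    case 7
    then show ?thesis using K[of 7]
      by (intro omega_tilde_le_floor_gap[of s 96 5 33 "31/100" 7]) (simp_all add: c power2_eq_square)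
  next
    case 8
    then show ?thesis using K[of 8]
      by (intro omega_tilde_le_floor_gap[of s 192 5 38 "289/1000" 8]) (simp_all add: c power2_eq_square)
  next
    case 9
    then show ?thesis using omega_tilde_le_floor_large False by blast
  qed
qed

section \<open>Symmetric chains in a product of chains\<close>

definition box :: "nat list \<Rightarrow> nat list set" where
  "box ks = {la. list_all2 (<) la ks}"

abbreviation box_rank :: "nat list \<Rightarrow> nat" where
  "box_rank ks \<equiv> (\<Sum>k\<leftarrow>ks. k - 1)"

text \<open>
  The symmetric chain decomposition of a product of chains (de Bruijn, Tengbergen, Kruyswijk):
  \<open>chain_bottom ks la\<close> is the least element of the chain through \<open>la\<close>, and \<open>chain_top ks la\<close> the
  number of elements of that chain above \<open>la\<close>. A chain \<open>c\<^sub>0 < \<dots> < c\<^sub>l\<close> times \<open>{0..<k}\<close> splits into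
  the hooks on which \<open>min j (l - i)\<close> is constant, where \<open>(j, c\<^sub>i)\<close> is the general element.
\<close>

fun chain_top :: "nat list \<Rightarrow> nat list \<Rightarrow> nat" where
  "chain_top (k # ks) (j # la) = chain_top ks la + (k - 1 - j) - min j (chain_top ks la)"
| "chain_top _ _ = 0"

fun chain_bottom :: "nat list \<Rightarrow> nat list \<Rightarrow> nat list" where
  "chain_bottom (k # ks) (j # la) = min j (chain_top ks la) # chain_bottom ks la"
| "chain_bottom _ _ = []"

lemma box_Nil: "box [] = {[]}"
  by (auto simp: box_def)

lemma box_Cons: "box (k # ks) = (\<lambda>(j, la). j # la) ` ({..<k} \<times> box ks)"
  by (auto simp: box_def list_all2_Cons2)

lemma box_ConsE:
  assumes "la \<in> box (k # ks)"
  obtains j mu where "la = j # mu" "j < k" "mu \<in> box ks"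
  using assms by (auto simp: box_Cons)

lemma finite_box: "finite (box ks)"
  by (induction ks) (auto simp: box_Nil box_Cons)

lemma card_box: "card (box ks) = prod_list ks"
  by (induction ks) (auto simp: box_Nil box_Cons card_image inj_on_def card_cartesian_product)

text \<open>The symmetry of the chains: the first two summands give the rank of the top of the chain
  through \<open>la\<close>, the third that of its bottom.\<close>

lemma chain_top_eq:
  "la \<in> box ks \<Longrightarrow> chain_top ks la + sum_list la + sum_list (chain_bottom ks la) = box_rank ks"
proof (induction ks arbitrary: la)
  case (Cons k ks)
  from Cons.prems obtain j mu where la: "la = j # mu" "j < k" "mu \<in> box ks"
    by (rule box_ConsE)
  then show ?case using Cons.IH[of mu] by (auto simp: min_def)
qed (auto simp: box_Nil)

lemma sum_chain_bottom_le:
  "la \<in> box ks \<Longrightarrow> sum_list (chain_bottom ks la) \<le> sum_list la"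
proof (induction ks arbitrary: la)
  case (Cons k ks)
  from Cons.prems obtain j mu where la: "la = j # mu" "j < k" "mu \<in> box ks"
    by (rule box_ConsE)
  then show ?case using Cons.IH[of mu] by (auto simp: min_def)
qed (auto simp: box_Nil)

lemma chain_bottom_in_box: "la \<in> box ks \<Longrightarrow> chain_bottom ks la \<in> box ks"
proof (induction ks arbitrary: la)
  case (Cons k ks)
  from Cons.prems obtain j mu where la: "la = j # mu" "j < k" "mu \<in> box ks"
    by (rule box_ConsE)
  then show ?case using Cons.IH[of mu] by (auto simp: box_Cons)
qed (auto simp: box_Nil)

text \<open>The bottom of a chain has at least as many elements above it as any other, so the
  minimum in the first coordinate is not lowered a second time.\<close>

lemma chain_bottom_idem:
  "la \<in> box ks \<Longrightarrow> chain_bottom ks (chain_bottom ks la) = chain_bottom ks la"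
proof (induction ks arbitrary: la)
  case (Cons k ks)
  from Cons.prems obtain j mu where la: "la = j # mu" "j < k" "mu \<in> box ks"
    by (rule box_ConsE)
  let ?L = "chain_bottom ks mu"
  have "chain_top ks mu \<le> chain_top ks ?L"
    using chain_top_eq[OF la(3)] chain_top_eq[OF chain_bottom_in_box[OF la(3)]]
      sum_chain_bottom_le[OF la(3)] Cons.IH[OF la(3)] by simp
  then show ?case using Cons.IH[OF la(3)] la(1) by simp
qed (auto simp: box_Nil)

text \<open>A hook first climbs the old chain with the new coordinate fixed, then turns and climbs
  in the new coordinate. The case distinction asks whether the corner has been reached.\<close>

lemma chain_successor:
  assumes "la \<in> box ks" "chain_top ks la > 0"
  shows "\<exists>mu\<in>box ks. chain_bottom ks mu = chain_bottom ks la \<and> sum_list mu = Suc (sum_list la)"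
  using assms
proof (induction ks arbitrary: la)
  case (Cons k ks)
  from Cons.prems(1) obtain j mu where la: "la = j # mu" "j < k" "mu \<in> box ks"
    by (rule box_ConsE)
  show ?case
  proof (cases "j < chain_top ks mu")
    case True
    then obtain nu where nu: "nu \<in> box ks" "chain_bottom ks nu = chain_bottom ks mu"
      "sum_list nu = Suc (sum_list mu)"
      using Cons.IH[OF la(3)] by auto
    have "chain_top ks nu + 1 = chain_top ks mu"
      using chain_top_eq[OF la(3)] chain_top_eq[OF nu(1)] nu by simp
    then have "min j (chain_top ks nu) = min j (chain_top ks mu)" using True by simp
    then show ?thesis
      using nu la by (intro bexI[of _ "j # nu"]) (auto simp: box_Cons)
  next
    case False
    then have "Suc j < k" using Cons.prems(2) la by (auto simp: min_def split: if_splits)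
    then show ?thesis
      using la False by (intro bexI[of _ "Suc j # mu"]) (auto simp: box_Cons min_def)
  qed
qed (auto simp: box_Nil)

text \<open>Along a hook neither coordinate falls while the rank rises. Equal bottoms force equal
  tops by \<open>chain_top_eq\<close>, which locates both tails on the same old chain.\<close>

lemma chain_comparable:
  assumes "la \<in> box ks" "mu \<in> box ks" "chain_bottom ks la = chain_bottom ks mu"
    and "sum_list la \<le> sum_list mu"
  shows "list_all2 (\<le>) la mu"
  using assms
proof (induction ks arbitrary: la mu)
  case (Cons k ks)
  from Cons.prems(1) obtain j la' where la: "la = j # la'" "j < k" "la' \<in> box ks"
    by (rule box_ConsE)
  from Cons.prems(2) obtain i mu' where mu: "mu = i # mu'" "i < k" "mu' \<in> box ks"
    by (rule box_ConsE)
  have b: "chain_bottom ks la' = chain_bottom ks mu'"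
    and m: "min j (chain_top ks la') = min i (chain_top ks mu')"
    using Cons.prems(3) la mu by auto
  have t: "chain_top ks la' + sum_list la' = chain_top ks mu' + sum_list mu'"
    using chain_top_eq[OF la(3)] chain_top_eq[OF mu(3)] b by simp
  have le: "j + sum_list la' \<le> i + sum_list mu'" using Cons.prems(4) la mu by simp
  have "sum_list la' \<le> sum_list mu' \<and> j \<le> i"
    using t m le by (auto simp: min_def split: if_splits)
  then show ?case using Cons.IH[OF la(3) mu(3) b] la mu by simp
qed (auto simp: box_Nil)

text \<open>A chain that is symmetric about the middle rank meets it, so the elements of middle rank
  already produce all bottoms.\<close>

lemma card_chains_le:
  "card (chain_bottom ks ` box ks) \<le> card {la \<in> box ks. sum_list la = box_rank ks div 2}"
proof -
  have step: "\<exists>mu\<in>box ks. chain_bottom ks mu = chain_bottom ks la \<and> sum_list mu = sum_list (chain_bottom ks la) + n"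
    if la: "la \<in> box ks" and "2 * sum_list (chain_bottom ks la) + n \<le> box_rank ks" for la n
    using that(2)
  proof (induction n)
    case 0
    then show ?case using chain_bottom_in_box[OF la] chain_bottom_idem[OF la] by auto
  next
    case (Suc n)
    then obtain mu where mu: "mu \<in> box ks" "chain_bottom ks mu = chain_bottom ks la"
      "sum_list mu = sum_list (chain_bottom ks la) + n" by auto
    then have "chain_top ks mu > 0" using chain_top_eq[OF mu(1)] Suc.prems mu(2,3) by simp
    from chain_successor[OF mu(1) this] mu show ?case by auto
  qed
  have "chain_bottom ks ` box ks \<subseteq> chain_bottom ks ` {la \<in> box ks. sum_list la = box_rank ks div 2}"
  proof
    fix L assume "L \<in> chain_bottom ks ` box ks"
    then obtain la where la: "la \<in> box ks" "L = chain_bottom ks la" by blast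
    have "2 * sum_list L \<le> box_rank ks"
      using chain_top_eq[OF chain_bottom_in_box[OF la(1)]] chain_bottom_idem[OF la(1)] la(2) by simp
    then show "L \<in> chain_bottom ks ` {la \<in> box ks. sum_list la = box_rank ks div 2}"
      using step[OF la(1), of "box_rank ks div 2 - sum_list L"] la(2) by (force simp: image_iff)
  qed
  then have "card (chain_bottom ks ` box ks) \<le> card (chain_bottom ks ` {la \<in> box ks. sum_list la = box_rank ks div 2})"
    by (intro card_mono) (auto simp: finite_box)
  also have "\<dots> \<le> card {la \<in> box ks. sum_list la = box_rank ks div 2}"
    by (intro card_image_le) (auto simp: finite_box)
  finally show ?thesis .
qed

section \<open>Rank polynomials of boxes\<close>

fun box_count :: "nat list \<Rightarrow> int \<Rightarrow> real" where
  "box_count [] n = (if n = 0 then 1 else 0)"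
| "box_count (k # ks) n = (\<Sum>i<k. box_count ks (n - int i))"

text \<open>Here \<open>box_count ks n\<close> is the coefficient of x^n in the product of the
  polynomials 1 + x + ... + x^(k - 1). Integer indices make reflections and shifts total, with value
  0 outside the range of ranks.\<close>

lemma box_count_eq_card: "box_count ks n = real (card {la \<in> box ks. int (sum_list la) = n})"
proof (induction ks arbitrary: n)
  case (Cons k ks)
  have "{la \<in> box (k # ks). int (sum_list la) = n} =
          (\<Union>i\<in>{..<k}. (#) i ` {la \<in> box ks. int (sum_list la) = n - int i})"
    by (auto simp: box_Cons)
  also have "card \<dots> = (\<Sum>i<k. card ((#) i ` {la \<in> box ks. int (sum_list la) = n - int i}))"
    by (intro card_UN_disjoint) (auto simp: finite_box)
  also have "\<dots> = (\<Sum>i<k. card {la \<in> box ks. int (sum_list la) = n - int i})"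
    by (intro sum.cong refl card_image) auto
  finally show ?case by (simp add: Cons.IH)
next
  case Nil
  have "{la \<in> box []. int (sum_list la) = n} = (if n = 0 then {[]} else {})"
    by (auto simp: box_Nil)
  then show ?case by simp
qed

text \<open>Symmetric about \<open>D / 2\<close> and decreasing away from it.\<close>

definition peaked :: "int \<Rightarrow> (int \<Rightarrow> real) \<Rightarrow> bool" where
  "peaked D f \<longleftrightarrow> (\<forall>m n. \<bar>2 * m - D\<bar> \<le> \<bar>2 * n - D\<bar> \<longrightarrow> f n \<le> f m)"

lemma peakedD: "peaked D f \<Longrightarrow> \<bar>2 * m - D\<bar> \<le> \<bar>2 * n - D\<bar> \<Longrightarrow> f n \<le> f m"
  by (simp add: peaked_def)

lemma peaked_sym:
  assumes "peaked D f"
  shows "f (D - n) = f n"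
  using peakedD[OF assms, of n "D - n"] peakedD[OF assms, of "D - n" n] by force

text \<open>Multiplication by 1 + x + ... + x^(k - 1) preserves peakedness: a window moved one place
  towards the centre gains a term that is at least as central as the one it loses.\<close>

lemma peaked_window:
  assumes f: "peaked D f" and "k \<ge> 1"
  shows "peaked (D + int k - 1) (\<lambda>n. \<Sum>i<k. f (n - int i))"
proof -
  define g where "g n = (\<Sum>i<k. f (n - int i))" for n
  define E where "E = D + int k - 1"
  have sym: "g (E - n) = g n" for n
  proof -
    have "g (E - n) = (\<Sum>i<k. f (E - n - int (k - 1 - i)))"
      unfolding g_def using \<open>k \<ge> 1\<close>
      by (intro sum.reindex_bij_witness[of _ "\<lambda>i. k - 1 - i" "\<lambda>i. k - 1 - i"]) auto
    also have "\<dots> = (\<Sum>i<k. f (D - (n - int i)))"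
      using \<open>k \<ge> 1\<close> by (intro sum.cong arg_cong[of _ _ f]) (auto simp: E_def of_nat_diff)
    also have "\<dots> = g n" unfolding g_def by (simp only: peaked_sym[OF f])
    finally show ?thesis .
  qed
  \<comment> \<open>The bound \<open>E + 1\<close> admits the step across the middle for odd
    \<open>E\<close>, between two values that agree by symmetry.\<close>
  have step: "g n \<le> g (n + 1)" if "2 * n + 2 \<le> E + 1" for n
  proof -
    obtain k' where k': "k = Suc k'" using \<open>k \<ge> 1\<close> by (metis Suc_le_D One_nat_def)
    have "g (n + 1) = f (n + 1) + (\<Sum>i<k'. f (n - int i))"
      unfolding g_def k' sum.lessThan_Suc_shift by (simp add: algebra_simps)
    moreover have "g n = (\<Sum>i<k'. f (n - int i)) + f (n - int k')"
      unfolding g_def k' by simp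
    moreover have "f (n - int k') \<le> f (n + 1)"
      using that by (intro peakedD[OF f]) (auto simp: E_def k')
    ultimately show ?thesis by simp
  qed
  have mono: "g n \<le> g m" if "n \<le> m" "2 * m \<le> E + 1" for m n
    using that
  proof (induction m rule: int_ge_induct)
    case (step i)
    then show ?case using \<open>\<And>n. 2 * n + 2 \<le> E + 1 \<Longrightarrow> g n \<le> g (n + 1)\<close>[of i] by auto
  qed simp
  have "g n \<le> g m" if *: "\<bar>2 * m - E\<bar> \<le> \<bar>2 * n - E\<bar>" for m n
  proof -
    define m' where "m' = min m (E - m)"
    define n' where "n' = min n (E - n)"
    have "g m' = g m" "g n' = g n" by (auto simp: m'_def n'_def min_def sym)
    moreover have "n' \<le> m'" using * unfolding m'_def n'_def by linarith
    moreover have "2 * m' \<le> E + 1" unfolding m'_def by (cases "m \<le> E - m") (simp_all add: min_def)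
    ultimately show ?thesis using mono by metis
  qed
  then show ?thesis by (auto simp: peaked_def g_def E_def)
qed

lemma peaked_box_count:
  "\<forall>k\<in>set ks. k \<ge> 1 \<Longrightarrow> peaked (int (box_rank ks)) (box_count ks)"
proof (induction ks)
  case Nil
  then show ?case by (auto simp: peaked_def)
next
  case (Cons k ks)
  then have "peaked (int (box_rank ks) + int k - 1) (\<lambda>n. \<Sum>i<k. box_count ks (n - int i))"
    by (intro peaked_window) auto
  then show ?case using Cons.prems by (simp add: of_nat_diff algebra_simps)
qed

text \<open>The factor (1 + x)^n, expanded by the binomial theorem.\<close>

lemma box_count_replicate:
  "box_count (replicate n 2 @ ks) x = (\<Sum>i\<le>n. real (n choose i) * box_count ks (x - int i))"
proof (induction n arbitrary: x)
  case (Suc n)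
  let ?u = "\<lambda>i. box_count ks (x - int i)"
  have "box_count (replicate (Suc n) 2 @ ks) x =
          box_count (replicate n 2 @ ks) x + box_count (replicate n 2 @ ks) (x - 1)"
    by (simp add: numeral_2_eq_2)
  also have "\<dots> = (\<Sum>i\<le>n. real (n choose i) * ?u i) + (\<Sum>i\<le>n. real (n choose i) * ?u (Suc i))"
    by (simp add: Suc.IH algebra_simps)
  also have "(\<Sum>i\<le>n. real (n choose i) * ?u i) = ?u 0 + (\<Sum>i\<le>n. real (n choose Suc i) * ?u (Suc i))"
  proof -
    have "(\<Sum>i\<le>n. real (n choose i) * ?u i) = (\<Sum>i\<le>Suc n. real (n choose i) * ?u i)" by simp
    also have "\<dots> = ?u 0 + (\<Sum>i\<le>n. real (n choose Suc i) * ?u (Suc i))"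
      by (subst sum.atMost_Suc_shift) simp
    finally show ?thesis .
  qed
  also have "\<dots> + (\<Sum>i\<le>n. real (n choose i) * ?u (Suc i)) =
      ?u 0 + (\<Sum>i\<le>n. real (Suc n choose Suc i) * ?u (Suc i))"
    by (simp add: sum.distrib[symmetric] algebra_simps)
  also have "\<dots> = (\<Sum>i\<le>Suc n. real (Suc n choose i) * ?u i)"
    by (subst sum.atMost_Suc_shift) simp
  finally show ?case .
qed simp

lemma box_count_binomial: "box_count (replicate n 2) (int i) = real (n choose i)"
proof -
  have "box_count (replicate n 2) (int i) = (\<Sum>j\<le>n. if j = i then real (n choose j) else 0)"
    using box_count_replicate[of n "[]" "int i"] by (simp add: if_distrib cong: if_cong sum.cong)
  also have "\<dots> = real (n choose i)" by (simp add: binomial_eq_0)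
  finally show ?thesis .
qed

lemma chebyshev_sum:
  fixes b f :: "nat \<Rightarrow> real"
  assumes "\<And>i j. i < k \<Longrightarrow> j < k \<Longrightarrow> 0 \<le> (b i - b j) * (f i - f j)"
  shows "(\<Sum>i<k. b i) * (\<Sum>i<k. f i) \<le> real k * (\<Sum>i<k. b i * f i)"
proof -
  have "0 \<le> (\<Sum>i<k. \<Sum>j<k. (b i - b j) * (f i - f j))"
    using assms by (intro sum_nonneg) auto
  also have "\<dots> = (\<Sum>i<k. \<Sum>j<k. b i * f i) + (\<Sum>i<k. \<Sum>j<k. b j * f j)
      - ((\<Sum>i<k. \<Sum>j<k. b i * f j) + (\<Sum>i<k. \<Sum>j<k. b j * f i))"
    by (simp add: algebra_simps sum.distrib sum_subtractf)
  also have "\<dots> = 2 * (real k * (\<Sum>i<k. b i * f i)) - 2 * ((\<Sum>i<k. b i) * (\<Sum>i<k. f i))"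
    by (simp add: sum_product sum_distrib_left[symmetric] sum.swap[of "\<lambda>i j. b j * f i"])
  finally show ?thesis by simp
qed

text \<open>The condition on \<open>m\<close> puts the window symmetrically around the peak of
  \<open>f\<close>. Binomial coefficients and values of \<open>f\<close> are then similarly ordered,
  and Chebyshev's sum inequality applies.\<close>

lemma window_le_binomial_window:
  assumes f: "peaked D f" and "k \<ge> 1" and m: "2 * m = D + int k - 1"
  shows "2 ^ (k - 1) * (\<Sum>i<k. f (m - int i)) \<le> real k * (\<Sum>i<k. real ((k - 1) choose i) * f (m - int i))"
proof -
  obtain n where n: "k = Suc n" using \<open>k \<ge> 1\<close> by (metis Suc_le_D One_nat_def)
  have pb: "peaked (int n) (box_count (replicate n 2))"
    using peaked_box_count[of "replicate n 2"] by (simp add: sum_list_replicate)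
  have "(\<Sum>i<k. real (n choose i)) = 2 ^ n"
    using choose_row_sum[of n] by (simp add: n lessThan_Suc_atMost flip: of_nat_sum)
  moreover have "(\<Sum>i<k. real (n choose i)) * (\<Sum>i<k. f (m - int i)) \<le> real k * (\<Sum>i<k. real (n choose i) * f (m - int i))"
  proof (rule chebyshev_sum)
    fix i j
    show "0 \<le> (real (n choose i) - real (n choose j)) * (f (m - int i) - f (m - int j))"
    proof (cases "\<bar>2 * int i - int n\<bar> \<le> \<bar>2 * int j - int n\<bar>")
      case True
      then have "real (n choose j) \<le> real (n choose i)"
        using peakedD[OF pb, of "int i" "int j"] by (simp add: box_count_binomial)
      moreover have "f (m - int j) \<le> f (m - int i)"
        using True m by (intro peakedD[OF f]) (auto simp: n)
      ultimately show ?thesis by simp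
    next
      case False
      then have "real (n choose i) \<le> real (n choose j)"
        using peakedD[OF pb, of "int j" "int i"] by (simp add: box_count_binomial)
      moreover have "f (m - int i) \<le> f (m - int j)"
        using False m by (intro peakedD[OF f]) (auto simp: n)
      ultimately show ?thesis by (intro mult_nonpos_nonpos) auto
    qed
  qed
  ultimately show ?thesis by (simp add: n)
qed

text \<open>
  The factors \<open>1 + x + \<dots> + x\<^bsup>k - 1\<^esup>\<close> of the rank polynomial are replaced one at a time by
  \<open>(1 + x)\<^bsup>k - 1\<^esup>\<close>. The total degree has to be even, as only then the windows are centred at the peak.
\<close>

lemma middle_box_count_even:
  assumes "\<forall>k\<in>set ks. k \<ge> 1" "n + box_rank ks = 2 * m"
  shows "2 ^ box_rank ks * box_count (replicate n 2 @ ks) (int m) \<le> real (prod_list ks) * real ((2 * m) choose m)"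
  using assms
proof (induction ks arbitrary: n)
  case Nil
  then show ?case using box_count_binomial[of n m] by simp
next
  case (Cons k ks)
  have k: "k \<ge> 1" and ks: "\<forall>k\<in>set ks. k \<ge> 1" using Cons.prems by auto
  define f where "f = box_count (replicate n 2 @ ks)"
  have pf: "peaked (int (n + box_rank ks)) f"
  proof -
    have "\<forall>k\<in>set (replicate n 2 @ ks). k \<ge> 1" using ks by auto
    from peaked_box_count[OF this] show ?thesis by (simp add: f_def sum_list_replicate)
  qed
  have swap: "box_count (replicate n 2 @ k # ks) x = (\<Sum>i<k. f (x - int i))" for x
    unfolding f_def box_count_replicate
    by (simp add: sum_distrib_left) (subst sum.swap, simp add: algebra_simps)
  have m: "2 * int m = int (n + box_rank ks) + int k - 1"
    using Cons.prems(2) k by simp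
  have IH: "2 ^ box_rank ks * box_count (replicate (k - 1 + n) 2 @ ks) (int m) \<le> real (prod_list ks) * real ((2 * m) choose m)"
    using Cons.prems(2) by (intro Cons.IH[OF ks]) simp
  have "2 ^ (k - 1) * (\<Sum>i<k. f (int m - int i)) \<le> real k * (\<Sum>i<k. real ((k - 1) choose i) * f (int m - int i))"
    by (rule window_le_binomial_window[OF pf k m])
  also have "(\<Sum>i<k. real ((k - 1) choose i) * f (int m - int i)) = box_count (replicate (k - 1 + n) 2 @ ks) (int m)"
  proof -
    have "{..<k} = {..k - 1}" using k by auto
    then show ?thesis
      unfolding f_def using box_count_replicate[of "k - 1" "replicate n 2 @ ks" "int m"] by (simp add: replicate_add)
  qed
  finally have "2 ^ box_rank ks * (2 ^ (k - 1) * box_count (replicate n 2 @ k # ks) (int m)) \<le>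
      2 ^ box_rank ks * (real k * box_count (replicate (k - 1 + n) 2 @ ks) (int m))"
    unfolding swap by (intro mult_left_mono) auto
  also have "\<dots> = real k * (2 ^ box_rank ks * box_count (replicate (k - 1 + n) 2 @ ks) (int m))" by simp
  also have "\<dots> \<le> real k * (real (prod_list ks) * real ((2 * m) choose m))"
    using IH by (intro mult_left_mono) auto
  finally show ?case by (simp add: power_add mult_ac)
qed

lemma middle_box_count_le:
  assumes ks: "\<forall>k\<in>set ks. k \<ge> 1"
  shows "box_count ks (int (box_rank ks div 2)) \<le> real (prod_list ks) * central_prob (box_rank ks)"
proof (cases "even (box_rank ks)")
  case True
  then have "2 ^ box_rank ks * box_count ks (int (box_rank ks div 2)) \<le>
      real (prod_list ks) * real (box_rank ks choose (box_rank ks div 2))"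
    using middle_box_count_even[OF ks, of 0 "box_rank ks div 2"] by simp
  then show ?thesis by (simp add: central_prob_def field_simps)
next
  case False
  \<comment> \<open>In odd degree one more factor 1 + x is inserted. It doubles the middle
    coefficient, as the two middle ones agree, and doubles the binomial coefficient as well, so the
    even case suffices.\<close>
  then obtain r where r: "box_rank ks = 2 * r + 1" by (auto elim: oddE)
  have "box_count ks (int (box_rank ks) - int r) = box_count ks (int r)"
    by (rule peaked_sym[OF peaked_box_count[OF ks]])
  moreover have "int (box_rank ks) - int r = int r + 1" using r by linarith
  ultimately have "box_count ks (int r + 1) = box_count ks (int r)" by metis
  then have count: "box_count (replicate 1 2 @ ks) (int (Suc r)) = 2 * box_count ks (int r)"
    by (simp add: numeral_2_eq_2 algebra_simps)
  have choose: "(2 * Suc r) choose Suc r = 2 * ((2 * r + 1) choose r)"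
    using binomial_symmetric[of r "2 * r + 1"] by simp
  have "1 + box_rank ks = 2 * Suc r" using r by simp
  from middle_box_count_even[OF ks this]
  have "2 ^ box_rank ks * (2 * box_count ks (int r)) \<le> real (prod_list ks) * (2 * real ((2 * r + 1) choose r))"
    by (simp only: count choose of_nat_mult of_nat_numeral)
  then have "2 ^ box_rank ks * box_count ks (int r) \<le> real (prod_list ks) * real ((2 * r + 1) choose r)"
    by linarith
  then have le: "2 ^ box_rank ks * box_count ks (int r) \<le> real (prod_list ks) * real (box_rank ks choose r)"
    by (simp only: r)
  have half: "box_rank ks div 2 = r" using r by simp
  have "u \<le> v * (w / x)" if "x * u \<le> v * w" "x > 0" for u v w x :: real
    using that by (simp add: field_simps)
  from this[OF le] show ?thesis unfolding central_prob_def half by simp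
qed

lemma card_chains_le_central_prob:
  assumes "\<forall>k\<in>set ks. k \<ge> 1"
  shows "real (card (chain_bottom ks ` box ks)) \<le> real (prod_list ks) * central_prob (box_rank ks)"
  using card_chains_le[of ks] middle_box_count_le[OF assms]
  unfolding box_count_eq_card of_nat_eq_iff by linarith

section \<open>Transversals for soluble transitive groups\<close>

fun box_code :: "nat list \<Rightarrow> nat list \<Rightarrow> nat" where
  "box_code (k # ks) (j # la) = j * prod_list ks + box_code ks la"
| "box_code _ _ = 0"

lemma box_code_less: "la \<in> box ks \<Longrightarrow> box_code ks la < prod_list ks"
proof (induction ks arbitrary: la)
  case (Cons k ks)
  from Cons.prems obtain j mu where la: "la = j # mu" "j < k" "mu \<in> box ks"
    by (rule box_ConsE)
  have "j * prod_list ks + box_code ks mu < Suc j * prod_list ks"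
    using Cons.IH[OF la(3)] by simp
  also have "\<dots> \<le> k * prod_list ks" using la(2) by (intro mult_le_mono1) simp
  finally show ?case using la(1) by simp
qed (simp add: box_Nil)

lemma box_code_Cons_less_iff:
  assumes "la \<in> box ks" "mu \<in> box ks"
  shows "box_code (k # ks) (i # la) < box_code (k # ks) (j # mu) \<longleftrightarrow>
           i < j \<or> i = j \<and> box_code ks la < box_code ks mu"
proof -
  have *: "i * prod_list ks + box_code ks la < j * prod_list ks + box_code ks mu"
    if "i < j" "la \<in> box ks" for i j la mu
  proof -
    have "i * prod_list ks + box_code ks la < Suc i * prod_list ks"
      using box_code_less[OF that(2)] by simp
    also have "\<dots> \<le> j * prod_list ks" using that(1) by (intro mult_le_mono1) simp
    finally show ?thesis by simp
  qed
  show ?thesis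
    using *[of i j la mu] *[of j i mu la] assms by (cases i j rule: linorder_cases) auto
qed

lemma inj_on_box_code: "inj_on (box_code ks) (box ks)"
proof (induction ks)
  case (Cons k ks)
  show ?case
  proof (rule inj_onI)
    fix la mu assume *: "la \<in> box (k # ks)" "mu \<in> box (k # ks)" "box_code (k # ks) la = box_code (k # ks) mu"
    obtain j la' where la: "la = j # la'" "la' \<in> box ks" using *(1) by (rule box_ConsE)
    obtain i mu' where mu: "mu = i # mu'" "mu' \<in> box ks" using *(2) by (rule box_ConsE)
    have "j = i" "box_code ks la' = box_code ks mu'"
      using *(3) box_code_Cons_less_iff[OF la(2) mu(2), of k j i] box_code_Cons_less_iff[OF mu(2) la(2), of k i j]
      unfolding la(1) mu(1) by (metis less_irrefl linorder_neqE_nat)+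
    then show "la = mu" using Cons.IH la mu by (auto dest: inj_onD)
  qed
qed (simp add: box_Nil)

lemma bij_betw_box_code: "bij_betw (box_code ks) (box ks) {..<prod_list ks}"
proof -
  have "box_code ks ` box ks = {..<prod_list ks}"
    by (intro card_subset_eq) (auto simp: box_code_less card_image inj_on_box_code card_box)
  then show ?thesis using inj_on_box_code by (simp add: bij_betw_def)
qed

text \<open>Codes are mixed-radix numbers with the first coordinate most significant; the
  lexicographic order they define extends the product order.\<close>

lemma box_code_mono: "list_all2 (\<le>) la mu \<Longrightarrow> box_code ks la \<le> box_code ks mu"
proof (induction ks arbitrary: la mu)
  case (Cons k ks)
  then show ?case by (cases la; cases mu) (auto intro!: add_mono)
qed simp

section \<open>Ladders along a soluble series\<close>

context group
begin

lemma inv_mult_cancel_left: "a \<in> carrier G \<Longrightarrow> b \<in> carrier G \<Longrightarrow> inv a \<otimes> (a \<otimes> b) = b"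
  by (simp add: m_assoc[symmetric])

lemma mult_inv_cancel_left: "a \<in> carrier G \<Longrightarrow> b \<in> carrier G \<Longrightarrow> a \<otimes> (inv a \<otimes> b) = b"
  by (simp add: m_assoc[symmetric])

lemmas group_normalize = m_assoc inv_mult_group inv_mult_cancel_left mult_inv_cancel_left

text \<open>
  The points \<open>H x\<^sub>l\<^sub>a\<close> are ordered lexicographically. The last clause says that for \<open>la \<le> mu\<close> in the product
  order, translation by \<open>inv (x mu) \<otimes> x la\<close> takes the points above \<open>H x\<^sub>m\<^sub>u\<close> to points above
  \<open>H x\<^sub>l\<^sub>a\<close>.
\<close>

definition ladder :: "'a set \<Rightarrow> 'a set \<Rightarrow> nat list \<Rightarrow> (nat list \<Rightarrow> 'a) \<Rightarrow> bool" where
  "ladder H D ks x \<longleftrightarrow>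
     (\<forall>la\<in>box ks. x la \<in> D) \<and>
     (\<forall>g\<in>D. \<exists>!la. la \<in> box ks \<and> g \<otimes> inv (x la) \<in> H) \<and>
     (\<forall>la\<in>box ks. \<forall>mu\<in>box ks. \<forall>nu\<in>box ks. \<forall>rho\<in>box ks.
        list_all2 (\<le>) la mu \<longrightarrow> box_code ks mu < box_code ks nu \<longrightarrow>
        x nu \<otimes> inv (x mu) \<otimes> x la \<otimes> inv (x rho) \<in> H \<longrightarrow> box_code ks la < box_code ks rho)"

lemma ladderD:
  assumes "ladder H D ks x"
  shows "la \<in> box ks \<Longrightarrow> x la \<in> D"
    and "g \<in> D \<Longrightarrow> \<exists>!la. la \<in> box ks \<and> g \<otimes> inv (x la) \<in> H"
    and "la \<in> box ks \<Longrightarrow> mu \<in> box ks \<Longrightarrow> nu \<in> box ks \<Longrightarrow> rho \<in> box ks \<Longrightarrow>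
        list_all2 (\<le>) la mu \<Longrightarrow> box_code ks mu < box_code ks nu \<Longrightarrow>
        x nu \<otimes> inv (x mu) \<otimes> x la \<otimes> inv (x rho) \<in> H \<Longrightarrow> box_code ks la < box_code ks rho"
  using assms unfolding ladder_def by (elim conjE, simp)+

lemma ladder_trivial:
  assumes "D \<subseteq> H" "D \<subseteq> carrier G" "\<one> \<in> D"
  shows "ladder H D [] (\<lambda>_. \<one>)"
  using assms by (auto simp: ladder_def box_Nil subset_iff)

lemma subgroup_extend_power:
  assumes D: "subgroup D G" and z: "z \<in> carrier G"
    and norm: "\<And>g n. g \<in> generate G (insert z D) \<Longrightarrow> n \<in> D \<Longrightarrow> g \<otimes> n \<otimes> inv g \<in> D"
  shows "subgroup {n \<otimes> z [^] (i::int) | n i. n \<in> D} G"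
proof -
  have DG: "n \<in> D \<Longrightarrow> n \<in> carrier G" for n using subgroup.mem_carrier[OF D] .
  have zpow: "z [^] (i::int) \<in> generate G (insert z D)" for i
    using z DG by (intro subgroup_int_pow_closed generate_is_subgroup generate.incl) auto
  have conj: "z [^] (i::int) \<otimes> n \<otimes> inv (z [^] i) \<in> D" if "n \<in> D" for n i
    using norm[OF zpow that] .
  show ?thesis
  proof (rule subgroupI)
    show "{n \<otimes> z [^] (i::int) | n i. n \<in> D} \<subseteq> carrier G" using DG z by auto
    show "{n \<otimes> z [^] (i::int) | n i. n \<in> D} \<noteq> {}" using subgroup.one_closed[OF D] by auto
  next
    fix a assume "a \<in> {n \<otimes> z [^] (i::int) | n i. n \<in> D}"
    then obtain n i where a: "a = n \<otimes> z [^] (i::int)" "n \<in> D" by auto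
    have "inv a = z [^] (- i) \<otimes> inv n \<otimes> inv (z [^] (- i)) \<otimes> z [^] (- i)"
      using a DG z by (simp add: group_normalize int_pow_neg)
    then show "inv a \<in> {n \<otimes> z [^] (i::int) | n i. n \<in> D}"
      using conj[OF subgroup.m_inv_closed[OF D a(2)], of "- i"] by blast
  next
    fix a b assume "a \<in> {n \<otimes> z [^] (i::int) | n i. n \<in> D}" "b \<in> {n \<otimes> z [^] (i::int) | n i. n \<in> D}"
    then obtain n i m j where a: "a = n \<otimes> z [^] (i::int)" "n \<in> D" and b: "b = m \<otimes> z [^] (j::int)" "m \<in> D"
      by auto
    have "a \<otimes> b = n \<otimes> (z [^] i \<otimes> m \<otimes> inv (z [^] i)) \<otimes> z [^] (i + j)"
      using a b DG z by (simp add: group_normalize int_pow_mult)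
    moreover have "n \<otimes> (z [^] i \<otimes> m \<otimes> inv (z [^] i)) \<in> D"
      using conj[OF b(2)] a(2) D by (simp add: subgroup.m_closed)
    ultimately show "a \<otimes> b \<in> {n \<otimes> z [^] (i::int) | n i. n \<in> D}" by blast
  qed
qed

text \<open>Since \<open>h\<close> normalises \<open>D\<close>, an element n h^i equals h^i n' with
  n' in \<open>D\<close> and lies in the coset H n'. No new points arise, and the transversal is
  kept.\<close>

lemma ladder_extend_in_subgroup:
  assumes H: "subgroup H G" and D: "subgroup D G" and h: "h \<in> H"
    and norm: "\<And>i n. n \<in> D \<Longrightarrow> h [^] (i::int) \<otimes> n \<otimes> inv (h [^] i) \<in> D"
    and lad: "ladder H D ks x"
  shows "ladder H {n \<otimes> h [^] (i::int) | n i. n \<in> D} ks x"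
proof -
  have DG: "n \<in> D \<Longrightarrow> n \<in> carrier G" for n using subgroup.mem_carrier[OF D] .
  have HG: "n \<in> H \<Longrightarrow> n \<in> carrier G" for n using subgroup.mem_carrier[OF H] .
  have xD: "x la \<in> D" if "la \<in> box ks" for la using ladderD(1)[OF lad that] .
  have hH: "h [^] (i::int) \<in> H" for i by (rule subgroup_int_pow_closed[OF H h])
  have mem: "x la \<in> {n \<otimes> h [^] (i::int) | n i. n \<in> D}" if "la \<in> box ks" for la
    using xD[OF that] DG by (intro CollectI exI[of _ "x la"] exI[of _ 0]) auto
  have ex1: "\<exists>!la. la \<in> box ks \<and> g \<otimes> inv (x la) \<in> H" if "g \<in> {n \<otimes> h [^] (i::int) | n i. n \<in> D}" for g
  proof -
    from that obtain n i where g: "g = n \<otimes> h [^] (i::int)" and n: "n \<in> D" by auto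
    define n' where "n' = h [^] (- i) \<otimes> n \<otimes> inv (h [^] (- i))"
    have n': "n' \<in> D" unfolding n'_def by (rule norm[OF n])
    have hG: "h \<in> carrier G" using h HG by auto
    have "inv (h [^] (- i)) = h [^] i" using hG by (simp add: int_pow_neg)
    then have "h [^] i \<otimes> n' = g"
      using n DG hG unfolding n'_def g by (simp add: group_normalize int_pow_neg)
    moreover have "(h [^] i \<otimes> n') \<otimes> inv (x la) \<in> H \<longleftrightarrow> n' \<otimes> inv (x la) \<in> H" if "la \<in> box ks" for la
    proof -
      have 1: "inv (h [^] i) \<otimes> ((h [^] i \<otimes> n') \<otimes> inv (x la)) = n' \<otimes> inv (x la)"
        using hG DG n' xD[OF that] by (simp add: group_normalize)
      have 2: "(h [^] i \<otimes> n') \<otimes> inv (x la) = h [^] i \<otimes> (n' \<otimes> inv (x la))"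
        using hG DG n' xD[OF that] by (simp add: m_assoc)
      show ?thesis
      proof
        assume "(h [^] i \<otimes> n') \<otimes> inv (x la) \<in> H"
        from subgroup.m_closed[OF H subgroup.m_inv_closed[OF H hH[of i]] this]
        show "n' \<otimes> inv (x la) \<in> H" by (simp only: 1)
      next
        assume "n' \<otimes> inv (x la) \<in> H"
        from subgroup.m_closed[OF H hH[of i] this]
        show "(h [^] i \<otimes> n') \<otimes> inv (x la) \<in> H" by (simp only: 2)
      qed
    qed
    ultimately have iff: "(la \<in> box ks \<and> g \<otimes> inv (x la) \<in> H) = (la \<in> box ks \<and> n' \<otimes> inv (x la) \<in> H)" for la
      by auto
    have "\<exists>!la. la \<in> box ks \<and> n' \<otimes> inv (x la) \<in> H"
      using ladderD(2)[OF lad n'] .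
    then show ?thesis unfolding iff .
  qed
  show ?thesis
    unfolding ladder_def
  proof (intro conjI ballI impI)
    fix la mu nu rho
    assume "la \<in> box ks" "mu \<in> box ks" "nu \<in> box ks" "rho \<in> box ks"
      "list_all2 (\<le>) la mu" "box_code ks mu < box_code ks nu"
      "x nu \<otimes> inv (x mu) \<otimes> x la \<otimes> inv (x rho) \<in> H"
    then show "box_code ks la < box_code ks rho" by (rule ladderD(3)[OF lad])
  qed (fact mem ex1)+
qed

text \<open>As \<open>H\<close> meets the larger group inside \<open>D\<close> only, a coset
  determines the exponent of \<open>y\<close> modulo \<open>p\<close>. This exponent becomes a new
  coordinate, the most significant one.\<close>

lemma ladder_extend_transversal:
  assumes D: "subgroup D G" and y: "y \<in> carrier G"
    and HD: "\<And>h. h \<in> H \<Longrightarrow> h \<in> {n \<otimes> y [^] (i::int) | n i. n \<in> D} \<Longrightarrow> h \<in> D"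
    and D1: "subgroup {n \<otimes> y [^] (i::int) | n i. n \<in> D} G"
    and norm: "\<And>(i::nat) n. n \<in> D \<Longrightarrow> y [^] i \<otimes> n \<otimes> inv (y [^] i) \<in> D"
    and yp: "y [^] p \<in> D" and ylt: "\<And>i. 0 < i \<Longrightarrow> i < p \<Longrightarrow> y [^] i \<notin> D" and "p > (0::nat)"
    and lad: "ladder H D ks x"
  shows "ladder H {n \<otimes> y [^] (i::int) | n i. n \<in> D} (p # ks) (\<lambda>la. x (tl la) \<otimes> y [^] hd la)"
proof -
  let ?D1 = "{n \<otimes> y [^] (i::int) | n i. n \<in> D}"
  define z where "z la = x (tl la) \<otimes> y [^] hd la" for la
  have zC: "z (j # la) = x la \<otimes> y [^] j" for j la by (simp add: z_def)
  have DG: "n \<in> D \<Longrightarrow> n \<in> carrier G" for n using subgroup.mem_carrier[OF D] .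
  have xD: "x la \<in> D" if "la \<in> box ks" for la using ladderD(1)[OF lad that] .
  have inD1: "n \<otimes> y [^] (j::nat) \<in> ?D1" if "n \<in> D" for n j
  proof -
    have "n \<otimes> y [^] j = n \<otimes> y [^] (int j)" by (simp add: int_pow_int)
    then show ?thesis using that by blast
  qed
  have D1_cases: "\<exists>n\<in>D. \<exists>i<p. g = n \<otimes> y [^] i" if "g \<in> ?D1" for g
  proof -
    from that obtain n i where g: "g = n \<otimes> y [^] (i::int)" and n: "n \<in> D" by auto
    define q where "q = i div int p"
    define r where "r = nat (i mod int p)"
    have r: "int r = i mod int p" "r < p" using \<open>p > 0\<close> by (auto simp: r_def nat_less_iff)
    have "y [^] i = y [^] (int p * q + int r)" using r by (simp add: q_def)
    also have "\<dots> = (y [^] p) [^] q \<otimes> y [^] r"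
      using y by (simp add: int_pow_mult int_pow_int int_pow_pow[symmetric])
    finally have "g = (n \<otimes> (y [^] p) [^] q) \<otimes> y [^] r"
      using g n DG y by (simp add: m_assoc)
    moreover have "n \<otimes> (y [^] p) [^] q \<in> D"
      using n subgroup_int_pow_closed[OF D yp] subgroup.m_closed[OF D] by blast
    ultimately show ?thesis using r(2) by blast
  qed
  have diff: "y [^] (a::nat) \<otimes> inv (y [^] b) = y [^] (a - b)" if "b \<le> a" for a b
  proof -
    have "y [^] a = y [^] (a - b) \<otimes> y [^] b" using y that by (simp add: nat_pow_mult)
    then show ?thesis using y by (simp add: m_assoc)
  qed
  have key: "e = r \<and> n \<otimes> inv d \<in> H"
    if *: "n \<otimes> y [^] e \<otimes> inv (d \<otimes> y [^] r) \<in> H" and "n \<in> D" "d \<in> D" "e < p" "r < p" for n d e r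
  proof -
    have eq: "n \<otimes> y [^] e \<otimes> inv (d \<otimes> y [^] r) = n \<otimes> (y [^] e \<otimes> inv (y [^] r)) \<otimes> inv d"
      using that DG y by (simp add: group_normalize)
    have "n \<otimes> y [^] e \<otimes> inv (d \<otimes> y [^] r) \<in> ?D1"
      using inD1 that D1 by (meson subgroup.m_closed subgroup.m_inv_closed)
    then have "n \<otimes> (y [^] e \<otimes> inv (y [^] r)) \<otimes> inv d \<in> D"
      using HD[OF *] eq by simp
    then have "inv n \<otimes> (n \<otimes> (y [^] e \<otimes> inv (y [^] r)) \<otimes> inv d) \<otimes> d \<in> D"
      using that D by (simp add: subgroup.m_closed subgroup.m_inv_closed)
    moreover have "inv n \<otimes> (n \<otimes> (y [^] e \<otimes> inv (y [^] r)) \<otimes> inv d) \<otimes> d = y [^] e \<otimes> inv (y [^] r)"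
      using that DG y by (simp add: group_normalize)
    ultimately have w: "y [^] e \<otimes> inv (y [^] r) \<in> D" by simp
    then have "inv (y [^] e \<otimes> inv (y [^] r)) \<in> D" using D by (simp add: subgroup.m_inv_closed)
    then have w': "y [^] r \<otimes> inv (y [^] e) \<in> D" using y by (simp add: inv_mult_group)
    have "e = r"
    proof (cases e r rule: linorder_cases)
      case less
      then show ?thesis using w' diff[of e r] ylt[of "r - e"] that by simp
    next
      case greater
      then show ?thesis using w diff[of r e] ylt[of "e - r"] that by simp
    qed
    then show ?thesis using * eq that DG y by simp
  qed
  show ?thesis
    unfolding ladder_def z_def[symmetric]
  proof (intro conjI ballI impI)
    fix la assume "la \<in> box (p # ks)"
    then show "z la \<in> ?D1" using inD1 xD by (auto elim!: box_ConsE simp: zC)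
  next
    fix g assume "g \<in> ?D1"
    then obtain n i where g: "g = n \<otimes> y [^] (i::nat)" "n \<in> D" "i < p" using D1_cases by blast
    obtain la where la: "la \<in> box ks" "n \<otimes> inv (x la) \<in> H"
      and uniq: "\<And>mu. mu \<in> box ks \<Longrightarrow> n \<otimes> inv (x mu) \<in> H \<Longrightarrow> mu = la"
      using ladderD(2)[OF lad g(2)] by blast
    show "\<exists>!la. la \<in> box (p # ks) \<and> g \<otimes> inv (z la) \<in> H"
    proof (rule ex1I[of _ "i # la"])
      have "n \<otimes> y [^] i \<otimes> inv (x la \<otimes> y [^] i) = n \<otimes> inv (x la)"
        using g DG y xD[OF la(1)] by (simp add: group_normalize)
      then show "i # la \<in> box (p # ks) \<and> g \<otimes> inv (z (i # la)) \<in> H"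
        using la g by (auto simp: box_Cons zC)
    next
      fix mu assume mu: "mu \<in> box (p # ks) \<and> g \<otimes> inv (z mu) \<in> H"
      then obtain j mu' where m: "mu = j # mu'" "j < p" "mu' \<in> box ks" by (auto elim: box_ConsE)
      have "n \<otimes> y [^] i \<otimes> inv (x mu' \<otimes> y [^] j) \<in> H" using mu m g by (simp add: zC)
      from key[OF this g(2) xD[OF m(3)] g(3) m(2)] have "i = j" "n \<otimes> inv (x mu') \<in> H" by auto
      then show "mu = i # la" using uniq[OF m(3)] m by simp
    qed
  next
    fix la mu nu rho
    assume box: "la \<in> box (p # ks)" "mu \<in> box (p # ks)" "nu \<in> box (p # ks)" "rho \<in> box (p # ks)"
      and le: "list_all2 (\<le>) la mu" and less: "box_code (p # ks) mu < box_code (p # ks) nu"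
      and inH: "z nu \<otimes> inv (z mu) \<otimes> z la \<otimes> inv (z rho) \<in> H"
    obtain j a where la: "la = j # a" "j < p" "a \<in> box ks" using box(1) by (rule box_ConsE)
    obtain j' a' where mu: "mu = j' # a'" "j' < p" "a' \<in> box ks" using box(2) by (rule box_ConsE)
    obtain i c where nu: "nu = i # c" "i < p" "c \<in> box ks" using box(3) by (rule box_ConsE)
    obtain r d where rho: "rho = r # d" "r < p" "d \<in> box ks" using box(4) by (rule box_ConsE)
    have le': "j \<le> j'" "list_all2 (\<le>) a a'" using le la mu by auto
    have less': "j' < i \<or> j' = i \<and> box_code ks a' < box_code ks c"
      using less box_code_Cons_less_iff[OF mu(3) nu(3)] mu nu by simp
    have G: "x a \<in> carrier G" "x a' \<in> carrier G" "x c \<in> carrier G" "x d \<in> carrier G"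
      using la mu nu rho xD DG by auto
    define q where "q = inv (x a') \<otimes> x a"
    have q: "q \<in> D" unfolding q_def using xD la mu D by (simp add: subgroup.m_closed subgroup.m_inv_closed)
    define u where "u = i - j'"
    have "j' \<le> i" using less' by auto
    have "z nu \<otimes> inv (z mu) \<otimes> z la = x c \<otimes> (y [^] i \<otimes> inv (y [^] j')) \<otimes> q \<otimes> y [^] j"
      using la mu nu G y by (simp add: zC q_def group_normalize)
    also have "\<dots> = x c \<otimes> (y [^] u \<otimes> q \<otimes> inv (y [^] u)) \<otimes> y [^] (u + j)"
      unfolding diff[OF \<open>j' \<le> i\<close>] u_def[symmetric] nat_pow_mult[OF y, symmetric]
      using G y q DG by (simp add: group_normalize)
    finally have zz: "z nu \<otimes> inv (z mu) \<otimes> z la = x c \<otimes> (y [^] u \<otimes> q \<otimes> inv (y [^] u)) \<otimes> y [^] (u + j)" .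
    have w: "x c \<otimes> (y [^] u \<otimes> q \<otimes> inv (y [^] u)) \<in> D"
      using norm[OF q] xD[OF nu(3)] D by (simp add: subgroup.m_closed)
    \<comment> \<open>The reason for demanding \<open>la \<le> mu\<close> in the product order: from
      \<open>j \<le> j'\<close> the exponent \<open>u + j\<close> is at most \<open>i\<close>, so it
      does not wrap around modulo \<open>p\<close> and the first coordinate cannot drop below
      \<open>j\<close>.\<close>
    have "u + j < p" using \<open>j' \<le> i\<close> le' nu(2) by (simp add: u_def)
    have "x c \<otimes> (y [^] u \<otimes> q \<otimes> inv (y [^] u)) \<otimes> y [^] (u + j) \<otimes> inv (x d \<otimes> y [^] r) \<in> H"
      using inH unfolding zz rho(1) zC .
    from key[OF this w xD[OF rho(3)] \<open>u + j < p\<close> rho(2)]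
    have r: "u + j = r" and H': "x c \<otimes> (y [^] u \<otimes> q \<otimes> inv (y [^] u)) \<otimes> inv (x d) \<in> H" by auto
    have "j < r \<or> j = r \<and> box_code ks a < box_code ks d"
    proof (cases "j' < i")
      case True
      then show ?thesis using r unfolding u_def by linarith
    next
      case False
      then have "u = 0" "box_code ks a' < box_code ks c" using less' by (auto simp: u_def)
      moreover have "x c \<otimes> inv (x a') \<otimes> x a \<otimes> inv (x d) \<in> H"
        using H' \<open>u = 0\<close> G q DG by (simp add: q_def group_normalize)
      ultimately show ?thesis
        using ladderD(3)[OF lad la(3) mu(3) nu(3) rho(3) le'(2)] r \<open>u = 0\<close> by simp
    qed
    then show "box_code (p # ks) la < box_code (p # ks) rho"
      using box_code_Cons_less_iff[OF la(3) rho(3)] la rho by simp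
  qed
qed

text \<open>Modulo \<open>D\<close> the group \<open>J\<close> is abelian, so every subgroup between
  them is normal in \<open>J\<close>. Whenever possible an element of \<open>H\<close> is adjoined,
  at no cost; otherwise one of prime order modulo the group reached, at the cost of one
  coordinate.\<close>

lemma ladder_extend_abelian:
  assumes fin: "finite (carrier G)" and H: "subgroup H G" and J: "subgroup J G"
    and D: "subgroup D G" and DJ: "D \<subseteq> J"
    and comm: "\<And>g h. g \<in> J \<Longrightarrow> h \<in> J \<Longrightarrow> g \<otimes> h \<otimes> inv g \<otimes> inv h \<in> D"
    and lad: "ladder H D ks x" and primes: "\<forall>k\<in>set ks. prime k"
  shows "\<exists>ks x. (\<forall>k\<in>set ks. prime k) \<and> ladder H J ks x"
  using D DJ comm lad primes
proof (induction "card J - card D" arbitrary: D ks x rule: less_induct)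
  case less
  note D = less.prems(1) and DJ = less.prems(2) and comm = less.prems(3) and lad = less.prems(4)
  have JG: "J \<subseteq> carrier G" using subgroup.subset[OF J] .
  have finJ: "finite J" using finite_subset[OF JG fin] .
  have norm: "g \<otimes> n \<otimes> inv g \<in> D" if "g \<in> J" "n \<in> D" for g n
  proof -
    have "g \<otimes> n \<otimes> inv g \<otimes> inv n \<otimes> n \<in> D"
      using comm[of g n] that DJ D by (auto intro: subgroup.m_closed)
    moreover have "g \<otimes> n \<otimes> inv g \<otimes> inv n \<otimes> n = g \<otimes> n \<otimes> inv g"
    proof -
      have "g \<in> carrier G" "n \<in> carrier G" using that JG DJ by auto
      then show ?thesis by (simp add: group_normalize)
    qed
    ultimately show ?thesis by simp
  qed
  have extend: ?case
    if z: "z \<in> J" "z \<notin> D" and lad': "ladder H {n \<otimes> z [^] (i::int) | n i. n \<in> D} ks' x'"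
      and primes': "\<forall>k\<in>set ks'. prime k" for z ks' x'
  proof -
    let ?D1 = "{n \<otimes> z [^] (i::int) | n i. n \<in> D}"
    have sub: "subgroup ?D1 G"
    proof (rule subgroup_extend_power[OF D])
      show "z \<in> carrier G" using z JG by auto
      fix g n assume "g \<in> generate G (insert z D)" "n \<in> D"
      moreover have "generate G (insert z D) \<subseteq> J"
        using z DJ J by (intro generate_subgroup_incl) auto
      ultimately show "g \<otimes> n \<otimes> inv g \<in> D" using norm by blast
    qed
    have D1J: "?D1 \<subseteq> J"
    proof clarify
      fix n i assume "n \<in> D"
      then show "n \<otimes> z [^] (i::int) \<in> J"
        using DJ subgroup.m_closed[OF J] subgroup_int_pow_closed[OF J z(1)] by blast
    qed
    have DD1: "D \<subseteq> ?D1"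
    proof
      fix n assume "n \<in> D"
      then have "n = n \<otimes> z [^] (0::int)" using subgroup.mem_carrier[OF D] by simp
      then show "n \<in> ?D1" using \<open>n \<in> D\<close> by blast
    qed
    have "z = \<one> \<otimes> z [^] (1::int)" using z JG int_pow_1[of z] by auto
    then have "z \<in> ?D1" using subgroup.one_closed[OF D] by blast
    then have "D \<subset> ?D1" using DD1 z(2) by blast
    then have "card D < card ?D1" using finite_subset[OF D1J finJ] by (rule psubset_card_mono[rotated])
    moreover have "card ?D1 \<le> card J" using D1J finJ by (rule card_mono[rotated])
    ultimately have "card J - card ?D1 < card J - card D" by simp
    then show ?case
      using comm DD1 by (intro less.hyps[OF _ sub D1J _ lad' primes']) blast+
  qed
  show ?case
  proof (cases "H \<inter> J \<subseteq> D")
    case False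
    then obtain h where h: "h \<in> H" "h \<in> J" "h \<notin> D" by blast
    have "ladder H {n \<otimes> h [^] (i::int) | n i. n \<in> D} ks x"
    proof (rule ladder_extend_in_subgroup[OF H D h(1) _ lad])
      fix i :: int and n assume "n \<in> D"
      then show "h [^] i \<otimes> n \<otimes> inv (h [^] i) \<in> D"
        using norm subgroup_int_pow_closed[OF J h(2)] by blast
    qed
    from extend[OF h(2,3) this less.prems(5)] show ?thesis .
  next
    case True
    show ?thesis
    proof (cases "D = J")
      case True
      then show ?thesis using lad less.prems(5) by blast
    next
      case False
      then obtain z where z: "z \<in> J" "z \<notin> D" using DJ by blast
      have zG: "z \<in> carrier G" using z JG by blast
      have zJ: "z [^] (i::nat) \<in> J" for i
        using subgroup_int_pow_closed[OF J z(1), of "int i"] by (simp add: int_pow_int)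
      define e where "e = (LEAST e. 0 < e \<and> z [^] (e::nat) \<in> D)"
      have "0 < Coset.order G \<and> z [^] Coset.order G \<in> D"
        using zG fin subgroup.one_closed[OF D] by (auto simp: pow_order_eq_1 order_gt_0_iff_finite)
      then have e: "0 < e \<and> z [^] e \<in> D" unfolding e_def by (rule LeastI)
      have e_min: "z [^] i \<notin> D" if "0 < i" "i < e" for i
        using not_less_Least[of i "\<lambda>e. 0 < e \<and> z [^] (e::nat) \<in> D"] that by (auto simp flip: e_def)
      have "e \<noteq> 1" using e z(2) zG by auto
      then obtain p where p: "prime p" "p dvd e" using prime_factor_nat by blast
      then obtain q where q: "e = p * q" by (auto elim: dvdE)
      have p0: "p > 1" "q > 0" using p(1) e q prime_gt_1_nat by (auto intro: Nat.gr0I)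
      \<comment> \<open>As \<open>e\<close> is the order of \<open>z\<close> modulo
        \<open>D\<close>, this power has prime order \<open>p\<close> modulo \<open>D\<close>. Prime
        lengths are what makes the rank of the box equal to \<open>K_fun\<close> of its
        size.\<close>
      define y where "y = z [^] q"
      have yG: "y \<in> carrier G" and yJ: "y \<in> J" using zG zJ by (auto simp: y_def)
      have ypow: "y [^] i = z [^] (q * i)" for i :: nat using zG by (simp add: y_def nat_pow_pow)
      have yJpow: "y [^] (i::nat) \<in> J" for i by (simp add: ypow zJ)
      have ylt: "y [^] i \<notin> D" if "0 < i" "i < p" for i
        unfolding ypow using that p0 q by (intro e_min) (auto simp: mult.commute)
      have yD: "y \<notin> D" using ylt[of 1] p0 yG by simp
      have yp: "y [^] p \<in> D" using e q by (simp add: ypow mult.commute)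
      let ?D1 = "{n \<otimes> y [^] (i::int) | n i. n \<in> D}"
      have D1J: "?D1 \<subseteq> J"
      proof clarify
        fix n i assume "n \<in> D"
        then show "n \<otimes> y [^] (i::int) \<in> J"
          using DJ subgroup.m_closed[OF J] subgroup_int_pow_closed[OF J yJ] by blast
      qed
      have sub: "subgroup ?D1 G"
      proof (rule subgroup_extend_power[OF D yG])
        fix g n assume "g \<in> generate G (insert y D)" "n \<in> D"
        moreover have "generate G (insert y D) \<subseteq> J"
          using yJ DJ J by (intro generate_subgroup_incl) auto
        ultimately show "g \<otimes> n \<otimes> inv g \<in> D" using norm by blast
      qed
      have "ladder H ?D1 (p # ks) (\<lambda>la. x (tl la) \<otimes> y [^] hd la)"
        using True D1J p0 norm yJpow
        by (intro ladder_extend_transversal[OF D yG _ sub _ yp ylt _ lad]) auto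
      from extend[OF yJ yD this] show ?thesis using less.prems(5) p(1) by simp
    qed
  qed
qed

text \<open>The soluble series lives in the permutation group, the ladder in \<open>G\<close>, so
  every term is replaced by its preimage. The preimage of the trivial group lies in \<open>H\<close>
  and amounts to a single point.\<close>

lemma ladder_preimage_solvable:
  assumes fin: "finite (carrier G)" and H: "subgroup H G"
    and hom: "group_hom G B \<phi>" and T: "subgroup T B"
    and seq: "solvable_seq (B\<lparr>carrier := T\<rparr>) S"
    and ker: "\<And>g. g \<in> carrier G \<Longrightarrow> \<phi> g = \<one>\<^bsub>B\<^esub> \<Longrightarrow> g \<in> H"
  shows "\<exists>ks x. (\<forall>k\<in>set ks. prime k) \<and> ladder H {g \<in> carrier G. \<phi> g \<in> S} ks x"
proof -
  interpret \<phi>: group_hom G B \<phi> by (rule hom)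
  let ?BT = "B\<lparr>carrier := T\<rparr>"
  interpret BT: group ?BT by (rule subgroup.subgroup_is_group[OF T \<phi>.H.group_axioms])
  have pre: "subgroup {g \<in> carrier G. \<phi> g \<in> S} G" if "subgroup S B" for S
  proof (rule subgroupI)
    show "{g \<in> carrier G. \<phi> g \<in> S} \<noteq> {}"
      using subgroup.one_closed[OF that] by (intro ex_in_conv[THEN iffD1] exI[of _ \<one>]) auto
  qed (use that in \<open>auto simp: subgroup.m_closed subgroup.m_inv_closed\<close>)
  have sub: "subgroup S B" if "subgroup S ?BT" for S
    by (rule \<phi>.H.incl_subgroup[OF T that])
  from seq show ?thesis
  proof induction
    case unity
    have "ladder H {g \<in> carrier G. \<phi> g \<in> {\<one>\<^bsub>?BT\<^esub>}} [] (\<lambda>_. \<one>)"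
      using ker by (intro ladder_trivial) auto
    then show ?case by (intro exI[of _ "[]"] exI[of _ "\<lambda>_. \<one>"]) simp
  next
    case (extension K S)
    have subK: "subgroup K ?BT" by (rule BT.solvable_imp_subgroup[OF extension.hyps(1)])
    have KS: "K \<subseteq> S"
      using normal_imp_subgroup[OF extension.hyps(2)] subgroup.subset by fastforce
    have der: "derived ?BT S \<subseteq> K"
      by (rule BT.derived_of_subgroup_minimal[OF extension.hyps(2-4)])
    have inv_eq: "inv\<^bsub>?BT\<^esub> t = inv\<^bsub>B\<^esub> t" if "t \<in> T" for t
      using \<phi>.H.m_inv_consistent[OF T that] by simp
    have ST: "S \<subseteq> T" using subgroup.subset[OF extension.hyps(3)] by simp
    obtain ks x where ks: "\<forall>k\<in>set ks. prime k" and lad: "ladder H {g \<in> carrier G. \<phi> g \<in> K} ks x"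
      using extension.IH by blast
    show ?case
    proof (rule ladder_extend_abelian[OF fin H pre[OF sub[OF extension.hyps(3)]] pre[OF sub[OF subK]] _ _ lad ks])
      show "{g \<in> carrier G. \<phi> g \<in> K} \<subseteq> {g \<in> carrier G. \<phi> g \<in> S}" using KS by auto
    next
      fix g h assume g: "g \<in> {g \<in> carrier G. \<phi> g \<in> S}" and h: "h \<in> {g \<in> carrier G. \<phi> g \<in> S}"
      have "\<phi> g \<otimes>\<^bsub>?BT\<^esub> \<phi> h \<otimes>\<^bsub>?BT\<^esub> inv\<^bsub>?BT\<^esub> (\<phi> g) \<otimes>\<^bsub>?BT\<^esub> inv\<^bsub>?BT\<^esub> (\<phi> h) \<in> derived ?BT S"
        unfolding derived_def using g h by (intro generate.incl) blast
      then have "\<phi> g \<otimes>\<^bsub>B\<^esub> \<phi> h \<otimes>\<^bsub>B\<^esub> inv\<^bsub>B\<^esub> (\<phi> g) \<otimes>\<^bsub>B\<^esub> inv\<^bsub>B\<^esub> (\<phi> h) \<in> K"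
      proof -
        assume "\<phi> g \<otimes>\<^bsub>?BT\<^esub> \<phi> h \<otimes>\<^bsub>?BT\<^esub> inv\<^bsub>?BT\<^esub> (\<phi> g) \<otimes>\<^bsub>?BT\<^esub> inv\<^bsub>?BT\<^esub> (\<phi> h) \<in> derived ?BT S"
        moreover have "\<phi> g \<in> T" "\<phi> h \<in> T" using g h ST by auto
        ultimately show ?thesis using subsetD[OF der] by (simp add: inv_eq)
      qed
      then show "g \<otimes> h \<otimes> inv g \<otimes> inv h \<in> {g \<in> carrier G. \<phi> g \<in> K}"
        using g h by simp
    qed
  qed
qed

section \<open>The permutation group on the right cosets\<close>

lemma coset_act_rcoset:
  assumes "subgroup H G" "g \<in> carrier G" "a \<in> carrier G"
  shows "coset_act G g (H #> a) = H #> (a \<otimes> inv g)"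
  unfolding coset_act_def using assms by (simp add: coset_mult_assoc subgroup.subset)

lemma coset_perm_hom:
  assumes H: "subgroup H G"
  shows "group_hom G (BijGroup (rcosets H)) (\<lambda>g. restrict (coset_act G g) (rcosets H))"
proof -
  let ?\<phi> = "\<lambda>g. restrict (coset_act G g) (rcosets H)"
  have HG: "H \<subseteq> carrier G" by (rule subgroup.subset[OF H])
  have rc: "\<exists>a\<in>carrier G. C = H #> a" if "C \<in> rcosets H" for C
    using that by (auto simp: RCOSETS_def)
  have act: "coset_act G g C \<in> rcosets H" if "g \<in> carrier G" "C \<in> rcosets H" for g C
    using rc[OF that(2)] that(1) HG by (auto simp: coset_act_rcoset[OF H] intro!: rcosetsI)
  have comp: "coset_act G (g \<otimes> h) C = coset_act G g (coset_act G h C)"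
    if "g \<in> carrier G" "h \<in> carrier G" "C \<in> rcosets H" for g h C
    using rc[OF that(3)] that(1,2) by (auto simp: coset_act_rcoset[OF H] inv_mult_group m_assoc)
  have one: "coset_act G \<one> C = C" if "C \<in> rcosets H" for C
    using rc[OF that] by (auto simp: coset_act_rcoset[OF H])
  have Bij: "?\<phi> g \<in> Bij (rcosets H)" if g: "g \<in> carrier G" for g
  proof -
    have "bij_betw (coset_act G g) (rcosets H) (rcosets H)"
      using g act comp[of "inv g" g] comp[of g "inv g"] one
      by (intro bij_betw_byWitness[where f' = "coset_act G (inv g)"]) auto
    then show ?thesis
      by (simp add: Bij_def bij_betw_restrict_eq)
  qed
  show ?thesis
  proof (intro group_hom.intro group_hom_axioms.intro group_axioms group_BijGroup homI)
    fix g assume "g \<in> carrier G"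
    then show "?\<phi> g \<in> carrier (BijGroup (rcosets H))" using Bij by (simp add: BijGroup_def)
  next
    fix g h assume "g \<in> carrier G" "h \<in> carrier G"
    then show "?\<phi> (g \<otimes> h) = ?\<phi> g \<otimes>\<^bsub>BijGroup (rcosets H)\<^esub> ?\<phi> h"
      using Bij act comp by (auto simp: BijGroup_def compose_def restrict_def fun_eq_iff)
  qed
qed

lemma soluble_transversal:
  assumes fin: "finite (carrier G)" and H: "subgroup H G"
    and sol: "has_soluble_transitive_subgroup (rcosets H) (coset_perm_group G H)"
  obtains x :: "nat \<Rightarrow> 'a" and col :: "nat \<Rightarrow> nat list"
  where "\<And>i. i < card (rcosets H) \<Longrightarrow> x i \<in> carrier G"
    and "\<And>g. g \<in> carrier G \<Longrightarrow> \<exists>!i. i < card (rcosets H) \<and> g \<otimes> inv (x i) \<in> H"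
    and "\<And>i j k l. i \<le> j \<Longrightarrow> j < k \<Longrightarrow> k < card (rcosets H) \<Longrightarrow> l < card (rcosets H) \<Longrightarrow> col i = col j \<Longrightarrow>
           x k \<otimes> inv (x j) \<otimes> x i \<otimes> inv (x l) \<in> H \<Longrightarrow> i < l"
    and "real (card (col ` {..<card (rcosets H)})) \<le> omega_tilde (card (rcosets H))"
proof -
  define \<phi> where "\<phi> = (\<lambda>g. restrict (coset_act G g) (rcosets H))"
  define B where "B = BijGroup (rcosets H)"
  interpret \<phi>: group_hom G B \<phi> unfolding \<phi>_def B_def by (rule coset_perm_hom[OF H])
  have HG: "H \<subseteq> carrier G" by (rule subgroup.subset[OF H])
  have H_rc: "H \<in> rcosets H" by (rule subgroup.subgroup_in_rcosets[OF H group_axioms])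
  have actH: "\<phi> g H = H #> inv g" if "g \<in> carrier G" for g
    using that H_rc by (simp add: \<phi>_def coset_act_def)
  have memI: "a \<otimes> inv b \<in> H \<longleftrightarrow> H #> a = H #> b" if "a \<in> carrier G" "b \<in> carrier G" for a b
  proof
    assume *: "a \<otimes> inv b \<in> H"
    have "a = (a \<otimes> inv b) \<otimes> b" using that by (simp add: m_assoc)
    then have "a \<in> H #> b" using * by (metis rcosI HG that(2))
    then show "H #> a = H #> b" by (metis repr_independence[OF _ that(2) H])
  next
    assume "H #> a = H #> b"
    then have "a \<in> H #> b" using rcos_self[OF that(1) H] by simp
    then show "a \<otimes> inv b \<in> H"
      using HG that by (auto simp: r_coset_def m_assoc subset_iff)
  qed
  obtain T where T: "T \<subseteq> coset_perm_group G H" "subgroup T B" "solvable (B\<lparr>carrier := T\<rparr>)"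
    "\<forall>a\<in>rcosets H. \<forall>b\<in>rcosets H. \<exists>t\<in>T. t a = b"
    using sol unfolding has_soluble_transitive_subgroup_def B_def by blast
  have "solvable_seq (B\<lparr>carrier := T\<rparr>) T" using T(3) by (simp add: solvable_def)
  moreover have "g \<in> H" if "g \<in> carrier G" "\<phi> g = \<one>\<^bsub>B\<^esub>" for g
  proof -
    have "H #> inv g = H" using actH[OF that(1)] that(2) H_rc by (simp add: B_def BijGroup_def)
    then have "inv g \<in> H" using rcos_self[OF inv_closed[OF that(1)] H] by simp
    then show ?thesis using subgroup.m_inv_closed[OF H] that(1) inv_inv by metis
  qed
  ultimately obtain ks y where ks: "\<forall>k\<in>set ks. prime k"
    and lad: "ladder H {g \<in> carrier G. \<phi> g \<in> T} ks y"
    using ladder_preimage_solvable[OF fin H \<phi>.group_hom_axioms T(2)] by blast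
  define J where "J = {g \<in> carrier G. \<phi> g \<in> T}"
  note lad = lad[folded J_def]
  have JG: "J \<subseteq> carrier G" by (auto simp: J_def)
  \<comment> \<open>By transitivity the preimage of \<open>T\<close> meets every right coset of
    \<open>H\<close>, so a transversal within it serves for all of \<open>G\<close>. The
    representative is an inverse because \<open>coset_act\<close> multiplies by inverses.\<close>
  have meets: "\<exists>j\<in>J. H #> g = H #> j" if g: "g \<in> carrier G" for g
  proof -
    obtain t where t: "t \<in> T" "t H = H #> g" using T(4) H_rc rcosetsI[OF HG g] by blast
    then obtain j where j: "j \<in> carrier G" "t = \<phi> j" using T(1) by (auto simp: coset_perm_group_def \<phi>_def)
    have "subgroup J G"
    proof (unfold J_def, rule subgroupI)
      show "{g \<in> carrier G. \<phi> g \<in> T} \<noteq> {}" using t j by blast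
    qed (use T(2) in \<open>auto simp: subgroup.m_closed subgroup.m_inv_closed\<close>)
    moreover have "j \<in> J" using t j by (simp add: J_def)
    ultimately have "inv j \<in> J" by (rule subgroup.m_inv_closed)
    then show ?thesis using t j actH[OF j(1)] by auto
  qed
  have yG: "y la \<in> carrier G" if "la \<in> box ks" for la using ladderD(1)[OF lad that] JG by auto
  have ex1: "\<exists>!la. la \<in> box ks \<and> g \<otimes> inv (y la) \<in> H" if g: "g \<in> carrier G" for g
  proof -
    obtain j where j: "j \<in> J" "H #> g = H #> j" using meets[OF g] by blast
    have "(la \<in> box ks \<and> g \<otimes> inv (y la) \<in> H) = (la \<in> box ks \<and> j \<otimes> inv (y la) \<in> H)" for la
      using memI[OF g yG[of la]] memI[of j "y la"] yG[of la] j JG by auto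
    then show ?thesis using ladderD(2)[OF lad j(1)] by simp
  qed
  have "bij_betw (\<lambda>la. H #> y la) (box ks) (rcosets H)"
  proof (rule bij_betw_imageI)
    show "inj_on (\<lambda>la. H #> y la) (box ks)"
    proof (rule inj_onI)
      fix la mu assume *: "la \<in> box ks" "mu \<in> box ks" "H #> y la = H #> y mu"
      then have "y la \<otimes> inv (y mu) \<in> H" using memI yG by simp
      moreover have "y la \<otimes> inv (y la) \<in> H" using yG[OF *(1)] subgroup.one_closed[OF H] by simp
      ultimately show "la = mu" using ex1[OF yG[OF *(1)]] * by blast
    qed
    show "(\<lambda>la. H #> y la) ` box ks = rcosets H"
    proof (intro equalityI subsetI)
      fix C assume "C \<in> (\<lambda>la. H #> y la) ` box ks"
      then show "C \<in> rcosets H" using yG rcosetsI[OF HG] by auto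
    next
      fix C assume "C \<in> rcosets H"
      then obtain g where g: "g \<in> carrier G" "C = H #> g" by (auto simp: RCOSETS_def)
      then obtain la where "la \<in> box ks" "g \<otimes> inv (y la) \<in> H" using ex1 by blast
      then show "C \<in> (\<lambda>la. H #> y la) ` box ks" using memI[OF g(1) yG] g(2) by auto
    qed
  qed
  then have s: "card (rcosets H) = prod_list ks" using bij_betw_same_card card_box by metis
  define dec where "dec = inv_into (box ks) (box_code ks)"
  have dec: "dec i \<in> box ks" "box_code ks (dec i) = i" if "i < card (rcosets H)" for i
    using that bij_betw_box_code[of ks] unfolding s dec_def
    by (auto simp: bij_betw_def inv_into_into f_inv_into_f)
  have dec_code: "dec (box_code ks la) = la" "box_code ks la < card (rcosets H)" if "la \<in> box ks" for la
    using that inj_on_box_code box_code_less unfolding dec_def s by (auto simp: inv_into_f_f)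
  show thesis
  \<comment> \<open>Points are numbered by their codes, and the colour of a point is the bottom of
    its chain, so that colours correspond to chains.\<close>
  proof (rule that[of "\<lambda>i. y (dec i)" "\<lambda>i. chain_bottom ks (dec i)"])
    fix i assume "i < card (rcosets H)"
    then show "y (dec i) \<in> carrier G" using yG dec by simp
  next
    fix g assume g: "g \<in> carrier G"
    then obtain la where la: "la \<in> box ks" "g \<otimes> inv (y la) \<in> H"
      and uniq: "\<And>mu. mu \<in> box ks \<Longrightarrow> g \<otimes> inv (y mu) \<in> H \<Longrightarrow> mu = la" using ex1 by blast
    show "\<exists>!i. i < card (rcosets H) \<and> g \<otimes> inv (y (dec i)) \<in> H"
    proof (rule ex1I[of _ "box_code ks la"])
      show "box_code ks la < card (rcosets H) \<and> g \<otimes> inv (y (dec (box_code ks la))) \<in> H"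
        using la dec_code by simp
    next
      fix i assume "i < card (rcosets H) \<and> g \<otimes> inv (y (dec i)) \<in> H"
      then show "i = box_code ks la" using uniq[of "dec i"] dec by metis
    qed
  next
    fix i j k l
    assume *: "i \<le> j" "j < k" "k < card (rcosets H)" "l < card (rcosets H)"
      "chain_bottom ks (dec i) = chain_bottom ks (dec j)"
      "y (dec k) \<otimes> inv (y (dec j)) \<otimes> y (dec i) \<otimes> inv (y (dec l)) \<in> H"
    have d: "dec i \<in> box ks" "dec j \<in> box ks" "dec k \<in> box ks" "dec l \<in> box ks"
      and c: "box_code ks (dec i) = i" "box_code ks (dec j) = j" "box_code ks (dec k) = k" "box_code ks (dec l) = l"
      using dec * by auto
    have "list_all2 (\<le>) (dec i) (dec j)"
    \<comment> \<open>Points of one chain are comparable; as codes are monotone, the numbering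
      decides which one is smaller.\<close>
    proof (cases "sum_list (dec i) \<le> sum_list (dec j)")
      case True
      then show ?thesis using chain_comparable[OF d(1,2) *(5)] by simp
    next
      case False
      then have "list_all2 (\<le>) (dec j) (dec i)" using chain_comparable[OF d(2,1)] *(5) by simp
      then have "j \<le> i" using box_code_mono[of "dec j" "dec i" ks] c by simp
      then have "i = j" using *(1) by simp
      then show ?thesis by (simp add: list_all2_refl)
    qed
    from ladderD(3)[OF lad d(1,2,3,4) this _ *(6)] show "i < l" using *(2) c by simp
  next
    have "(\<lambda>i. chain_bottom ks (dec i)) ` {..<card (rcosets H)} \<subseteq> chain_bottom ks ` box ks"
      using dec by auto
    then have "card ((\<lambda>i. chain_bottom ks (dec i)) ` {..<card (rcosets H)}) \<le> card (chain_bottom ks ` box ks)"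
      by (intro card_mono finite_imageI finite_box)
    also have "real (card (chain_bottom ks ` box ks)) \<le> real (prod_list ks) * central_prob (box_rank ks)"
      using ks prime_ge_1_nat by (intro card_chains_le_central_prob) auto
    also have "\<dots> = omega_tilde (card (rcosets H))"
      using K_fun_prod_list[OF ks] by (simp add: omega_tilde_eq s)
    finally show "real (card ((\<lambda>i. chain_bottom ks (dec i)) ` {..<card (rcosets H)})) \<le> omega_tilde (card (rcosets H))"
      by simp
  qed
qed

end

section \<open>Generators of submodules of induced modules\<close>

text \<open>Encodes a strictly increasing chain of submodules by one new generator for each
  step.\<close>

definition indep_list ::
    "('f::field \<Rightarrow> 'v::ab_group_add \<Rightarrow> 'v) \<Rightarrow> ('g, 'r) monoid_scheme \<Rightarrow> ('g \<Rightarrow> 'v \<Rightarrow> 'v) \<Rightarrow>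
      'v set \<Rightarrow> 'v list \<Rightarrow> bool" where
  "indep_list sc G act V vs \<longleftrightarrow>
     set vs \<subseteq> V \<and> (\<forall>k<length vs. vs ! k \<notin> generated_submodule sc G act V (set (take k vs)))"

lemma indep_list_Nil: "indep_list sc G act V []"
  by (simp add: indep_list_def)

lemma indep_list_snoc:
  "indep_list sc G act V (vs @ [v]) \<longleftrightarrow>
     indep_list sc G act V vs \<and> v \<in> V \<and> v \<notin> generated_submodule sc G act V (set vs)"
  by (auto simp: indep_list_def nth_append less_Suc_eq)

lemma generated_submodule_superset: "S \<subseteq> generated_submodule sc G act V S"
  by (simp add: generated_submodule_def hull_subset)

lemma generated_submodule_mono:
  "S \<subseteq> T \<Longrightarrow> generated_submodule sc G act V S \<subseteq> generated_submodule sc G act V T"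
  by (simp add: generated_submodule_def hull_mono)

lemma generated_submodule_minimal:
  "is_submodule sc G act N V \<Longrightarrow> S \<subseteq> N \<Longrightarrow> generated_submodule sc G act V S \<subseteq> N"
  by (simp add: generated_submodule_def hull_minimal)

lemma is_submodule_trans:
  "is_submodule sc G act N M \<Longrightarrow> is_submodule sc G act M V \<Longrightarrow> is_submodule sc G act N V"
  by (auto simp: is_submodule_def)

lemma rep_module_restrict:
  assumes "rep_module (G\<lparr>carrier := H\<rparr>) sc act V" "K \<subseteq> H" "group (G\<lparr>carrier := K\<rparr>)"
  shows "rep_module (G\<lparr>carrier := K\<rparr>) sc act V"
proof -
  interpret rep_module "G\<lparr>carrier := H\<rparr>" sc act V by (rule assms(1))
  have KH: "g \<in> carrier (G\<lparr>carrier := H\<rparr>)" if "g \<in> K" for g using assms(2) that by auto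
  show ?thesis
  proof (intro rep_module.intro rep_module_axioms.intro assms(3) vector_space_axioms subspace_V)
    fix g h v assume "g \<in> carrier (G\<lparr>carrier := K\<rparr>)" "h \<in> carrier (G\<lparr>carrier := K\<rparr>)" "v \<in> V"
    then show "act (g \<otimes>\<^bsub>G\<lparr>carrier := K\<rparr>\<^esub> h) v = act g (act h v)"
      using act_mult[OF KH KH, of g h v] by simp
  next
    show "act \<one>\<^bsub>G\<lparr>carrier := K\<rparr>\<^esub> v = v" if "v \<in> V" for v
      using act_one[OF that] by simp
  qed (use KH act_closed act_add act_scale in simp_all)
qed

context rep_module
begin

lemma act_zero: "g \<in> carrier G \<Longrightarrow> act g 0 = 0"
  using act_scale[of g 0 0] subspace_0[OF subspace_V] by simp

lemma is_submodule_self: "is_submodule scale G act V V"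
  using subspace_V act_closed by (auto simp: is_submodule_def)

lemma is_submodule_Inter:
  assumes "\<And>N. N \<in> \<N> \<Longrightarrow> is_submodule scale G act N V" "\<N> \<noteq> {}"
  shows "is_submodule scale G act (\<Inter>\<N>) V"
  using assms by (auto simp: is_submodule_def intro!: subspace_Inter)

lemma generated_submodule_is_submodule:
  assumes "S \<subseteq> V"
  shows "is_submodule scale G act (generated_submodule scale G act V S) V"
  unfolding generated_submodule_def hull_def
  using assms is_submodule_self by (intro is_submodule_Inter) auto

text \<open>One list serves the whole index set. At each index \<open>b\<close>, taken in increasing
  order, it is prolonged as far as possible by elements of \<open>L b\<close>; maximality puts
  \<open>L b\<close> into the submodule generated so far. Hence \<open>n\<close> bounds the cost of
  a whole chain, not just that of one point.\<close>

lemma chain_generators: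
  assumes bound: "\<And>vs. indep_list scale G act V vs \<Longrightarrow> length vs \<le> n"
    and "finite (I :: nat set)" and L: "\<And>i. i \<in> I \<Longrightarrow> L i \<subseteq> V"
  shows "\<exists>ps. indep_list scale G act V (map snd ps) \<and> set ps \<subseteq> Sigma I L \<and>
           (\<forall>i\<in>I. L i \<subseteq> generated_submodule scale G act V {v. \<exists>j\<le>i. (j, v) \<in> set ps})"
  using assms(2,3)
proof (induction I rule: finite_linorder_max_induct)
  case empty
  then show ?case by (intro exI[of _ "[]"]) (simp add: indep_list_Nil)
next
  case (insert b A)
  then obtain ps where ps: "indep_list scale G act V (map snd ps)" "set ps \<subseteq> Sigma A L"
    "\<forall>i\<in>A. L i \<subseteq> generated_submodule scale G act V {v. \<exists>j\<le>i. (j, v) \<in> set ps}"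
    by auto
  let ?P = "\<lambda>us. set us \<subseteq> L b \<and> indep_list scale G act V (map snd ps @ us)"
  have 1: "?P []" using ps(1) by simp
  have 2: "\<forall>us. ?P us \<longrightarrow> length us < Suc n"
  proof (intro allI impI)
    fix us assume "?P us"
    then have "length (map snd ps @ us) \<le> n" by (intro bound) (elim conjE)
    then show "length us < Suc n" by simp
  qed
  from ex_has_greatest_nat[of ?P "[]" length "Suc n", OF 1 2]
  obtain us where us: "?P us" and max: "\<forall>us'. ?P us' \<longrightarrow> length us' \<le> length us"
    by (elim exE) (rule that, erule conjunct1, erule conjunct2)
  have Lb: "L b \<subseteq> generated_submodule scale G act V (set (map snd ps @ us))"
  proof
    fix v assume v: "v \<in> L b"
    show "v \<in> generated_submodule scale G act V (set (map snd ps @ us))"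
    proof (rule ccontr)
      assume "\<not> ?thesis"
      then have "?P (us @ [v])"
        using us v insert.prems[of b] indep_list_snoc[of scale G act V "map snd ps @ us" v]
        by (auto simp: subset_iff)
      then have "length (us @ [v]) \<le> length us" using max by (elim allE impE)
      then show False by simp
    qed
  qed
  let ?ps = "ps @ map (Pair b) us"
  have "map snd ?ps = map snd ps @ us" by (simp add: comp_def)
  moreover have "set ?ps \<subseteq> Sigma (insert b A) L" using ps(2) us by auto
  moreover have "L i \<subseteq> generated_submodule scale G act V {v. \<exists>j\<le>i. (j, v) \<in> set ?ps}" if "i \<in> insert b A" for i
  proof (cases "i = b")
    case True
    have "set (map snd ps @ us) \<subseteq> {v. \<exists>j\<le>b. (j, v) \<in> set ?ps}"
    proof
      fix v assume "v \<in> set (map snd ps @ us)"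
      then consider j where "(j, v) \<in> set ps" | "v \<in> set us" by auto
      then show "v \<in> {v. \<exists>j\<le>b. (j, v) \<in> set ?ps}"
      proof cases
        case 1
        then have "j < b" using ps(2) insert.hyps(2) by blast
        with 1 show ?thesis by (intro CollectI exI[of _ j]) simp
      next
        case 2
        then show ?thesis by (intro CollectI exI[of _ b]) simp
      qed
    qed
    from generated_submodule_mono[OF this] Lb show ?thesis unfolding True by blast
  next
    case False
    then have "i \<in> A" using that by simp
    then have "L i \<subseteq> generated_submodule scale G act V {v. \<exists>j\<le>i. (j, v) \<in> set ps}" using ps(3) by blast
    also have "\<dots> \<subseteq> generated_submodule scale G act V {v. \<exists>j\<le>i. (j, v) \<in> set ?ps}"
      by (rule generated_submodule_mono) auto
    finally show ?thesis .
  qed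
  ultimately show ?case using us by (intro exI[of _ ?ps]) simp
qed

end

section \<open>Leading coefficients in induced modules\<close>

locale ladder_module = group G + V: rep_module "G\<lparr>carrier := H\<rparr>" scale act V
  for G :: "('g, 'r) monoid_scheme" (structure) and H
    and scale :: "'f::field \<Rightarrow> 'v::ab_group_add \<Rightarrow> 'v" and act :: "'g \<Rightarrow> 'v \<Rightarrow> 'v" and V :: "'v set" +
  fixes K :: "'g set" and x :: "nat \<Rightarrow> 'g" and s :: nat and col :: "nat \<Rightarrow> 'k"
  assumes H_subgroup: "subgroup H G"
    and K_subset: "K \<subseteq> H"
    and K_group: "group (G\<lparr>carrier := K\<rparr>)"
    and K_normal: "g \<in> carrier G \<Longrightarrow> h \<in> K \<Longrightarrow> g \<otimes> h \<otimes> inv g \<in> K"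
    and x_closed: "i < s \<Longrightarrow> x i \<in> carrier G"
    and x_transversal: "g \<in> carrier G \<Longrightarrow> \<exists>i<s. g \<otimes> inv (x i) \<in> H"
    and x_ladder: "i \<le> j \<Longrightarrow> j < k \<Longrightarrow> k < s \<Longrightarrow> l < s \<Longrightarrow> col i = col j \<Longrightarrow>
           x k \<otimes> inv (x j) \<otimes> x i \<otimes> inv (x l) \<in> H \<Longrightarrow> i < l"
begin

sublocale F: vector_space "fun_scale scale"
  by (rule vector_space_fun_scale) (rule V.vector_space_axioms)

lemma H_carrier: "h \<in> H \<Longrightarrow> h \<in> carrier G"
  using subgroup.mem_carrier[OF H_subgroup] .

text \<open>The analogue of leading coefficients of polynomials, the last point of the support
  playing the part of the degree; 0 is included because \<open>f (x i)\<close> may vanish.\<close>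

definition leading :: "('g \<Rightarrow> 'v) set \<Rightarrow> nat \<Rightarrow> 'v set" where
  "leading N i = {f (x i) | f. f \<in> N \<and> (\<forall>k<s. i < k \<longrightarrow> f (x k) = 0)}"

lemma induced_mult:
  assumes "f \<in> induced G H act V" "h \<in> H" "g \<in> carrier G"
  shows "f (h \<otimes> g) = act h (f g)"
  using assms by (simp add: induced_def)

lemma induced_eq_act:
  assumes "f \<in> induced G H act V" "g \<in> carrier G" "g \<otimes> inv g' \<in> H" "g' \<in> carrier G"
  shows "f g = act (g \<otimes> inv g') (f g')"
proof -
  have "g = (g \<otimes> inv g') \<otimes> g'" using assms by (simp add: m_assoc)
  then show ?thesis using induced_mult[OF assms(1,3,4)] by simp
qed

context
  fixes N assumes N: "is_submodule (fun_scale scale) G (induced_act G) N (induced G H act V)"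
begin

lemma N_induced: "f \<in> N \<Longrightarrow> f \<in> induced G H act V"
  using N by (auto simp: is_submodule_def)

lemma N_subspace: "F.subspace N"
  using N by (auto simp: is_submodule_def)

lemma N_act: "g \<in> carrier G \<Longrightarrow> f \<in> N \<Longrightarrow> induced_act G g f \<in> N"
  using N by (auto simp: is_submodule_def)

text \<open>The action of \<open>k\<close> on the value at \<open>x i\<close> is realised by
  translating \<open>f\<close> by the conjugate \<open>k'\<close>. As \<open>K\<close> is normal in
  \<open>G\<close> and contained in \<open>H\<close>, this translation maps every coset of
  \<open>H\<close> to itself and so keeps the zeros of \<open>f\<close>.\<close>

lemma leading_is_submodule:
  assumes i: "i < s"
  shows "is_submodule scale (G\<lparr>carrier := K\<rparr>) act (leading N i) V"
  unfolding is_submodule_def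
proof (intro conjI ballI)
  have z: "0 (x j) = (0 :: 'v)" for j by (simp add: zero_fun_def)
  show "V.subspace (leading N i)"
    unfolding V.subspace_def
  proof (intro conjI ballI allI)
    have "0 \<in> N" by (rule F.subspace_0[OF N_subspace])
    then show "0 \<in> leading N i" unfolding leading_def by (intro CollectI exI[of _ 0]) auto
  next
    fix v w assume "v \<in> leading N i" "w \<in> leading N i"
    then obtain f f' where f: "v = f (x i)" "f \<in> N" "\<forall>k<s. i < k \<longrightarrow> f (x k) = 0"
      "w = f' (x i)" "f' \<in> N" "\<forall>k<s. i < k \<longrightarrow> f' (x k) = 0" unfolding leading_def by blast
    then show "v + w \<in> leading N i"
      unfolding leading_def using F.subspace_add[OF N_subspace]
      by (intro CollectI exI[of _ "f + f'"]) auto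
  next
    fix c v assume "v \<in> leading N i"
    then obtain f where f: "v = f (x i)" "f \<in> N" "\<forall>k<s. i < k \<longrightarrow> f (x k) = 0"
      unfolding leading_def by blast
    then show "scale c v \<in> leading N i"
      unfolding leading_def using F.subspace_scale[OF N_subspace, of f c]
      by (intro CollectI exI[of _ "fun_scale scale c f"]) (auto simp: fun_scale_def)
  qed
next
  show "leading N i \<subseteq> V"
    using N_induced x_closed[OF i] by (auto simp: leading_def induced_def)
next
  fix k v assume k: "k \<in> carrier (G\<lparr>carrier := K\<rparr>)" and "v \<in> leading N i"
  then obtain f where f: "v = f (x i)" "f \<in> N" "\<forall>k<s. i < k \<longrightarrow> f (x k) = 0"
    unfolding leading_def by blast
  have kK: "k \<in> K" using k by simp
  then have kG: "k \<in> carrier G" using K_subset H_carrier by blast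
  have xG: "x i \<in> carrier G" using x_closed[OF i] .
  define k' where "k' = inv (x i) \<otimes> k \<otimes> x i"
  have k'K: "k' \<in> K" using K_normal[of "inv (x i)" k] xG kK by (simp add: k'_def)
  then have k'G: "k' \<in> carrier G" using K_subset H_carrier by blast
  have "x i \<otimes> k' = k \<otimes> x i" using xG kG by (simp add: k'_def group_normalize)
  then have "induced_act G k' f (x i) = act k v"
    using induced_mult[OF N_induced[OF f(2)], of k "x i"] kK K_subset xG f(1)
    by (auto simp: induced_act_def)
  moreover have "induced_act G k' f (x j) = 0" if j: "j < s" "i < j" for j
  proof -
    have xj: "x j \<in> carrier G" using x_closed[OF j(1)] .
    have kk: "x j \<otimes> k' \<otimes> inv (x j) \<in> H" using K_normal[OF xj k'K] K_subset by blast
    have "f (x j \<otimes> k') = act (x j \<otimes> k' \<otimes> inv (x j)) (f (x j))"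
      using xj k'G kk by (intro induced_eq_act[OF N_induced[OF f(2)]]) auto
    then show ?thesis using f(3) j V.act_zero kk xj by (simp add: induced_act_def)
  qed
  ultimately show "act k v \<in> leading N i"
    unfolding leading_def using N_act[OF k'G f(2)] by (intro CollectI exI[of _ "induced_act G k' f"]) simp
qed

text \<open>Translation by \<open>g = inv (x j) \<otimes> x i\<close> moves the value at
  \<open>x i\<close> to \<open>x j\<close>. For a later point \<open>x k\<close> the ladder
  condition places \<open>x k \<otimes> g\<close> in a coset numbered above \<open>i\<close>, where
  \<open>f\<close> vanishes.\<close>

lemma leading_mono:
  assumes "i \<le> j" "j < s" "col i = col j"
  shows "leading N i \<subseteq> leading N j"
proof
  fix v assume "v \<in> leading N i"
  then obtain f where f: "v = f (x i)" "f \<in> N" "\<forall>k<s. i < k \<longrightarrow> f (x k) = 0"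
    unfolding leading_def by blast
  have xG: "x i \<in> carrier G" "x j \<in> carrier G" using x_closed assms by auto
  define g where "g = inv (x j) \<otimes> x i"
  have gG: "g \<in> carrier G" using xG by (simp add: g_def)
  have "induced_act G g f (x j) = v"
    using xG f(1) by (simp add: induced_act_def g_def group_normalize)
  moreover have "induced_act G g f (x k) = 0" if k: "k < s" "j < k" for k
  proof -
    have xk: "x k \<in> carrier G" using x_closed[OF k(1)] .
    obtain l where l: "l < s" "x k \<otimes> g \<otimes> inv (x l) \<in> H"
      using x_transversal[of "x k \<otimes> g"] xk gG by auto
    have "x k \<otimes> inv (x j) \<otimes> x i \<otimes> inv (x l) \<in> H"
      using l xk xG x_closed[OF l(1)] by (simp add: g_def m_assoc)
    then have "i < l" using x_ladder[OF assms(1) k(2,1) l(1) assms(3)] by simp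
    then have "f (x l) = 0" using f(3) l(1) by simp
    moreover have "f (x k \<otimes> g) = act (x k \<otimes> g \<otimes> inv (x l)) (f (x l))"
      using xk gG l x_closed[OF l(1)] by (intro induced_eq_act[OF N_induced[OF f(2)]]) auto
    ultimately show ?thesis using V.act_zero l(2) xk by (simp add: induced_act_def)
  qed
  ultimately show "v \<in> leading N j"
    unfolding leading_def using N_act[OF gG f(2)] by (intro CollectI exI[of _ "induced_act G g f"]) simp
qed

end

text \<open>For each colour one list of leading coefficients, tagged by their positions, generates
  all leading coefficients of that colour; elements of \<open>M\<close> with these leading
  coefficients generate \<open>M\<close>.\<close>

lemma min_generators_le:
  assumes M: "is_submodule (fun_scale scale) G (induced_act G) M (induced G H act V)"
    and bound: "\<And>vs. indep_list scale (G\<lparr>carrier := K\<rparr>) act V vs \<Longrightarrow> length vs \<le> n"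
  shows "min_generators (fun_scale scale) G (induced_act G) M \<le> n * card (col ` {..<s})"
proof -
  interpret VK: rep_module "G\<lparr>carrier := K\<rparr>" scale act V
    by (rule rep_module_restrict[OF V.rep_module_axioms K_subset K_group])
  define I where "I c = {i. i < s \<and> col i = c}" for c
  define Q where "Q c ps \<longleftrightarrow> indep_list scale (G\<lparr>carrier := K\<rparr>) act V (map snd ps) \<and>
      set ps \<subseteq> Sigma (I c) (leading M) \<and>
      (\<forall>i\<in>I c. leading M i \<subseteq> generated_submodule scale (G\<lparr>carrier := K\<rparr>) act V {v. \<exists>j\<le>i. (j, v) \<in> set ps})"
    for c ps
  have "\<exists>ps. Q c ps" for c
    unfolding Q_def
  proof (rule VK.chain_generators[OF bound])
    show "finite (I c)" by (simp add: I_def)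
    show "leading M i \<subseteq> V" if "i \<in> I c" for i
      using leading_is_submodule[OF M, of i] that by (auto simp: I_def is_submodule_def)
  qed
  then obtain ps where Q: "\<And>c. Q c (ps c)" by metis
  have ps: "indep_list scale (G\<lparr>carrier := K\<rparr>) act V (map snd (ps c))"
    "set (ps c) \<subseteq> Sigma (I c) (leading M)"
    "i \<in> I c \<Longrightarrow> leading M i \<subseteq> generated_submodule scale (G\<lparr>carrier := K\<rparr>) act V {v. \<exists>j\<le>i. (j, v) \<in> set (ps c)}"
    for c i
    using Q[of c] by (simp_all add: Q_def)
  define P where "P = (\<Union>c\<in>col ` {..<s}. set (ps c))"
  have "\<forall>p\<in>P. \<exists>f. f \<in> M \<and> f (x (fst p)) = snd p \<and> (\<forall>k<s. fst p < k \<longrightarrow> f (x k) = 0)"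
  proof
    fix p assume "p \<in> P"
    then obtain c where "p \<in> set (ps c)" unfolding P_def by blast
    then have "snd p \<in> leading M (fst p)" using ps(2)[of c] by auto
    then show "\<exists>f. f \<in> M \<and> f (x (fst p)) = snd p \<and> (\<forall>k<s. fst p < k \<longrightarrow> f (x k) = 0)"
      unfolding leading_def by auto
  qed
  then obtain F where "\<forall>p\<in>P. F p \<in> M \<and> F p (x (fst p)) = snd p \<and> (\<forall>k<s. fst p < k \<longrightarrow> F p (x k) = 0)"
    by (rule bchoice[THEN exE])
  then have F: "p \<in> P \<Longrightarrow> F p \<in> M" "p \<in> P \<Longrightarrow> F p (x (fst p)) = snd p"
    "p \<in> P \<Longrightarrow> k < s \<Longrightarrow> fst p < k \<Longrightarrow> F p (x k) = 0" for p k
    by auto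
  have finP: "finite P" by (simp add: P_def)
  have "card (F ` P) \<le> card P" by (rule card_image_le[OF finP])
  also have "\<dots> \<le> (\<Sum>c\<in>col ` {..<s}. card (set (ps c)))" unfolding P_def by (rule card_UN_le) simp
  also have "\<dots> \<le> (\<Sum>c\<in>col ` {..<s}. n)"
  proof (rule sum_mono)
    fix c
    have "card (set (ps c)) \<le> length (ps c)" by (rule card_length)
    also have "\<dots> \<le> n" using bound[OF ps(1)] by simp
    finally show "card (set (ps c)) \<le> n" .
  qed
  finally have card: "card (F ` P) \<le> n * card (col ` {..<s})" by (simp add: mult.commute)
  have MN: "M \<subseteq> N" if N: "is_submodule (fun_scale scale) G (induced_act G) N M" and FN: "F ` P \<subseteq> N" for N
  proof
    have NI: "is_submodule (fun_scale scale) G (induced_act G) N (induced G H act V)"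
      by (rule is_submodule_trans[OF N M])
    \<comment> \<open>Reduction as in polynomial division: an element that vanishes from position
      \<open>t\<close> on is reduced by elements of \<open>N\<close>, one leading coefficient at a
      time.\<close>
    have *: "f \<in> N" if "f \<in> M" "\<forall>k<s. t \<le> k \<longrightarrow> f (x k) = 0" for f t
      using that
    proof (induction t arbitrary: f)
      case 0
      have fI: "f \<in> induced G H act V" using N_induced[OF M 0(1)] .
      have "f = 0"
      proof
        fix g show "f g = 0 g"
        proof (cases "g \<in> carrier G")
          case True
          then obtain i where i: "i < s" "g \<otimes> inv (x i) \<in> H" using x_transversal by blast
          have "f g = act (g \<otimes> inv (x i)) (f (x i))"
            by (rule induced_eq_act[OF fI True i(2) x_closed[OF i(1)]])
          then show ?thesis using 0(2) i V.act_zero i(2) by simp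
        next
          case False
          then show ?thesis using fI by (simp add: induced_def)
        qed
      qed
      then show ?case using F.subspace_0[OF N_subspace[OF NI]] by (simp only:)
    next
      case (Suc t)
      show ?case
      proof (cases "t < s")
        case False
        then show ?thesis using Suc by auto
      next
        case True
        define c where "c = col t"
        have tI: "t \<in> I c" using True by (simp add: I_def c_def)
        have "f (x t) \<in> leading M t"
          unfolding leading_def using Suc.prems by (auto simp: Suc_le_eq)
        then have "f (x t) \<in> generated_submodule scale (G\<lparr>carrier := K\<rparr>) act V {v. \<exists>j\<le>t. (j, v) \<in> set (ps c)}"
          using ps(3)[OF tI] by blast
        \<comment> \<open>The chosen elements lie in \<open>N\<close>, so their coefficients at
          earlier positions of the same colour belong to \<open>leading N j\<close> and are carried
          up to \<open>t\<close> within \<open>N\<close>.\<close>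
        also have "\<dots> \<subseteq> leading N t"
        proof (rule generated_submodule_minimal[OF leading_is_submodule[OF NI True]])
          show "{v. \<exists>j\<le>t. (j, v) \<in> set (ps c)} \<subseteq> leading N t"
          proof clarify
            fix v j assume j: "j \<le> t" "(j, v) \<in> set (ps c)"
            have pP: "(j, v) \<in> P" using j(2) True unfolding P_def c_def by blast
            have "j \<in> I c" using ps(2)[of c] j(2) by auto
            then have "col j = col t" by (simp add: I_def c_def)
            have "v \<in> leading N j"
              unfolding leading_def using F(2,3)[OF pP] FN pP by (intro CollectI exI[of _ "F (j, v)"]) auto
            then show "v \<in> leading N t" using leading_mono[OF NI j(1) True \<open>col j = col t\<close>] by blast
          qed
        qed
        finally obtain f' where f': "f (x t) = f' (x t)" "f' \<in> N" "\<forall>k<s. t < k \<longrightarrow> f' (x k) = 0"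
          unfolding leading_def by blast
        have "f' \<in> M" using N f'(2) by (auto simp: is_submodule_def)
        then have "f - f' \<in> M" using F.subspace_diff[OF N_subspace[OF M]] Suc.prems(1) by blast
        moreover have "\<forall>k<s. t \<le> k \<longrightarrow> (f - f') (x k) = 0"
          using f' Suc.prems(2) by (auto simp: Suc_le_eq le_less)
        ultimately have "f - f' \<in> N" by (rule Suc.IH)
        from F.subspace_add[OF N_subspace[OF NI] this f'(2)] show ?thesis by simp
      qed
    qed
    fix f assume "f \<in> M"
    then show "f \<in> N" by (rule *[of f s]) simp
  qed
  have FM: "F ` P \<subseteq> M" using F(1) by blast
  have "generated_submodule (fun_scale scale) G (induced_act G) M (F ` P) = M"
  proof
    have "is_submodule (fun_scale scale) G (induced_act G) M M"
      using M by (auto simp: is_submodule_def)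
    from generated_submodule_minimal[OF this FM]
    show "generated_submodule (fun_scale scale) G (induced_act G) M (F ` P) \<subseteq> M" .
    show "M \<subseteq> generated_submodule (fun_scale scale) G (induced_act G) M (F ` P)"
      unfolding generated_submodule_def hull_def using MN by blast
  qed
  then have "\<exists>S\<subseteq>M. finite S \<and> card S = card (F ` P) \<and>
      generated_submodule (fun_scale scale) G (induced_act G) M S = M"
    using FM finP by (intro exI[of _ "F ` P"]) simp
  then have "min_generators (fun_scale scale) G (induced_act G) M \<le> card (F ` P)"
    unfolding min_generators_def by (rule Least_le)
  with card show ?thesis by linarith
qed

end

section \<open>Lengths of chains of submodules\<close>

context rep_module
begin

text \<open>A later entry in the orbit of an earlier one would lie in the submodule generated by
  it.\<close>

lemma indep_list_length_le_orbits:
  assumes vs: "indep_list scale G act V vs" and fin: "finite (orbits G (V - {0}) act)"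
  shows "length vs \<le> card (orbits G (V - {0}) act)"
proof -
  have V: "vs ! i \<in> V" if "i < length vs" for i
    using vs that by (auto simp: indep_list_def)
  have gen: "is_submodule scale G act (generated_submodule scale G act V (set (take j vs))) V" for j
    using vs set_take_subset[of j vs] by (intro generated_submodule_is_submodule) (auto simp: indep_list_def)
  have neq: "orbit G act (vs ! i) \<noteq> orbit G act (vs ! j)" if ij: "i < j" "j < length vs" for i j
  proof
    assume eq: "orbit G act (vs ! i) = orbit G act (vs ! j)"
    have "vs ! j = act \<one> (vs ! j)" using act_one V ij by simp
    then have "vs ! j \<in> orbit G act (vs ! j)" unfolding orbit_def by blast
    then have "vs ! j \<in> orbit G act (vs ! i)" using eq by simp
    then obtain g where g: "g \<in> carrier G" "vs ! j = act g (vs ! i)" unfolding orbit_def by blast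
    have "vs ! i \<in> set (take j vs)" using ij by (auto simp: in_set_conv_nth intro!: exI[of _ i])
    then have "vs ! i \<in> generated_submodule scale G act V (set (take j vs))"
      using generated_submodule_superset by blast
    then have "act g (vs ! i) \<in> generated_submodule scale G act V (set (take j vs))"
      using gen[of j] g(1) unfolding is_submodule_def by blast
    then show False using vs ij g(2) by (auto simp: indep_list_def)
  qed
  have inj: "inj_on (\<lambda>i. orbit G act (vs ! i)) {..<length vs}"
  proof (rule inj_onI)
    fix i j assume "i \<in> {..<length vs}" "j \<in> {..<length vs}" "orbit G act (vs ! i) = orbit G act (vs ! j)"
    then show "i = j" using neq[of i j] neq[of j i] by (cases i j rule: linorder_cases) auto
  qed
  have "vs ! i \<noteq> 0" if i: "i < length vs" for i
  proof
    assume "vs ! i = 0"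
    then have "vs ! i \<in> generated_submodule scale G act V (set (take i vs))"
      using gen[of i] subspace_0 by (auto simp: is_submodule_def)
    then show False using vs i by (auto simp: indep_list_def)
  qed
  then have "(\<lambda>i. orbit G act (vs ! i)) ` {..<length vs} \<subseteq> orbits G (V - {0}) act"
    using V unfolding orbits_def by blast
  from card_inj_on_le[OF inj this fin] show ?thesis by simp
qed

text \<open>Among the submodules that meet \<open>A\<close> trivially, one of largest dimension is a
  complement: an irreducible summand not inside A + C would meet A + C in 0 and could be added to
  \<open>C\<close>. Bounded dimension takes the place of Zorn's lemma.\<close>

lemma semisimple_complement:
  assumes fd: "\<And>E. E \<subseteq> V \<Longrightarrow> independent E \<Longrightarrow> finite E \<and> card E \<le> N"
    and ss: "semisimple_module scale G act V" and A: "is_submodule scale G act A V"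
  obtains C where "is_submodule scale G act C V" "A \<inter> C = {0}" "V \<subseteq> {a + c | a c. a \<in> A \<and> c \<in> C}"
proof -
  define P where "P C \<longleftrightarrow> is_submodule scale G act C V \<and> A \<inter> C = {0}" for C
  have sub: "subspace C" "C \<subseteq> V" "g \<in> carrier G \<Longrightarrow> v \<in> C \<Longrightarrow> act g v \<in> C" if "is_submodule scale G act C V" for C g v
    using that by (auto simp: is_submodule_def)
  have "is_submodule scale G act {0} V"
    using subspace_0[OF subspace_V] by (auto simp: is_submodule_def act_zero subspace_single_0)
  then have P0: "P {0}" using subspace_0[OF sub(1)[OF A]] by (auto simp: P_def)
  have dimN: "dim C < Suc N" if C: "P C" for C
  proof -
    obtain E where E: "E \<subseteq> C" "independent E" "C \<subseteq> span E" "card E = dim C"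
      using basis_exists[of C] by metis
    have "E \<subseteq> V" using E(1) sub(2) C by (auto simp: P_def)
    then show ?thesis using fd[OF _ E(2)] E(4) by simp
  qed
  obtain C where C: "P C" and max: "\<And>C'. P C' \<Longrightarrow> dim C' \<le> dim C"
  proof -
    have "\<exists>C. P C \<and> (\<forall>C'. P C' \<longrightarrow> dim C' \<le> dim C)"
      by (rule ex_has_greatest_nat[of P "{0}" dim "Suc N"]) (use P0 dimN in auto)
    then show ?thesis using that by (elim exE conjE) simp
  qed
  have Cs: "is_submodule scale G act C V" and AC: "A \<inter> C = {0}" using C by (auto simp: P_def)
  have plus: "is_submodule scale G act {x + y | x y. x \<in> C1 \<and> y \<in> C2} V"
    if 1: "is_submodule scale G act C1 V" and 2: "is_submodule scale G act C2 V" for C1 C2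
    unfolding is_submodule_def
  proof (intro conjI ballI)
    show "subspace {x + y | x y. x \<in> C1 \<and> y \<in> C2}" by (rule subspace_sums[OF sub(1)[OF 1] sub(1)[OF 2]])
    show "{x + y | x y. x \<in> C1 \<and> y \<in> C2} \<subseteq> V"
      using sub(2)[OF 1] sub(2)[OF 2] subspace_add[OF subspace_V] by blast
    fix g v assume g: "g \<in> carrier G" and "v \<in> {x + y | x y. x \<in> C1 \<and> y \<in> C2}"
    then obtain x y where v: "v = x + y" "x \<in> C1" "y \<in> C2" by blast
    then have "act g v = act g x + act g y" using g act_add sub(2)[OF 1] sub(2)[OF 2] by blast
    then show "act g v \<in> {x + y | x y. x \<in> C1 \<and> y \<in> C2}"
      using sub(3)[OF 1 g v(2)] sub(3)[OF 2 g v(3)] by blast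
  qed
  define S where "S = {a + c | a c. a \<in> A \<and> c \<in> C}"
  have S: "is_submodule scale G act S V" unfolding S_def by (rule plus[OF A Cs])
  obtain \<S> where irr: "\<And>N. N \<in> \<S> \<Longrightarrow> irreducible_submodule scale G act N V" and spn: "span (\<Union>\<S>) = V"
    using ss unfolding semisimple_module_def by blast
  have "I \<subseteq> S" if I: "I \<in> \<S>" for I
  proof (rule ccontr)
    assume nsub: "\<not> I \<subseteq> S"
    have Is: "is_submodule scale G act I V" "I \<noteq> {0}"
      and Imin: "\<And>N'. is_submodule scale G act N' I \<Longrightarrow> N' = {0} \<or> N' = I"
      using irr[OF I] by (auto simp: irreducible_submodule_def)
    have "is_submodule scale G act (I \<inter> S) I"
      using sub[OF Is(1)] sub[OF S] by (auto simp: is_submodule_def intro: subspace_inter)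
    then have IS: "I \<inter> S = {0}" using Imin nsub by blast
    obtain v where v: "v \<in> I" "v \<noteq> 0"
      using Is(2) subspace_0[OF sub(1)[OF Is(1)]] by blast
    define C' where "C' = {c + i | c i. c \<in> C \<and> i \<in> I}"
    have C's: "is_submodule scale G act C' V" unfolding C'_def by (rule plus[OF Cs Is(1)])
    have "A \<inter> C' \<subseteq> {0}"
    proof
      fix a assume a: "a \<in> A \<inter> C'"
      then obtain c i where ci: "a = c + i" "c \<in> C" "i \<in> I" unfolding C'_def by blast
      have "i = a + (- c)" using ci by simp
      moreover have "- c \<in> C" using subspace_neg[OF sub(1)[OF Cs] ci(2)] .
      ultimately have "i \<in> S" unfolding S_def using a by blast
      then have "i = 0" using IS ci(3) by blast
      then have "a \<in> A \<inter> C" using a ci by simp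
      then show "a \<in> {0}" using AC by simp
    qed
    moreover have "0 \<in> A \<inter> C'" using subspace_0 sub(1)[OF A] sub(1)[OF C's] by simp
    ultimately have "P C'" using C's unfolding P_def by blast
    have CC': "C \<subseteq> C'"
    proof
      fix c assume "c \<in> C"
      moreover have "c = c + 0" "0 \<in> I" using subspace_0[OF sub(1)[OF Is(1)]] by simp_all
      ultimately show "c \<in> C'" unfolding C'_def by blast
    qed
    have "v = 0 + v" by simp
    then have vC': "v \<in> C'" unfolding C'_def using v(1) subspace_0[OF sub(1)[OF Cs]] by blast
    have vC: "v \<notin> C"
    proof
      assume "v \<in> C"
      moreover have "v = 0 + v" by simp
      ultimately have "v \<in> S" unfolding S_def using subspace_0[OF sub(1)[OF A]] by blast
      then show False using IS v by blast
    qed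
    obtain E where E: "E \<subseteq> C" "independent E" "C \<subseteq> span E" "card E = dim C"
      using basis_exists[of C] by metis
    have "span E \<subseteq> C" by (rule span_minimal[OF E(1) sub(1)[OF Cs]])
    then have "independent (insert v E)" using vC E(2) by (intro independent_insertI) auto
    moreover have "insert v E \<subseteq> C'" using E(1) CC' vC' by blast
    ultimately obtain E' where E': "insert v E \<subseteq> E'" "E' \<subseteq> C'" "independent E'" "C' \<subseteq> span E'"
      using maximal_independent_subset_extend[of "insert v E" C'] by metis
    have finE': "finite E'" using fd[OF _ E'(3)] E'(2) sub(2)[OF C's] by blast
    have "dim C < card (insert v E)"
      using E(1,4) vC finite_subset[OF _ finE', of E] E'(1) by (subst card_insert_disjoint) auto
    also have "\<dots> \<le> card E'" by (rule card_mono[OF finE' E'(1)])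
    also have "\<dots> = dim C'" by (rule basis_card_eq_dim[OF E'(2,4,3)])
    finally show False using max[OF \<open>P C'\<close>] by simp
  qed
  then have "span (\<Union>\<S>) \<subseteq> S" by (intro span_minimal sub(1)[OF S]) blast
  then have "V \<subseteq> S" using spn by simp
  then show thesis using that[OF Cs AC] unfolding S_def by blast
qed

text \<open>Let \<open>C\<close> be a complement of \<open>A\<close>. For w in both \<open>B\<close>
  and \<open>C\<close>, the difference of g w and w lies in \<open>A\<close> by triviality and in
  \<open>C\<close> by invariance, so it is 0.\<close>

lemma semisimple_fixed_vector:
  assumes fd: "\<And>E. E \<subseteq> V \<Longrightarrow> independent E \<Longrightarrow> finite E \<and> card E \<le> N"
    and ss: "semisimple_module scale G act V"
    and A: "is_submodule scale G act A V" and B: "is_submodule scale G act B V"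
    and "A \<subseteq> B" "A \<noteq> B"
    and triv: "\<And>g v. g \<in> carrier G \<Longrightarrow> v \<in> B \<Longrightarrow> act g v - v \<in> A"
  obtains w where "w \<in> B" "w \<notin> A" "\<And>g. g \<in> carrier G \<Longrightarrow> act g w = w"
proof -
  obtain C where C: "is_submodule scale G act C V" "A \<inter> C = {0}" "V \<subseteq> {a + c | a c. a \<in> A \<and> c \<in> C}"
    by (rule semisimple_complement[OF fd ss A])
  have sA: "subspace A" and sB: "subspace B" and sC: "subspace C" and BV: "B \<subseteq> V"
    using A B C(1) by (auto simp: is_submodule_def)
  obtain b where b: "b \<in> B" "b \<notin> A" using assms(5,6) by blast
  then have "b \<in> {a + c | a c. a \<in> A \<and> c \<in> C}" using C(3) BV by blast
  then obtain a c where ac: "b = a + c" "a \<in> A" "c \<in> C" by blast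
  have "c = b - a" using ac by simp
  then have cB: "c \<in> B" using subspace_diff[OF sB b(1)] ac(2) assms(5) by blast
  have cA: "c \<notin> A" using subspace_add[OF sA ac(2)] ac(1) b(2) by blast
  have "act g c = c" if g: "g \<in> carrier G" for g
  proof -
    have "act g c \<in> C" using C(1) g ac(3) by (simp add: is_submodule_def)
    then have "act g c - c \<in> C" using subspace_diff[OF sC _ ac(3)] by blast
    then have "act g c - c \<in> A \<inter> C" using triv[OF g cB] by blast
    then show ?thesis using C(2) by simp
  qed
  then show thesis using that cB cA by blast
qed

text \<open>The group acts on the quotient of \<open>B\<close> by \<open>A\<close>. This action is
  written in matrices with respect to the basis vectors in \<open>BB - BA\<close>, without forming
  the quotient, and is non-trivial because \<open>g0\<close> moves \<open>v0\<close> modulo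
  \<open>A\<close>.\<close>

lemma rep_min_dim_le:
  assumes A: "is_submodule scale G act A V" and B: "is_submodule scale G act B V"
    and BA: "span BA = A" and BB: "independent BB" "span BB = B" and sub: "BA \<subseteq> BB"
    and fin: "finite (BB - BA)"
    and nontriv: "g0 \<in> carrier G" "v0 \<in> B" "act g0 v0 - v0 \<notin> A"
  shows "rep_min_dim TYPE('f) G \<le> card (BB - BA)" and "1 \<le> rep_min_dim TYPE('f) G"
proof -
  define r where "r = card (BB - BA)"
  obtain c where c: "bij_betw c {0..<r} (BB - BA)"
    using ex_bij_betw_nat_finite[OF fin] unfolding r_def by blast
  have cB: "c i \<in> BB" "c i \<notin> BA" if "i < r" for i
    using bij_betwE[OF c] that by auto
  have cinj: "c i = c j \<longleftrightarrow> i = j" if "i < r" "j < r" for i j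
    using bij_betw_imp_inj_on[OF c] that by (auto dest: inj_onD)
  have BB_B: "b \<in> B" if "b \<in> BB" for b using span_base[OF that] BB(2) by simp
  have indA: "independent BA" using independent_mono[OF BB(1) sub] .
  have BV: "v \<in> V" if "v \<in> B" for v using B that by (auto simp: is_submodule_def)
  have Bsp: "subspace B" using B by (simp add: is_submodule_def)
  have actB: "act g v \<in> B" if "g \<in> carrier G" "v \<in> B" for g v using B that by (simp add: is_submodule_def)
  have actA: "act g v \<in> A" if "g \<in> carrier G" "v \<in> A" for g v using A that by (simp add: is_submodule_def)
  \<comment> \<open>Coordinates modulo \<open>A\<close>: all of them vanish on \<open>A\<close>, and
    an element of \<open>B\<close> on which all vanish lies in \<open>A\<close>.\<close>
  define coef where "coef v i = representation BB v (c i)" for v i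
  have coef_add: "coef (v + w) i = coef v i + coef w i" if "v \<in> B" "w \<in> B" for v w i
    using representation_add[OF BB(1)] that by (simp add: coef_def BB(2))
  have coef_scale: "coef (scale a v) i = a * coef v i" if "v \<in> B" for a v i
    using representation_scale[OF BB(1)] that by (simp add: coef_def BB(2))
  have coef_zero: "coef 0 i = 0" for i by (simp add: coef_def representation_zero)
  have coef_A: "coef v i = 0" if "v \<in> A" "i < r" for v i
  proof -
    have "representation BB v = representation BA v"
      using that BA by (intro representation_extend[OF BB(1) _ sub]) simp
    then show ?thesis using representation_ne_zero[of BA v "c i"] cB(2)[OF that(2)] by (auto simp: coef_def)
  qed
  have coef_c: "coef (c j) i = (if i = j then 1 else 0)" if "i < r" "j < r" for i j
    using representation_basis[OF BB(1) cB(1)[OF that(2)]] cinj[OF that] by (simp add: coef_def)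
  have coef_0_A: "v \<in> A" if v: "v \<in> B" and z: "\<And>i. i < r \<Longrightarrow> coef v i = 0" for v
  proof -
    have "v = (\<Sum>b | representation BB v b \<noteq> 0. scale (representation BB v b) b)"
      using sum_nonzero_representation_eq[OF BB(1), of v] v BB(2) by simp
    also have "\<dots> \<in> span BA"
    proof (rule span_sum)
      fix b assume b: "b \<in> {b. representation BB v b \<noteq> 0}"
      then have bB: "b \<in> BB" using representation_ne_zero by blast
      have "b \<in> BA"
      proof (rule ccontr)
        assume "b \<notin> BA"
        then have "b \<in> c ` {0..<r}" using bB bij_betw_imp_surj_on[OF c] by blast
        then show False using z b by (auto simp: coef_def)
      qed
      then show "scale (representation BB v b) b \<in> span BA" by (intro span_scale span_base)
    qed
    finally show ?thesis using BA by simp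
  qed
  have key: "coef (act g w) i = (\<Sum>k\<in>{0..<r}. coef (act g (c k)) i * coef w k)"
    if g: "g \<in> carrier G" and w: "w \<in> B" and i: "i < r" for g w i
  proof -
    let ?h = "\<lambda>w. w \<in> B \<and> coef (act g w) i = (\<Sum>k\<in>{0..<r}. coef (act g (c k)) i * coef w k)"
    have "w \<in> span BB" using w BB(2) by simp
    then have "?h w"
    proof (rule span_induct_alt)
      show "?h 0"
        using subspace_0[OF Bsp] by (simp add: act_zero[OF g] coef_zero)
    next
      fix a x y assume x: "x \<in> BB" and y: "?h y"
      have xB: "x \<in> B" using BB_B[OF x] .
      have axB: "scale a x \<in> B" using subspace_scale[OF Bsp xB] .
      have hx: "coef (act g x) i = (\<Sum>k\<in>{0..<r}. coef (act g (c k)) i * coef x k)"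
      proof (cases "x \<in> BA")
        case True
        then have "x \<in> A" using span_base BA by blast
        then show ?thesis using coef_A actA[OF g] i by simp
      next
        case False
        then have "x \<in> c ` {0..<r}" using x bij_betw_imp_surj_on[OF c] by simp
        then obtain l where l: "l < r" "x = c l" by auto
        have "(\<Sum>k\<in>{0..<r}. coef (act g (c k)) i * coef x k) = (\<Sum>k\<in>{0..<r}. if k = l then coef (act g (c l)) i else 0)"
          using l coef_c by (intro sum.cong) auto
        then show ?thesis using l by simp
      qed
      have yB: "y \<in> B" and hy: "coef (act g y) i = (\<Sum>k\<in>{0..<r}. coef (act g (c k)) i * coef y k)"
        using y by auto
      have cc: "coef (scale a x + y) k = a * coef x k + coef y k" for k
        using coef_add[OF axB yB] coef_scale[OF xB] by simp
      have "act g (scale a x + y) = scale a (act g x) + act g y"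
        using act_add[OF g BV[OF axB] BV[OF yB]] act_scale[OF g BV[OF xB]] by simp
      then have "coef (act g (scale a x + y)) i = a * coef (act g x) i + coef (act g y) i"
        using coef_add[OF subspace_scale[OF Bsp actB[OF g xB]] actB[OF g yB]] coef_scale[OF actB[OF g xB]] by simp
      also have "\<dots> = (\<Sum>k\<in>{0..<r}. coef (act g (c k)) i * coef (scale a x + y) k)"
        unfolding hx hy cc by (simp add: sum_distrib_left sum.distrib[symmetric] algebra_simps)
      finally show "?h (scale a x + y)" using subspace_add[OF Bsp axB yB] by blast
    qed
    then show ?thesis by blast
  qed
  define \<rho> where "\<rho> g = Matrix.mat r r (\<lambda>(i, j). coef (act g (c j)) i)" for g
  have \<rho>_carrier: "\<rho> g \<in> carrier_mat r r" for g by (simp add: \<rho>_def)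
  have \<rho>_mult: "\<rho> (g \<otimes> h) = \<rho> g * \<rho> h" if g: "g \<in> carrier G" and h: "h \<in> carrier G" for g h
  proof (rule eq_matI)
    fix i j assume "i < dim_row (\<rho> g * \<rho> h)" "j < dim_col (\<rho> g * \<rho> h)"
    then have i: "i < r" and j: "j < r" by (simp_all add: \<rho>_def)
    have cjB: "c j \<in> B" using BB_B cB j by blast
    have "(\<rho> g * \<rho> h) $$ (i, j) = (\<Sum>k\<in>{0..<r}. coef (act g (c k)) i * coef (act h (c j)) k)"
      using i j by (simp add: \<rho>_def scalar_prod_def)
    also have "\<dots> = coef (act g (act h (c j))) i" by (rule key[OF g actB[OF h cjB] i, symmetric])
    also have "act g (act h (c j)) = act (g \<otimes> h) (c j)" using act_mult[OF g h BV[OF cjB]] by simp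
    finally show "\<rho> (g \<otimes> h) $$ (i, j) = (\<rho> g * \<rho> h) $$ (i, j)" using i j by (simp add: \<rho>_def)
  qed (simp_all add: \<rho>_def)
  have \<rho>_one: "\<rho> \<one> = 1\<^sub>m r"
    using BB_B cB BV by (intro eq_matI) (auto simp: \<rho>_def act_one coef_c)
  let ?R = "ring_mat TYPE('f) r ()"
  have "\<rho> \<in> hom G (units_of ?R)"
  proof (rule homI)
    fix g assume g: "g \<in> carrier G"
    have "\<rho> (inv g) * \<rho> g = 1\<^sub>m r" "\<rho> g * \<rho> (inv g) = 1\<^sub>m r"
      using g \<rho>_mult[of "inv g" g] \<rho>_mult[of g "inv g"] by (simp_all add: \<rho>_one)
    then show "\<rho> g \<in> carrier (units_of ?R)"
      using \<rho>_carrier by (auto simp: units_of_carrier Units_def ring_mat_simps intro!: bexI[of _ "\<rho> (inv g)"])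
  next
    fix g h assume "g \<in> carrier G" "h \<in> carrier G"
    then show "\<rho> (g \<otimes> h) = \<rho> g \<otimes>\<^bsub>units_of ?R\<^esub> \<rho> h"
      by (simp add: units_of_mult ring_mat_simps \<rho>_mult)
  qed
  moreover have "\<rho> g0 \<noteq> 1\<^sub>m r"
  proof
    assume eq: "\<rho> g0 = 1\<^sub>m r"
    have id: "coef (act g0 (c k)) i = (if i = k then 1 else 0)" if "i < r" "k < r" for i k
    proof -
      have "\<rho> g0 $$ (i, k) = 1\<^sub>m r $$ (i, k)" using eq by simp
      then show ?thesis using that by (simp add: \<rho>_def)
    qed
    have aB: "act g0 v0 \<in> B" using actB nontriv by blast
    have "act g0 v0 - v0 \<in> A"
    proof (rule coef_0_A)
      show "act g0 v0 - v0 \<in> B" by (rule subspace_diff[OF Bsp aB nontriv(2)])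
      fix i assume i: "i < r"
      have "coef (act g0 v0) i = (\<Sum>k\<in>{0..<r}. if k = i then coef v0 i else 0)"
        unfolding key[OF nontriv(1,2) i] using id i by (intro sum.cong) auto
      then have e: "coef (act g0 v0) i = coef v0 i" using i by simp
      have "coef ((act g0 v0 - v0) + v0) i = coef (act g0 v0 - v0) i + coef v0 i"
        by (rule coef_add[OF subspace_diff[OF Bsp aB nontriv(2)] nontriv(2)])
      then show "coef (act g0 v0 - v0) i = 0" using e by simp
    qed
    then show False using nontriv(3) by blast
  qed
  ultimately have ex: "\<exists>\<rho>\<in>hom G (units_of ?R). \<exists>x\<in>carrier G. \<rho> x \<noteq> 1\<^sub>m r"
    using nontriv(1) by blast
  then show "rep_min_dim TYPE('f) G \<le> card (BB - BA)"
    unfolding rep_min_dim_def r_def[symmetric] by (rule Least_le)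
  \<comment> \<open>Degree 0 is excluded because the only matrix of size 0 is the identity.\<close>
  define n where "n = rep_min_dim TYPE('f) G"
  have "\<exists>\<rho>\<in>hom G (units_of (ring_mat TYPE('f) n ())). \<exists>x\<in>carrier G. \<rho> x \<noteq> 1\<^sub>m n"
    unfolding n_def rep_min_dim_def by (rule LeastI[where P = "\<lambda>n. \<exists>\<rho>\<in>hom G (units_of (ring_mat TYPE('f) n ())). \<exists>x\<in>carrier G. \<rho> x \<noteq> 1\<^sub>m n", OF ex])
  then obtain \<sigma> g where \<sigma>: "\<sigma> \<in> hom G (units_of (ring_mat TYPE('f) n ()))" "g \<in> carrier G" "\<sigma> g \<noteq> 1\<^sub>m n" by blast
  have "\<sigma> g \<in> carrier_mat n n"
    using hom_in_carrier[OF \<sigma>(1,2)] by (simp add: units_of_carrier Units_def ring_mat_simps)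
  then have "n \<noteq> 0" using \<sigma>(3) by (auto intro!: eq_matI)
  then show "1 \<le> rep_min_dim TYPE('f) G" by (simp add: n_def)
qed

end

context rep_module
begin

text \<open>
  In the chain of submodules generated by the initial segments of \<open>vs\<close>, a step whose quotient is a trivial
  module provides a new vector fixed by \<open>Q\<close>, and any other step raises the dimension by at least
  \<open>rep_min_dim\<close>. In the induction \<open>B\<close> is a basis and \<open>C\<close> collects these fixed vectors.
\<close>

lemma indep_list_length_le_dim:
  assumes fd: "\<And>E. E \<subseteq> V \<Longrightarrow> independent E \<Longrightarrow> finite E \<and> card E \<le> N"
    and Q: "subgroup Q G" and ss: "semisimple_module scale (G\<lparr>carrier := Q\<rparr>) act V"
    and fixed: "\<And>E. E \<subseteq> V \<Longrightarrow> (\<And>v g. v \<in> E \<Longrightarrow> g \<in> Q \<Longrightarrow> act g v = v) \<Longrightarrow> independent E \<Longrightarrow> card E \<le> t"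
    and vs: "indep_list scale G act V vs" and "t \<le> N"
  shows "real (length vs) \<le> (real N - real t) / real (rep_min_dim TYPE('f) G) + real t"
proof -
  define R where "R = rep_min_dim TYPE('f) G"
  let ?gen = "\<lambda>vs. generated_submodule scale G act V (set vs)"
  interpret VQ: rep_module "G\<lparr>carrier := Q\<rparr>" scale act V
  proof (rule rep_module_restrict[where H = "carrier G"])
    show "rep_module (G\<lparr>carrier := carrier G\<rparr>) scale act V" using rep_module_axioms by simp
    show "Q \<subseteq> carrier G" by (rule subgroup.subset[OF Q])
    show "group (G\<lparr>carrier := Q\<rparr>)" by (rule subgroup.subgroup_is_group[OF Q group_axioms])
  qed
  \<comment> \<open>Here \<open>card C\<close> counts the trivial steps. The last conjunct records
    that \<open>R\<close> is positive once a non-trivial step has occurred; before that nothing is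
    known about \<open>R\<close>.\<close>
  have "\<exists>B C. B \<subseteq> V \<and> independent B \<and> span B = ?gen vs \<and>
      C \<subseteq> ?gen vs \<and> independent C \<and> (\<forall>v\<in>C. \<forall>g\<in>Q. act g v = v) \<and>
      card C \<le> length vs \<and> card C + R * (length vs - card C) \<le> card B \<and> (card C < length vs \<longrightarrow> 1 \<le> R)"
    using vs
  proof (induction vs rule: rev_induct)
    case Nil
    have "is_submodule scale G act {0} V"
      using subspace_0[OF subspace_V] by (auto simp: is_submodule_def act_zero subspace_single_0)
    then have "?gen [] \<subseteq> {0}" by (intro generated_submodule_minimal) auto
    moreover have "0 \<in> ?gen []"
      using generated_submodule_is_submodule[of "{}"] subspace_0 by (auto simp: is_submodule_def)
    ultimately have "?gen [] = {0}" by blast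
    then show ?case by (intro exI[of _ "{}"]) (simp add: independent_empty)
  next
    case (snoc v vs)
    have vs: "indep_list scale G act V vs" and v: "v \<in> V" "v \<notin> ?gen vs"
      using snoc.prems by (auto simp: indep_list_snoc)
    obtain B C where BC: "B \<subseteq> V" "independent B" "span B = ?gen vs" "C \<subseteq> ?gen vs" "independent C"
      "\<forall>v\<in>C. \<forall>g\<in>Q. act g v = v" "card C \<le> length vs" "card C + R * (length vs - card C) \<le> card B"
      "card C < length vs \<longrightarrow> 1 \<le> R"
      using snoc.IH[OF vs] by (elim exE conjE) (rule that)
    have sV: "set vs \<subseteq> V" "set (vs @ [v]) \<subseteq> V" using vs v by (auto simp: indep_list_def)
    have A: "is_submodule scale G act (?gen vs) V" and A': "is_submodule scale G act (?gen (vs @ [v])) V"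
      using sV by (auto intro!: generated_submodule_is_submodule)
    have AA': "?gen vs \<subseteq> ?gen (vs @ [v])" by (rule generated_submodule_mono) auto
    have vA': "v \<in> ?gen (vs @ [v])" using generated_submodule_superset[of "set (vs @ [v])"] by auto
    have sp: "subspace (?gen vs)" "subspace (?gen (vs @ [v]))" "?gen (vs @ [v]) \<subseteq> V"
      using A A' by (auto simp: is_submodule_def)
    have BA': "B \<subseteq> ?gen (vs @ [v])" using span_superset[of B] BC(3) AA' by blast
    obtain B' where B': "B \<subseteq> B'" "B' \<subseteq> ?gen (vs @ [v])" "independent B'" "?gen (vs @ [v]) \<subseteq> span B'"
      by (rule maximal_independent_subset_extend[OF BA' BC(2)])
    have B'V: "B' \<subseteq> V" using B'(2) sp(3) by blast
    have spB': "span B' = ?gen (vs @ [v])" using span_minimal[OF B'(2) sp(2)] B'(4) by blast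
    have fin: "finite B'" using fd[OF B'V B'(3)] by blast
    have card: "card B' = card B + card (B' - B)"
      using card_Diff_subset[OF finite_subset[OF B'(1) fin] B'(1)] card_mono[OF fin B'(1)] by simp
    have "B' \<noteq> B" using spB' BC(3) v(2) vA' by auto
    then have "B' - B \<noteq> {}" using B'(1) by blast
    then have pos: "1 \<le> card (B' - B)" using fin by (simp add: Suc_le_eq card_gt_0_iff)
    show ?case
    proof (cases "\<forall>g\<in>carrier G. \<forall>w\<in>?gen (vs @ [v]). act g w - w \<in> ?gen vs")
      case True
      have AQ: "is_submodule scale (G\<lparr>carrier := Q\<rparr>) act (?gen vs) V"
        and AQ': "is_submodule scale (G\<lparr>carrier := Q\<rparr>) act (?gen (vs @ [v])) V"
        using A A' subgroup.subset[OF Q] by (auto simp: is_submodule_def)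
      have ne: "?gen vs \<noteq> ?gen (vs @ [v])" using v(2) vA' by blast
      have triv: "act g w - w \<in> ?gen vs" if "g \<in> carrier (G\<lparr>carrier := Q\<rparr>)" "w \<in> ?gen (vs @ [v])" for g w
        using True that subgroup.subset[OF Q] by auto
      obtain w where w: "w \<in> ?gen (vs @ [v])" "w \<notin> ?gen vs"
        "\<And>g. g \<in> carrier (G\<lparr>carrier := Q\<rparr>) \<Longrightarrow> act g w = w"
        by (rule VQ.semisimple_fixed_vector[OF fd ss AQ AQ' AA' ne triv]) (assumption | rule that)+
      have wC: "w \<notin> span C" using w(2) span_minimal[OF BC(4) sp(1)] by blast
      then have ind: "independent (insert w C)" using BC(5) by (rule independent_insertI)
      have "w \<notin> C" using w(2) BC(4) by blast
      moreover have "finite C" using fd[OF _ BC(5)] BC(4) AA' sp(3) by blast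
      ultimately have cC: "card (insert w C) = Suc (card C)" by simp
      have "card (insert w C) + R * (length (vs @ [v]) - card (insert w C)) \<le> card B'"
        using BC(8) card pos by (simp add: cC)
      moreover have "insert w C \<subseteq> ?gen (vs @ [v])" using w(1) BC(4) AA' by blast
      moreover have "\<forall>v\<in>insert w C. \<forall>g\<in>Q. act g v = v" using w(3) BC(6) by simp
      moreover have "card (insert w C) \<le> length (vs @ [v])" using BC(7) cC by simp
      moreover have "card (insert w C) < length (vs @ [v]) \<longrightarrow> 1 \<le> R" using BC(9) cC by simp
      ultimately show ?thesis using B'V B'(3) spB' ind by (intro exI[of _ B'] exI[of _ "insert w C"]) simp
    next
      case False
      then obtain g w where gw: "g \<in> carrier G" "w \<in> ?gen (vs @ [v])" "act g w - w \<notin> ?gen vs" by blast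
      note R = rep_min_dim_le[OF A A' BC(3) B'(3) spB' B'(1) finite_Diff[OF fin] gw, folded R_def]
      have "card C + R * (length (vs @ [v]) - card C) \<le> card B'"
        using BC(7,8) card R(1) by (simp add: Suc_diff_le)
      moreover have "C \<subseteq> ?gen (vs @ [v])" using BC(4) AA' by blast
      moreover have "card C \<le> length (vs @ [v])" using BC(7) by simp
      ultimately show ?thesis using B'V B'(3) spB' BC(5,6) R(2) by (intro exI[of _ B'] exI[of _ C]) simp
    qed
  qed
  then obtain B C where BC: "B \<subseteq> V" "independent B" "C \<subseteq> ?gen vs" "independent C"
      "\<forall>v\<in>C. \<forall>g\<in>Q. act g v = v" "card C \<le> length vs" "card C + R * (length vs - card C) \<le> card B"
      "card C < length vs \<longrightarrow> 1 \<le> R"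
    by (elim exE conjE) (rule that)
  have BN: "card B \<le> N" using fd BC(1,2) by blast
  have "?gen vs \<subseteq> V"
    using generated_submodule_is_submodule[of "set vs"] vs by (auto simp: is_submodule_def indep_list_def)
  then have Ct: "card C \<le> t" using fixed[OF _ _ BC(4)] BC(3,5) by blast
  show ?thesis
  proof (cases "card C = length vs")
    case True
    \<comment> \<open>All steps were trivial, and \<open>R\<close> may even be 0; division by 0
      yields 0, so the quotient is non-negative in any case.\<close>
    have "0 \<le> (real N - real t) / real R" using \<open>t \<le> N\<close> by simp
    then show ?thesis using Ct True unfolding R_def by linarith
  next
    case False
    then have R1: "1 \<le> R" using BC(6,8) by simp
    define k where "k = length vs - card C"
    have len: "real (length vs) = real (card C) + real k" using BC(6) by (simp add: k_def of_nat_diff)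
    have "card C + R * k \<le> N" using BC(7) BN by (simp add: k_def)
    then have 1: "real (card C) + real R * real k \<le> real N"
      by (metis of_nat_add of_nat_le_iff of_nat_mult)
    \<comment> \<open>For \<open>R\<close> at least 1 the bound (N - c) / R + c does not decrease in
      the number c of trivial steps, so c may be replaced by its upper bound
      \<open>t\<close>.\<close>
    have "(real t - real (card C)) * 1 \<le> (real t - real (card C)) * real R"
      using Ct R1 by (intro mult_left_mono) auto
    with 1 have "(real (card C) + real k) * real R \<le> real N - real t + real t * real R"
      by (simp add: algebra_simps)
    then have "real (card C) + real k \<le> (real N - real t + real t * real R) / real R"
      using R1 by (simp add: pos_le_divide_eq)
    also have "\<dots> = (real N - real t) / real R + real t" using R1 by (simp add: add_divide_distrib)
    finally show ?thesis unfolding len R_def .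
  qed
qed

end

text \<open>Restriction to \<open>P\<close> is injective on \<open>Y\<close> by \<open>det\<close>,
  and its image lies in the span of the functions \<open>\<delta> (p, b)\<close> with one possibly
  non-zero value, a basis vector \<open>b\<close> at \<open>p\<close>. This handles the dimension of
  \<open>V\<close> and that of its fixed vectors alike.\<close>

lemma card_independent_functions_le:
  fixes sc :: "'f::field \<Rightarrow> 'u::ab_group_add \<Rightarrow> 'u" and E :: "('g \<Rightarrow> 'u) set"
  assumes vs: "vector_space sc" and U: "has_dim sc U a" and P: "finite P"
    and Y: "Modules.module.subspace (fun_scale sc) Y"
    and val: "\<And>f p. f \<in> Y \<Longrightarrow> p \<in> P \<Longrightarrow> f p \<in> U"
    and det: "\<And>f. f \<in> Y \<Longrightarrow> (\<And>p. p \<in> P \<Longrightarrow> f p = 0) \<Longrightarrow> f = 0"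
    and E: "E \<subseteq> Y" "\<not> Modules.module.dependent (fun_scale sc) E"
  shows "finite E \<and> card E \<le> a * card P"
proof -
  interpret U: vector_space sc by (rule vs)
  interpret F: vector_space "fun_scale sc" by (rule vector_space_fun_scale[OF vs])
  interpret FF: vector_space_pair "fun_scale sc :: 'f \<Rightarrow> ('g \<Rightarrow> 'u) \<Rightarrow> 'g \<Rightarrow> 'u" "fun_scale sc :: 'f \<Rightarrow> ('g \<Rightarrow> 'u) \<Rightarrow> 'g \<Rightarrow> 'u"
    by unfold_locales
  obtain B where B: "B \<subseteq> U" "finite B" "U.span B = U" "card B = a"
    using U unfolding has_dim_def by blast
  define res where "res f = (\<lambda>p. if p \<in> P then f p else (0 :: 'u))" for f :: "'g \<Rightarrow> 'u"
  have lin: "Vector_Spaces.linear (fun_scale sc) (fun_scale sc) res"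
    unfolding Vector_Spaces.linear_iff by (auto simp: res_def fun_scale_def fun_eq_iff F.vector_space_axioms)
  have spanE: "F.span E \<subseteq> Y" by (rule F.span_minimal[OF E(1) Y])
  have "inj_on res (F.span E)"
  proof (rule inj_onI)
    fix f g assume fg: "f \<in> F.span E" "g \<in> F.span E" "res f = res g"
    have "f - g \<in> Y" using F.subspace_diff[OF Y] fg spanE by blast
    moreover have "(f - g) p = 0" if "p \<in> P" for p
      using fun_cong[OF fg(3), of p] that by (simp add: res_def)
    ultimately have "f - g = 0" by (rule det)
    then show "f = g" by (simp only: right_minus_eq)
  qed
  then have ind: "F.independent (res ` E)"
    using FF.linear_independent_injective_image[OF lin _ _] E(2) by blast
  define \<delta> :: "'g \<times> 'u \<Rightarrow> 'g \<Rightarrow> 'u" where "\<delta> = (\<lambda>(p, b) q. if q = p then b else 0)"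
  define D where "D = \<delta> ` (P \<times> B)"
  have D: "finite D" "card D \<le> a * card P"
    using P B card_image_le[of "P \<times> B" \<delta>] by (auto simp: D_def card_cartesian_product mult.commute)
  have single: "\<delta> (p, u) \<in> F.span D" if "p \<in> P" "u \<in> U" for p u
  proof -
    have "u \<in> U.span B" using that B by simp
    then show ?thesis
    proof (induction rule: U.span_induct_alt)
      case base
      have "\<delta> (p, 0) = 0" by (auto simp: \<delta>_def fun_eq_iff)
      then show ?case using F.span_zero[of D] by (simp only:)
    next
      case (step c b u)
      have eq: "\<delta> (p, sc c b + u) = fun_scale sc c (\<delta> (p, b)) + \<delta> (p, u)"
        by (auto simp: \<delta>_def fun_eq_iff fun_scale_def)
      have "\<delta> (p, b) \<in> F.span D" using step that by (intro F.span_base) (auto simp: D_def)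
      from F.span_add[OF F.span_scale[OF this] step(2)] show ?case unfolding eq .
    qed
  qed
  have "res ` E \<subseteq> F.span D"
  proof
    fix h assume "h \<in> res ` E"
    then obtain f where f: "f \<in> E" "h = res f" by blast
    have "res f = (\<Sum>p\<in>P. \<delta> (p, f p))"
    proof
      fix q
      have "(\<Sum>p\<in>P. \<delta> (p, f p)) q = (\<Sum>p\<in>P. \<delta> (p, f p) q)"
        by (induction P rule: infinite_finite_induct) auto
      also have "\<dots> = (\<Sum>p\<in>P. if p = q then f q else 0)"
        by (intro sum.cong) (auto simp: \<delta>_def)
      also have "\<dots> = res f q" using P by (simp add: res_def)
      finally show "res f q = (\<Sum>p\<in>P. \<delta> (p, f p)) q" by simp
    qed
    also have "\<dots> \<in> F.span D"
      using E(1) f(1) val by (intro F.span_sum single) auto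
    finally show "h \<in> F.span D" using f(2) by simp
  qed
  from F.independent_span_bound[OF D(1) ind this]
  have "finite (res ` E)" "card (res ` E) \<le> card D" by auto
  moreover have "inj_on res E" using \<open>inj_on res (F.span E)\<close> F.span_superset inj_on_subset by blast
  ultimately show ?thesis using D(2) by (auto simp: card_image dest: finite_imageD)
qed

text \<open>The summands are the lines through a basis. For the trivial subgroup this shows that the
  set whose minimum is \<open>m\<close> is not empty.\<close>

lemma (in rep_module) semisimple_trivial_action:
  assumes triv: "\<And>g v. g \<in> carrier G \<Longrightarrow> v \<in> V \<Longrightarrow> act g v = v"
  shows "semisimple_module scale G act V"
proof -
  obtain B where B: "B \<subseteq> V" "independent B" "V \<subseteq> span B"
    by (rule maximal_independent_subset[of V])
  have spB: "span B = V" using span_minimal[OF B(1) subspace_V] B(3) by blast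
  have span_b: "span {b} \<subseteq> V" if "b \<in> B" for b
    using B(1) that by (intro span_minimal subspace_V) auto
  have nz: "b \<noteq> 0" if "b \<in> B" for b using B(2) that dependent_zero by blast
  have scaleE: "\<exists>c. v = scale c b" if "v \<in> span {b}" for v b
    using that by (auto simp: span_singleton)
  have bspan: "b \<in> span {b}" for b by (intro span_base) simp
  let ?S = "(\<lambda>b. span {b}) ` B"
  have "irreducible_submodule scale G act (span {b}) V" if b: "b \<in> B" for b
    unfolding irreducible_submodule_def
  proof (intro conjI allI impI)
    show "is_submodule scale G act (span {b}) V"
      using span_b[OF b] triv by (auto simp: is_submodule_def subspace_span)
    show "span {b} \<noteq> {0}" using bspan[of b] nz[OF b] by blast
    fix N assume N: "is_submodule scale G act N (span {b})"
    then have sN: "subspace N" "N \<subseteq> span {b}" by (auto simp: is_submodule_def)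
    show "N = {0} \<or> N = span {b}"
    proof (cases "N \<subseteq> {0}")
      case True
      then show ?thesis using subspace_0[OF sN(1)] by blast
    next
      case False
      then obtain v where v: "v \<in> N" "v \<noteq> 0" by blast
      then obtain c where c: "v = scale c b" using scaleE sN(2) by blast
      then have "scale (inverse c) v = b" using v by auto
      then have "b \<in> N" using subspace_scale[OF sN(1) v(1), of "inverse c"] by simp
      then have "span {b} \<subseteq> N" by (intro span_minimal sN(1)) simp
      then show ?thesis using sN(2) by blast
    qed
  qed
  moreover have "span {b} \<inter> span (\<Union>(?S - {span {b}})) = {0}" if b: "b \<in> B" for b
  proof -
    have "\<Union>(?S - {span {b}}) \<subseteq> span (B - {b})"
    proof
      fix v assume "v \<in> \<Union>(?S - {span {b}})"
      then obtain b' where b': "b' \<in> B" "v \<in> span {b'}" "span {b'} \<noteq> span {b}" by blast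
      then have "{b'} \<subseteq> B - {b}" by auto
      then show "v \<in> span (B - {b})" using b'(2) span_mono by blast
    qed
    then have sub: "span (\<Union>(?S - {span {b}})) \<subseteq> span (B - {b})"
      by (intro span_minimal subspace_span)
    have "v = 0" if v: "v \<in> span {b}" "v \<in> span (B - {b})" for v
    proof (rule ccontr)
      assume v0: "v \<noteq> 0"
      obtain c where c: "v = scale c b" using scaleE v(1) by blast
      then have "scale (inverse c) v = b" using v0 by auto
      then have "b \<in> span (B - {b})" using span_scale[OF v(2), of "inverse c"] by simp
      then show False using B(2) b unfolding dependent_def by blast
    qed
    then show ?thesis using sub span_zero by blast
  qed
  moreover have "span (\<Union>?S) = V"
  proof
    show "span (\<Union>?S) \<subseteq> V" using span_b by (intro span_minimal subspace_V) blast
    have "B \<subseteq> \<Union>?S" using bspan by blast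
    then show "V \<subseteq> span (\<Union>?S)" using span_mono B(3) by blast
  qed
  ultimately show ?thesis
    unfolding semisimple_module_def by (intro exI[of _ ?S]) auto
qed

text \<open>A smaller group generates smaller submodules; this carries the dimension bound for
  \<open>K'\<close> over to lists for \<open>K\<close>.\<close>

lemma indep_list_subgroup:
  assumes "indep_list sc (G\<lparr>carrier := K\<rparr>) act V vs" "L \<subseteq> K"
  shows "indep_list sc (G\<lparr>carrier := L\<rparr>) act V vs"
proof -
  have "generated_submodule sc (G\<lparr>carrier := L\<rparr>) act V S \<subseteq> generated_submodule sc (G\<lparr>carrier := K\<rparr>) act V S" for S
    unfolding generated_submodule_def hull_def using assms(2) by (auto simp: is_submodule_def subset_iff)
  then show ?thesis using assms(1) unfolding indep_list_def by blast
qed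

lemma min_card_nonneg: "0 \<le> x \<Longrightarrow> 0 \<le> min_card x Os"
  by (simp add: min_card_def)

section \<open>Cores, and vectors fixed by a subgroup\<close>

context group
begin

lemma mem_core_iff:
  assumes H: "subgroup H G"
  shows "k \<in> core G H \<longleftrightarrow> k \<in> carrier G \<and> (\<forall>g\<in>carrier G. inv g \<otimes> k \<otimes> g \<in> H)"
proof -
  have HG: "h \<in> H \<Longrightarrow> h \<in> carrier G" for h using subgroup.mem_carrier[OF H] .
  have iff: "k \<in> g <# H #> inv g \<longleftrightarrow> k \<in> carrier G \<and> inv g \<otimes> k \<otimes> g \<in> H" if g: "g \<in> carrier G" for g
  proof
    assume "k \<in> g <# H #> inv g"
    then obtain h where h: "h \<in> H" "k = g \<otimes> h \<otimes> inv g" by (auto simp: l_coset_def r_coset_def)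
    have "inv g \<otimes> k \<otimes> g = h" using h g HG by (simp add: group_normalize)
    then show "k \<in> carrier G \<and> inv g \<otimes> k \<otimes> g \<in> H" using h g HG by simp
  next
    assume k: "k \<in> carrier G \<and> inv g \<otimes> k \<otimes> g \<in> H"
    then have "k = g \<otimes> (inv g \<otimes> k \<otimes> g) \<otimes> inv g" using g by (simp add: group_normalize)
    then show "k \<in> g <# H #> inv g" using k unfolding l_coset_def r_coset_def by blast
  qed
  show ?thesis
  proof
    assume "k \<in> core G H"
    then have "k \<in> g <# H #> inv g" if "g \<in> carrier G" for g using that by (auto simp: core_def)
    then show "k \<in> carrier G \<and> (\<forall>g\<in>carrier G. inv g \<otimes> k \<otimes> g \<in> H)" using iff by blast
  qed (auto simp: core_def iff)
qed

lemma core_subset: "subgroup H G \<Longrightarrow> core G H \<subseteq> H"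
  using mem_core_iff[of H] by (metis inv_one l_one one_closed r_one subsetI)

lemma core_normal:
  assumes H: "subgroup H G" and "g \<in> carrier G" "k \<in> core G H"
  shows "g \<otimes> k \<otimes> inv g \<in> core G H"
proof -
  have k: "k \<in> carrier G" and conj: "\<And>g. g \<in> carrier G \<Longrightarrow> inv g \<otimes> k \<otimes> g \<in> H"
    using assms(3) mem_core_iff[OF H] by auto
  have "inv g' \<otimes> (g \<otimes> k \<otimes> inv g) \<otimes> g' \<in> H" if g': "g' \<in> carrier G" for g'
    using conj[of "inv g \<otimes> g'"] g' assms(2) k by (simp add: group_normalize)
  then show ?thesis using mem_core_iff[OF H] k assms(2) by simp
qed

lemma core_subgroup:
  assumes H: "subgroup H G"
  shows "subgroup (core G H) G"
proof (rule subgroupI)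
  have "\<one> \<in> core G H"
    using subgroup.one_closed[OF H] by (auto simp: mem_core_iff[OF H])
  then show "core G H \<noteq> {}" by blast
next
  fix a assume "a \<in> core G H"
  then have a: "a \<in> carrier G" "\<And>g. g \<in> carrier G \<Longrightarrow> inv g \<otimes> a \<otimes> g \<in> H"
    using mem_core_iff[OF H] by auto
  have "inv g \<otimes> inv a \<otimes> g \<in> H" if g: "g \<in> carrier G" for g
    using subgroup.m_inv_closed[OF H a(2)[OF g]] g a(1) by (simp add: group_normalize)
  then show "inv a \<in> core G H" using a(1) by (simp add: mem_core_iff[OF H])
next
  fix a b assume "a \<in> core G H" "b \<in> core G H"
  then have a: "a \<in> carrier G" "\<And>g. g \<in> carrier G \<Longrightarrow> inv g \<otimes> a \<otimes> g \<in> H"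
    and b: "b \<in> carrier G" "\<And>g. g \<in> carrier G \<Longrightarrow> inv g \<otimes> b \<otimes> g \<in> H"
    using mem_core_iff[OF H] by auto
  have "inv g \<otimes> (a \<otimes> b) \<otimes> g \<in> H" if g: "g \<in> carrier G" for g
    using subgroup.m_closed[OF H a(2)[OF g] b(2)[OF g]] g a(1) b(1) by (simp add: group_normalize)
  then show "a \<otimes> b \<in> core G H" using a(1) b(1) by (simp add: mem_core_iff[OF H])
qed (simp add: mem_core_iff[OF H] subset_iff)

lemma num_orbits_le_card:
  assumes "finite \<Sigma>"
  shows "num_orbits G Q \<Sigma> \<phi> \<le> card \<Sigma>"
proof -
  have "orbits (G\<lparr>carrier := Q\<rparr>) \<Sigma> \<phi> = (\<lambda>x. orbit (G\<lparr>carrier := Q\<rparr>) \<phi> x) ` \<Sigma>"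
    by (auto simp: orbits_def)
  then show ?thesis unfolding num_orbits_def using card_image_le[OF assms] by simp
qed

text \<open>A function fixed by \<open>Q\<close> is invariant under right translation by
  \<open>Q\<close>, and its behaviour under \<open>H1\<close> on the left is prescribed. One value
  for each orbit of \<open>Q\<close> on the cosets of \<open>H1\<close> therefore determines
  it.\<close>

lemma card_fixed_functions_le:
  fixes sc :: "'f::field \<Rightarrow> 'u::ab_group_add \<Rightarrow> 'u"
  assumes fin: "finite (carrier G)" and H: "subgroup H G" and H1: "subgroup H1 (G\<lparr>carrier := H\<rparr>)"
    and U: "rep_module (G\<lparr>carrier := H1\<rparr>) sc actU U" "has_dim sc U a"
    and Q: "subgroup Q G" "Q \<subseteq> H"
    and E: "E \<subseteq> induced (G\<lparr>carrier := H\<rparr>) H1 actU U"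
      "\<And>v q. v \<in> E \<Longrightarrow> q \<in> Q \<Longrightarrow> induced_act (G\<lparr>carrier := H\<rparr>) q v = v"
      "\<not> Modules.module.dependent (fun_scale sc) E"
  shows "finite E \<and> card E \<le> a * num_orbits G Q (rcosets\<^bsub>G\<lparr>carrier := H\<rparr>\<^esub> H1) (coset_act G)"
proof -
  let ?GH = "G\<lparr>carrier := H\<rparr>"
  let ?\<Omega> = "rcosets\<^bsub>?GH\<^esub> H1"
  interpret GH: group ?GH by (rule subgroup.subgroup_is_group[OF H group_axioms])
  interpret U: rep_module "G\<lparr>carrier := H1\<rparr>" sc actU U by (rule U(1))
  have HG: "h \<in> H \<Longrightarrow> h \<in> carrier G" for h using subgroup.mem_carrier[OF H] .
  have H1H: "h \<in> H1 \<Longrightarrow> h \<in> H" for h using subgroup.mem_carrier[OF H1] by simp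
  have H1G: "subgroup H1 G" by (rule incl_subgroup[OF H H1])
  have rc: "H1 #>\<^bsub>?GH\<^esub> h = H1 #> h" for h by (simp add: r_coset_def)
  have \<Omega>: "?\<Omega> = (\<lambda>h. H1 #> h) ` H" by (auto simp: RCOSETS_def rc)
  interpret V: rep_module ?GH "fun_scale sc" "induced_act ?GH" "induced ?GH H1 actU U"
    using rep_module_induced[OF GH.group_axioms H1, of sc actU U] U(1) by simp
  define Os where "Os = orbits (G\<lparr>carrier := Q\<rparr>) ?\<Omega> (coset_act G)"
  have "finite H" using finite_subset[OF subgroup.subset[OF H] fin] .
  then have finO: "finite Os"
    by (simp add: Os_def orbits_def \<Omega> setcompr_eq_image)
  have "\<forall>C\<in>Os. \<exists>p. p \<in> H \<and> H1 #> p \<in> C"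
  proof
    fix C' assume "C' \<in> Os"
    then obtain h where h: "h \<in> H" "C' = orbit (G\<lparr>carrier := Q\<rparr>) (coset_act G) (H1 #> h)"
      by (auto simp: Os_def orbits_def \<Omega>)
    have "coset_act G \<one> (H1 #> h) = H1 #> h" using coset_act_rcoset[OF H1G one_closed HG[OF h(1)]] HG[OF h(1)] by simp
    then have "H1 #> h \<in> C'" using subgroup.one_closed[OF Q(1)] unfolding h(2) orbit_def by force
    then show "\<exists>p. p \<in> H \<and> H1 #> p \<in> C'" using h(1) by blast
  qed
  then obtain p where p: "\<forall>C\<in>Os. p C \<in> H \<and> H1 #> p C \<in> C" by (rule bchoice[THEN exE])
  define Y where "Y = {f \<in> induced ?GH H1 actU U. \<forall>q\<in>Q. induced_act ?GH q f = f}"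
  have "finite E \<and> card E \<le> a * card (p ` Os)"
  proof (rule card_independent_functions_le[OF U.vector_space_axioms U(2)])
    show "finite (p ` Os)" using finO by simp
    show "V.subspace Y"
      unfolding V.subspace_def Y_def
      using Q(2) V.subspace_0[OF V.subspace_V] V.subspace_add[OF V.subspace_V] V.subspace_scale[OF V.subspace_V]
        V.act_add V.act_scale V.act_zero by (auto simp: subset_iff)
    show "f x \<in> U" if "f \<in> Y" "x \<in> p ` Os" for f x
      using that p by (auto simp: Y_def induced_def)
    show "E \<subseteq> Y" using E(1,2) by (auto simp: Y_def)
    show "\<not> V.dependent E" by (rule E(3))
    fix f assume f: "f \<in> Y" and z: "\<And>x. x \<in> p ` Os \<Longrightarrow> f x = 0"
    have fV: "f \<in> induced ?GH H1 actU U" using f by (simp add: Y_def)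
    show "f = 0"
    proof
      fix h show "f h = 0 h"
      proof (cases "h \<in> H")
        case False
        then show ?thesis using fV by (simp add: induced_def)
      next
        case True
        let ?C = "orbit (G\<lparr>carrier := Q\<rparr>) (coset_act G) (H1 #> h)"
        have C: "?C \<in> Os" using True by (auto simp: Os_def orbits_def \<Omega>)
        define x where "x = p ?C"
        have x: "x \<in> H" "H1 #> x \<in> ?C" "f x = 0" using p z C by (auto simp: x_def)
        obtain q where q: "q \<in> Q" "H1 #> x = coset_act G q (H1 #> h)" using x(2) by (auto simp: orbit_def)
        have qG: "q \<in> carrier G" using subgroup.mem_carrier[OF Q(1) q(1)] .
        have "x \<in> H1 #> (h \<otimes> inv q)"
          using q(2) coset_act_rcoset[OF H1G qG HG[OF True]] rcos_self[OF HG[OF x(1)] H1G] by simp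
        then obtain k where k: "k \<in> H1" "x = k \<otimes> (h \<otimes> inv q)" by (auto simp: r_coset_def)
        have kG: "k \<in> carrier G" using k(1) H1H HG by blast
        have "h = inv k \<otimes> (x \<otimes> q)" using k(2) kG qG HG[OF True] by (simp add: group_normalize)
        moreover have ik: "inv k \<in> H1" by (rule subgroup.m_inv_closed[OF H1G k(1)])
        moreover have "x \<otimes> q \<in> H" using subgroup.m_closed[OF H x(1)] q(1) Q(2) by blast
        ultimately have "f h = actU (inv k) (f (x \<otimes> q))"
          using fV by (simp add: induced_def)
        also have "f (x \<otimes> q) = induced_act ?GH q f x" using x(1) by (simp add: induced_act_def)
        also have "\<dots> = 0" using f q(1) x(3) by (simp add: Y_def)
        finally show ?thesis using U.act_zero[of "inv k"] ik by simp
      qed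
    qed
  qed
  moreover have "card (p ` Os) \<le> card Os" by (rule card_image_le[OF finO])
  ultimately show ?thesis
    unfolding num_orbits_def Os_def[symmetric] using mult_le_mono2 order_trans by blast
qed

end

section \<open>The bound\<close>

theorem theorem4p13:
  fixes G :: "('g, 'r) monoid_scheme"
    and H H1 K K' :: "'g set"
    and scale :: "'f::field \<Rightarrow> 'u::ab_group_add \<Rightarrow> 'u"
    and actU :: "'g \<Rightarrow> 'u \<Rightarrow> 'u" and U :: "'u set"
    and actV :: "'g \<Rightarrow> ('g \<Rightarrow> 'u) \<Rightarrow> 'g \<Rightarrow> 'u" and V :: "('g \<Rightarrow> 'u) set"
    and actW :: "'g \<Rightarrow> ('g \<Rightarrow> 'g \<Rightarrow> 'u) \<Rightarrow> 'g \<Rightarrow> 'g \<Rightarrow> 'u" and W M :: "('g \<Rightarrow> 'g \<Rightarrow> 'u) set"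
    and \<Omega> \<Omega>1 :: "'g set set"
    and a d s m dM :: nat and R X b :: real
  assumes "group G" and "finite (carrier G)"
    and "subgroup H G" and "\<Omega> = rcosets\<^bsub>G\<^esub> H" and "s = card \<Omega>" and "s \<ge> 2"
    and "subgroup H1 (G\<lparr>carrier := H\<rparr>)" and "\<Omega>1 = rcosets\<^bsub>G\<lparr>carrier := H\<rparr>\<^esub> H1"
    and "d = card \<Omega>1" and "d \<ge> 1"
    and "rep_module (G\<lparr>carrier := H1\<rparr>) scale actU U" and "has_dim scale U a"
    and "V = induced (G\<lparr>carrier := H\<rparr>) H1 actU U" and "actV = induced_act (G\<lparr>carrier := H\<rparr>)"
    and "W = induced G H actV V" and "actW = induced_act G"
    and "K = core G H" and "subgroup K' (G\<lparr>carrier := K\<rparr>)"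
    and "m = Min {num_orbits G Q \<Omega>1 (coset_act G) | Q.
                    subgroup Q (G\<lparr>carrier := K'\<rparr>) \<and>
                    semisimple_module (fun_scale scale) (G\<lparr>carrier := Q\<rparr>) actV V}"
    and "has_soluble_transitive_subgroup \<Omega> (coset_perm_group G H)"
    and "is_submodule (fun_scale (fun_scale scale)) G actW M W"
    and "R = real (rep_min_dim TYPE('f) (G\<lparr>carrier := K'\<rparr>))"
    and "X = min_card ((real a * real d - real a * real m) / R + real a * real m)
                      (orbits (G\<lparr>carrier := K\<rparr>) (V - {0}) actV)"
    and "b = sqrt (2 / pi)"
    and "dM = min_generators (fun_scale (fun_scale scale)) G actW M"
  shows "real dM \<le> X * omega_tilde s \<and>
         (s \<notin> {3, 6} \<longrightarrow>
            X * omega_tilde s \<le> X * real_of_int \<lfloor>b * real s / sqrt (log 2 (real s))\<rfloor>) \<and>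
         real dM \<le> X * real_of_int \<lfloor>b * real s / sqrt (log 2 (real s))\<rfloor> \<and>
         (\<forall>p t. prime (p::nat) \<and> s = p ^ t \<longrightarrow>
            real dM \<le> X * real_of_int \<lfloor>b * real (p ^ t) / sqrt (real (t * (p - 1)))\<rfloor>)"
proof -
  interpret group G by fact
  note fin = \<open>finite (carrier G)\<close> and H = \<open>subgroup H G\<close>
  let ?GH = "G\<lparr>carrier := H\<rparr>"
  interpret GH: group ?GH by (rule subgroup.subgroup_is_group[OF H group_axioms])
  note H1 = \<open>subgroup H1 ?GH\<close> and U = \<open>rep_module (G\<lparr>carrier := H1\<rparr>) scale actU U\<close> \<open>has_dim scale U a\<close>
  have repV: "rep_module ?GH (fun_scale scale) actV V"
    unfolding \<open>V = _\<close> \<open>actV = _\<close>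
    using rep_module_induced[OF GH.group_axioms H1, of scale actU U] U(1) by simp
  have K: "subgroup K G" "K \<subseteq> H" unfolding \<open>K = _\<close> by (rule core_subgroup[OF H], rule core_subset[OF H])
  have K': "subgroup K' G" "K' \<subseteq> K"
    using incl_subgroup[OF K(1) \<open>subgroup K' (G\<lparr>carrier := K\<rparr>)\<close>]
      subgroup.subset[OF \<open>subgroup K' (G\<lparr>carrier := K\<rparr>)\<close>] by auto
  have repK: "rep_module (G\<lparr>carrier := K\<rparr>) (fun_scale scale) actV V"
    by (rule rep_module_restrict[OF repV K(2) subgroup.subgroup_is_group[OF K(1) group_axioms]])
  have "K' \<subseteq> H" using K'(2) K(2) by blast
  have repK': "rep_module (G\<lparr>carrier := K'\<rparr>) (fun_scale scale) actV V"
    by (rule rep_module_restrict[OF repV \<open>K' \<subseteq> H\<close> subgroup.subgroup_is_group[OF K'(1) group_axioms]])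
  interpret V: rep_module ?GH "fun_scale scale" actV V by (rule repV)
  interpret VK: rep_module "G\<lparr>carrier := K\<rparr>" "fun_scale scale" actV V by (rule repK)
  interpret VK': rep_module "G\<lparr>carrier := K'\<rparr>" "fun_scale scale" actV V by (rule repK')
  have fin\<Omega>1: "finite \<Omega>1"
    using finite_subset[OF subgroup.subset[OF H] fin] unfolding \<open>\<Omega>1 = _\<close> by (auto simp: RCOSETS_def)
  have fixed: "finite E \<and> card E \<le> a * num_orbits G Q \<Omega>1 (coset_act G)"
    if "subgroup Q G" "Q \<subseteq> H" "E \<subseteq> V" "\<And>v q. v \<in> E \<Longrightarrow> q \<in> Q \<Longrightarrow> actV q v = v" "V.independent E" for Q E
    using card_fixed_functions_le[OF fin H H1 U that(1,2), of E] that(3-5)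
    unfolding \<open>V = _\<close> \<open>actV = _\<close> \<open>\<Omega>1 = _\<close> by blast
  have one: "subgroup {\<one>\<^bsub>G\<^esub>} G" by (rule triv_subgroup)
  have oneH: "{\<one>\<^bsub>G\<^esub>} \<subseteq> H" using subgroup.one_closed[OF H] by simp
  \<comment> \<open>With the trivial group as \<open>Q\<close> every vector is fixed and there are
    at most \<open>d\<close> orbits, so the bound for fixed vectors bounds the dimension of
    \<open>V\<close>.\<close>
  have fd: "finite E \<and> card E \<le> a * d" if E: "E \<subseteq> V" "V.independent E" for E
  proof -
    have "finite E \<and> card E \<le> a * num_orbits G {\<one>\<^bsub>G\<^esub>} \<Omega>1 (coset_act G)"
      using E(1) V.act_one by (intro fixed[OF one oneH E(1) _ E(2)]) auto
    moreover have "num_orbits G {\<one>\<^bsub>G\<^esub>} \<Omega>1 (coset_act G) \<le> d"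
      unfolding \<open>d = _\<close> by (rule num_orbits_le_card[OF fin\<Omega>1])
    ultimately show ?thesis using mult_le_mono2 order_trans by blast
  qed
  define \<M> where "\<M> = {num_orbits G Q \<Omega>1 (coset_act G) | Q.
      subgroup Q (G\<lparr>carrier := K'\<rparr>) \<and> semisimple_module (fun_scale scale) (G\<lparr>carrier := Q\<rparr>) actV V}"
  have m: "m = Min \<M>" using \<open>m = _\<close> unfolding \<M>_def .
  have "\<M> \<subseteq> {..card \<Omega>1}" using num_orbits_le_card[OF fin\<Omega>1] by (auto simp: \<M>_def)
  then have fin\<M>: "finite \<M>" by (rule finite_subset) simp
  have "num_orbits G {\<one>\<^bsub>G\<^esub>} \<Omega>1 (coset_act G) \<in> \<M>"
  proof -
    have "subgroup {\<one>\<^bsub>G\<^esub>} (G\<lparr>carrier := K'\<rparr>)"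
      using subgroup_incl[OF one K'(1)] subgroup.one_closed[OF K'(1)] by simp
    moreover interpret V1: rep_module "G\<lparr>carrier := {\<one>\<^bsub>G\<^esub>}\<rparr>" "fun_scale scale" actV V
      by (rule rep_module_restrict[OF repV oneH subgroup.subgroup_is_group[OF one group_axioms]])
    have "semisimple_module (fun_scale scale) (G\<lparr>carrier := {\<one>\<^bsub>G\<^esub>}\<rparr>) actV V"
      using V.act_one by (intro V1.semisimple_trivial_action) auto
    ultimately show ?thesis unfolding \<M>_def by blast
  qed
  then have "m \<in> \<M>" unfolding m using fin\<M> by (intro Min_in) auto
  then obtain Q where Q: "m = num_orbits G Q \<Omega>1 (coset_act G)" "subgroup Q (G\<lparr>carrier := K'\<rparr>)"
    "semisimple_module (fun_scale scale) (G\<lparr>carrier := Q\<rparr>) actV V" unfolding \<M>_def by blast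
  have QG: "subgroup Q G" by (rule incl_subgroup[OF K'(1) Q(2)])
  have QH: "Q \<subseteq> H" using subgroup.subset[OF Q(2)] K'(2) K(2) by auto
  have md: "m \<le> d" unfolding Q(1) \<open>d = _\<close> by (rule num_orbits_le_card[OF fin\<Omega>1])
  define X1 where "X1 = (real a * real d - real a * real m) / R + real a * real m"
  define Os where "Os = orbits (G\<lparr>carrier := K\<rparr>) (V - {0}) actV"
  have X: "X = min_card X1 Os" unfolding \<open>X = _\<close> X1_def Os_def ..
  have "real a * real m \<le> real a * real d" using md by (intro mult_left_mono) auto
  then have "0 \<le> X1" unfolding X1_def \<open>R = _\<close> by simp
  then have X0: "0 \<le> X" unfolding X by (rule min_card_nonneg)
  have length_le: "real (length vs) \<le> X" if vs: "indep_list (fun_scale scale) (G\<lparr>carrier := K\<rparr>) actV V vs" for vs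
  proof -
    have "real (length vs) \<le> (real (a * d) - real (a * m)) / real (rep_min_dim TYPE('f) (G\<lparr>carrier := K'\<rparr>)) + real (a * m)"
    proof (rule VK'.indep_list_length_le_dim[OF fd Q(2)])
      show "semisimple_module (fun_scale scale) (G\<lparr>carrier := K', carrier := Q\<rparr>) actV V" using Q(3) by simp
      show "card E \<le> a * m"
        if "E \<subseteq> V" "\<And>v g. v \<in> E \<Longrightarrow> g \<in> Q \<Longrightarrow> actV g v = v" "V.independent E" for E
        using fixed[OF QG QH that] unfolding Q(1) by blast
      show "indep_list (fun_scale scale) (G\<lparr>carrier := K'\<rparr>) actV V vs" by (rule indep_list_subgroup[OF vs K'(2)])
      show "a * m \<le> a * d" using md by simp
    qed
    then have "real (length vs) \<le> X1" by (simp add: X1_def \<open>R = _\<close>)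
    moreover have "length vs \<le> card Os" if "finite Os"
      using VK.indep_list_length_le_orbits[OF vs] that unfolding Os_def by blast
    ultimately show ?thesis by (simp add: X min_card_def)
  qed
  \<comment> \<open>Lengths of lists are integers, so the real bound \<open>X\<close> may be rounded
    down to supply the natural number in \<open>min_generators_le\<close>.\<close>
  define n where "n = nat \<lfloor>X\<rfloor>"
  have n: "real n \<le> X" using X0 by (simp add: n_def)
  have length_le_n: "length vs \<le> n" if "indep_list (fun_scale scale) (G\<lparr>carrier := K\<rparr>) actV V vs" for vs
    using length_le[OF that] by (simp add: n_def le_nat_floor)
  have s: "s = card (rcosets\<^bsub>G\<^esub> H)" using \<open>s = _\<close> \<open>\<Omega> = _\<close> by simp
  obtain x :: "nat \<Rightarrow> 'g" and col :: "nat \<Rightarrow> nat list" where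
    x: "\<And>i. i < s \<Longrightarrow> x i \<in> carrier G"
      "\<And>g. g \<in> carrier G \<Longrightarrow> \<exists>!i. i < s \<and> g \<otimes>\<^bsub>G\<^esub> inv\<^bsub>G\<^esub> (x i) \<in> H"
      "\<And>i j k l. i \<le> j \<Longrightarrow> j < k \<Longrightarrow> k < s \<Longrightarrow> l < s \<Longrightarrow> col i = col j \<Longrightarrow>
           x k \<otimes>\<^bsub>G\<^esub> inv\<^bsub>G\<^esub> (x j) \<otimes>\<^bsub>G\<^esub> x i \<otimes>\<^bsub>G\<^esub> inv\<^bsub>G\<^esub> (x l) \<in> H \<Longrightarrow> i < l"
    and col: "real (card (col ` {..<s})) \<le> omega_tilde s"
    using soluble_transversal[OF fin H] \<open>has_soluble_transitive_subgroup \<Omega> (coset_perm_group G H)\<close>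
    unfolding \<open>\<Omega> = _\<close> s by blast
  interpret ladder_module G H "fun_scale scale" actV V K x s col
  proof (intro ladder_module.intro ladder_module_axioms.intro group_axioms repV H K(2))
    show "\<And>g. g \<in> carrier G \<Longrightarrow> \<exists>i<s. g \<otimes>\<^bsub>G\<^esub> inv\<^bsub>G\<^esub> (x i) \<in> H" using x(2) by blast
    show "group (G\<lparr>carrier := K\<rparr>)" by (rule subgroup.subgroup_is_group[OF K(1) group_axioms])
    show "\<And>g h. g \<in> carrier G \<Longrightarrow> h \<in> K \<Longrightarrow> g \<otimes>\<^bsub>G\<^esub> h \<otimes>\<^bsub>G\<^esub> inv\<^bsub>G\<^esub> g \<in> K"
      using core_normal[OF H] unfolding \<open>K = _\<close> .
  qed (fact x(1) x(3))+
  define w where "w = card (col ` {..<s})"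
  have dMw: "real dM \<le> X * real w"
  proof -
    have "dM \<le> n * w"
      using min_generators_le[of M n] length_le_n \<open>is_submodule _ G actW M W\<close>
      unfolding \<open>dM = _\<close> \<open>W = _\<close> \<open>actW = _\<close> w_def by blast
    then have "real dM \<le> real n * real w" by (metis of_nat_le_iff of_nat_mult)
    also have "\<dots> \<le> X * real w" using n by (intro mult_right_mono) auto
    finally show ?thesis .
  qed
  have w: "real w \<le> omega_tilde s" using col by (simp add: w_def)
  \<comment> \<open>Rounding down is applied to \<open>y\<close> against the integer
    \<open>w\<close>, not against \<open>omega_tilde s\<close>, and so covers the cases 3 and 6 as
    well.\<close>
  have bound: "real dM \<le> X * real_of_int \<lfloor>y\<rfloor>" if "omega_tilde s \<le> y" for y
  proof -
    have "int w \<le> \<lfloor>y\<rfloor>" using w that by (simp add: le_floor_iff)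
    then have "real w \<le> real_of_int \<lfloor>y\<rfloor>" by linarith
    then have "X * real w \<le> X * real_of_int \<lfloor>y\<rfloor>" using X0 by (rule mult_left_mono)
    then show ?thesis using dMw by linarith
  qed
  note s2 = \<open>s \<ge> 2\<close> and b = \<open>b = sqrt (2 / pi)\<close>
  show ?thesis
  proof (intro conjI allI impI)
    show "real dM \<le> X * omega_tilde s" using dMw mult_left_mono[OF w X0] by linarith
    show "X * omega_tilde s \<le> X * real_of_int \<lfloor>b * real s / sqrt (log 2 (real s))\<rfloor>" if "s \<notin> {3, 6}"
      using omega_tilde_le_floor[OF s2] that X0 unfolding b by (intro mult_left_mono) auto
    show "real dM \<le> X * real_of_int \<lfloor>b * real s / sqrt (log 2 (real s))\<rfloor>"
      using bound[OF omega_tilde_le_log[OF s2]] unfolding b .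
    show "real dM \<le> X * real_of_int \<lfloor>b * real (p ^ t) / sqrt (real (t * (p - 1)))\<rfloor>"
      if "prime p \<and> s = p ^ t" for p t
    proof -
      have "K_fun s = t * (p - 1)" "s = p ^ t" using that K_fun_prime_power by auto
      then show ?thesis using bound[OF omega_tilde_le[OF s2]] unfolding b by simp
    qed
  qed
qed

end
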